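(* Let $\mathcal A$ be an essential arrangement of affine hyperplanes in a finite-dimensional complex vector space $V$. Then the poset of layers $\mathcal P(\mathcal A)$ is supersolvable if and only if $\mathcal A$ is fiber-type.
   Context: An affine hyperplane arrangement is a finite set $\mathcal A$ of affine hyperplanes in $V$; its complement is $M(\mathcal A)=V\setminus\bigcup_{H\in\mathcal A}H$. It is essential if the linear parts of the defining affine functionals span the dual space $V^*$. Its poset of layers $\mathcal P(\mathcal A)$ is the set of nonempty intersections of subsets of $\mathcal A$ (including $V$), ordered by reverse inclusion; it is a geometric semilattice, in particular a locally geometric poset (graded, bounded below, each $\mathcal P_{\le x}$ a geometric lattice). Fiber-type (inductive): $\mathcal A$ is fiber-type if $\dim V=1$, or there is a choice of coordinates $V\cong\mathbb C^n$ and a fiber-type affine arrangement $\mathcal B$ in $\mathbb C^{n-1}$ such that the projection $\mathbb C^n\to\mathbb C^{n-1}$ onto the first $n-1$ coordinates restricts to a fiber bundle $M(\mathcal A)\to M(\mathcal B)$ whose fibers are homeomorphic to $\mathbb C$ with finitely many points removed. Supersolvability: $x\vee y$ is the set of minimal common upper bounds. An element of a geometric lattice is modular if its complements form an antichain. An order ideal $\mathcal Q$ is pure if its maximal elements share a rank $\operatorname{rk}(\mathcal Q)$, join-closed if it contains all minimal upper bounds of its subsets. An M-ideal of $\mathcal P$ is a pure join-closed order ideal $\mathcal Q$ with (M1) if $y\in\mathcal Q$, $a$ an atom, $a\vee y=\emptyset$, then $a\in\mathcal Q$; (M2) for every maximal $x\in\mathcal P$ some maximal $y\in\mathcal Q$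 is modular in $\mathcal P_{\le x}$. $\mathcal P$ is supersolvable if there is a chain $\{\hat0\}=\mathcal Q_0\subset\cdots\subset\mathcal Q_n=\mathcal P$ with each $\mathcal Q_i$ an M-ideal of $\mathcal Q_{i+1}$ and $\operatorname{rk}(\mathcal Q_i)=i$. *)

theory Defs
  imports "HOL-Analysis.Analysis" "HOL-Library.Function_Algebras"
begin

section \<open>Supersolvable posets\<close>

text \<open>Posets are given by a carrier \<open>P\<close> and an order \<open>le\<close>, which is only used on \<open>P\<close>.\<close>

definition bottom_of :: "'a set \<Rightarrow> ('a \<Rightarrow> 'a \<Rightarrow> bool) \<Rightarrow> 'a \<Rightarrow> bool" where
  "bottom_of P le b \<longleftrightarrow> b \<in> P \<and> (\<forall>x\<in>P. le b x)"

definition maximals :: "'a set \<Rightarrow> ('a \<Rightarrow> 'a \<Rightarrow> bool) \<Rightarrow> 'a set" where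
  "maximals P le = {x \<in> P. \<forall>y\<in>P. le x y \<longrightarrow> y = x}"

definition minimals :: "'a set \<Rightarrow> ('a \<Rightarrow> 'a \<Rightarrow> bool) \<Rightarrow> 'a set" where
  "minimals P le = {x \<in> P. \<forall>y\<in>P. le y x \<longrightarrow> y = x}"

definition joins :: "'a set \<Rightarrow> ('a \<Rightarrow> 'a \<Rightarrow> bool) \<Rightarrow> 'a set \<Rightarrow> 'a set" where
  "joins P le S = minimals {u \<in> P. \<forall>s\<in>S. le s u} le"

definition meets :: "'a set \<Rightarrow> ('a \<Rightarrow> 'a \<Rightarrow> bool) \<Rightarrow> 'a set \<Rightarrow> 'a set" where
  "meets P le S = maximals {l \<in> P. \<forall>s\<in>S. le l s} le"

definition below :: "'a set \<Rightarrow> ('a \<Rightarrow> 'a \<Rightarrow> bool) \<Rightarrow> 'a \<Rightarrow> 'a set" where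
  "below P le x = {y \<in> P. le y x}"

definition atoms :: "'a set \<Rightarrow> ('a \<Rightarrow> 'a \<Rightarrow> bool) \<Rightarrow> 'a set" where
  "atoms P le = minimals {a \<in> P. \<not> bottom_of P le a} le"

definition elem_rank :: "'a set \<Rightarrow> ('a \<Rightarrow> 'a \<Rightarrow> bool) \<Rightarrow> 'a \<Rightarrow> nat" where
  "elem_rank P le x =
     Max {card C | C. finite C \<and> C \<subseteq> below P le x \<and> Complete_Partial_Order.chain le C} - 1"

definition pure :: "'a set \<Rightarrow> ('a \<Rightarrow> 'a \<Rightarrow> bool) \<Rightarrow> bool" where
  "pure P le \<longleftrightarrow> (\<exists>r. \<forall>x\<in>maximals P le. elem_rank P le x = r)"

text \<open>For pure \<open>P\<close> the maximum is over a single value, the common rank of the maximal elements.\<close>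

definition poset_rank :: "'a set \<Rightarrow> ('a \<Rightarrow> 'a \<Rightarrow> bool) \<Rightarrow> nat" where
  "poset_rank P le = Max (elem_rank P le ` maximals P le)"

definition order_ideal :: "'a set \<Rightarrow> ('a \<Rightarrow> 'a \<Rightarrow> bool) \<Rightarrow> 'a set \<Rightarrow> bool" where
  "order_ideal P le Q \<longleftrightarrow> Q \<subseteq> P \<and> (\<forall>y\<in>Q. \<forall>x\<in>P. le x y \<longrightarrow> x \<in> Q)"

definition join_closed :: "'a set \<Rightarrow> ('a \<Rightarrow> 'a \<Rightarrow> bool) \<Rightarrow> 'a set \<Rightarrow> bool" where
  "join_closed P le Q \<longleftrightarrow> (\<forall>S\<subseteq>Q. joins P le S \<subseteq> Q)"

text \<open>In a bounded poset \<open>maximals L le\<close> and \<open>minimals L le\<close> are the singletons of top and bottom.\<close>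

definition complements :: "'a set \<Rightarrow> ('a \<Rightarrow> 'a \<Rightarrow> bool) \<Rightarrow> 'a \<Rightarrow> 'a set" where
  "complements L le y =
     {z \<in> L. joins L le {y, z} = maximals L le \<and> meets L le {y, z} = minimals L le}"

definition modular_in :: "'a set \<Rightarrow> ('a \<Rightarrow> 'a \<Rightarrow> bool) \<Rightarrow> 'a \<Rightarrow> bool" where
  "modular_in L le y \<longleftrightarrow> y \<in> L \<and>
     (\<forall>z\<in>complements L le y. \<forall>w\<in>complements L le y. le z w \<longrightarrow> z = w)"

definition M_ideal :: "'a set \<Rightarrow> ('a \<Rightarrow> 'a \<Rightarrow> bool) \<Rightarrow> 'a set \<Rightarrow> bool" where
  "M_ideal P le Q \<longleftrightarrow>
     order_ideal P le Q \<and> pure Q le \<and> join_closed P le Q \<and>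
     (\<forall>y\<in>Q. \<forall>a\<in>atoms P le. joins P le {a, y} = {} \<longrightarrow> a \<in> Q) \<and>
     (\<forall>x\<in>maximals P le. \<exists>y\<in>maximals Q le. modular_in (below P le x) le y)"

definition supersolvable :: "'a set \<Rightarrow> ('a \<Rightarrow> 'a \<Rightarrow> bool) \<Rightarrow> bool" where
  "supersolvable P le \<longleftrightarrow>
     (\<exists>n Q. (\<exists>b. bottom_of P le b \<and> Q 0 = {b}) \<and> Q n = P \<and>
            (\<forall>i<n. Q i \<subset> Q (Suc i) \<and> M_ideal (Q (Suc i)) le (Q i)) \<and>
            (\<forall>i\<le>n. poset_rank (Q i) le = i))"


section \<open>Affine hyperplane arrangements\<close>

text \<open>
  The ambient space of an arrangement is a subspace \<open>V\<close> of a complex vector space with scalar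
  multiplication \<open>s\<close>: the whole type for an abstract vector space, or \<open>Cn n\<close> below.
\<close>

definition affine_hyperplane ::
  "(complex \<Rightarrow> 'v::ab_group_add \<Rightarrow> 'v) \<Rightarrow> 'v set \<Rightarrow> 'v set \<Rightarrow> bool" where
  "affine_hyperplane s V H \<longleftrightarrow>
     (\<exists>f c. Vector_Spaces.linear s (*) f \<and> (\<exists>v\<in>V. f v \<noteq> 0) \<and> H = {v \<in> V. f v = c})"

definition affine_arrangement ::
  "(complex \<Rightarrow> 'v::ab_group_add \<Rightarrow> 'v) \<Rightarrow> 'v set \<Rightarrow> 'v set set \<Rightarrow> bool" where
  "affine_arrangement s V A \<longleftrightarrow> finite A \<and> (\<forall>H\<in>A. affine_hyperplane s V H)"

definition arr_complement :: "'v set \<Rightarrow> 'v set set \<Rightarrow> 'v set" where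
  "arr_complement V A = V - \<Union>A"

definition layers :: "'v set \<Rightarrow> 'v set set \<Rightarrow> 'v set set" where
  "layers V A = {L. L \<noteq> {} \<and> (\<exists>S\<subseteq>A. L = V \<inter> \<Inter>S)}"

definition fun_scale :: "complex \<Rightarrow> ('i \<Rightarrow> complex) \<Rightarrow> 'i \<Rightarrow> complex" where
  "fun_scale c f = (\<lambda>i. c * f i)"

definition dual_space :: "(complex \<Rightarrow> 'v::ab_group_add \<Rightarrow> 'v) \<Rightarrow> ('v \<Rightarrow> complex) set" where
  "dual_space s = {f. Vector_Spaces.linear s (*) f}"

text \<open>A hyperplane determines its defining functional up to a nonzero scalar; all choices are
  collected here, which does not affect the span.\<close>

definition linear_parts ::
  "(complex \<Rightarrow> 'v::ab_group_add \<Rightarrow> 'v) \<Rightarrow> 'v set set \<Rightarrow> ('v \<Rightarrow> complex) set" where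
  "linear_parts s A = {f \<in> dual_space s. f \<noteq> 0 \<and> (\<exists>c. {v. f v = c} \<in> A)}"

definition essential :: "(complex \<Rightarrow> 'v::ab_group_add \<Rightarrow> 'v) \<Rightarrow> 'v set set \<Rightarrow> bool" where
  "essential s A \<longleftrightarrow> module.span fun_scale (linear_parts s A) = dual_space s"


section \<open>Fiber-type arrangements\<close>

definition fiber_bundle ::
  "'e topology \<Rightarrow> 'b topology \<Rightarrow> ('e \<Rightarrow> 'b) \<Rightarrow> 'f topology \<Rightarrow> bool" where
  "fiber_bundle E B p F \<longleftrightarrow>
     continuous_map E B p \<and>
     (\<forall>b\<in>topspace B. \<exists>U h. openin B U \<and> b \<in> U \<and>
        homeomorphic_map (subtopology E {e \<in> topspace E. p e \<in> U})
          (prod_topology (subtopology B U) F) h \<and>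
        (\<forall>e\<in>topspace E. p e \<in> U \<longrightarrow> fst (h e) = p e))"

text \<open>
  \<open>\<complex>\<^sup>n\<close> as the sequences vanishing from index \<open>n\<close> on, so that all \<open>n\<close> share one type. Its
  topology is the subspace topology of the product topology on \<open>nat \<Rightarrow> complex\<close>, and its scalar
  multiplication is \<open>fun_scale\<close>.
\<close>

definition Cn :: "nat \<Rightarrow> (nat \<Rightarrow> complex) set" where
  "Cn n = {x. \<forall>i\<ge>n. x i = 0}"

definition proj :: "nat \<Rightarrow> (nat \<Rightarrow> complex) \<Rightarrow> nat \<Rightarrow> complex" where
  "proj n x = (\<lambda>i. if i < n then x i else 0)"

definition coordinates ::
  "(complex \<Rightarrow> 'v::ab_group_add \<Rightarrow> 'v) \<Rightarrow> 'v set \<Rightarrow> nat \<Rightarrow> ('v \<Rightarrow> nat \<Rightarrow> complex) \<Rightarrow> bool" where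
  "coordinates s V n \<phi> \<longleftrightarrow>
     bij_betw \<phi> V (Cn n) \<and>
     (\<forall>x\<in>V. \<forall>y\<in>V. \<phi> (x + y) = \<phi> x + \<phi> y) \<and>
     (\<forall>c. \<forall>x\<in>V. \<phi> (s c x) = fun_scale c (\<phi> x))"

definition fibers_over ::
  "(complex \<Rightarrow> 'v::ab_group_add \<Rightarrow> 'v) \<Rightarrow> 'v set \<Rightarrow> 'v set set \<Rightarrow>
   nat \<Rightarrow> (nat \<Rightarrow> complex) set set \<Rightarrow> bool" where
  "fibers_over s V A n B \<longleftrightarrow>
     (\<exists>\<phi> S. coordinates s V (Suc n) \<phi> \<and> finite S \<and>
        fiber_bundle (top_of_set (\<phi> ` arr_complement V A))
          (top_of_set (arr_complement (Cn n) B)) (proj n) (top_of_set (UNIV - S :: complex set)))"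

text \<open>The recursion is carried out for arrangements in \<open>Cn n\<close>, because an inductive predicate
  lives on one type; \<open>coord_fiber_type_iff\<close> confirms that it is \<open>fiber_type\<close> on \<open>Cn n\<close>.\<close>

inductive coord_fiber_type :: "nat \<Rightarrow> (nat \<Rightarrow> complex) set set \<Rightarrow> bool" where
  line: "affine_arrangement fun_scale (Cn 1) A \<Longrightarrow> coord_fiber_type 1 A"
| step: "affine_arrangement fun_scale (Cn (Suc n)) A \<Longrightarrow> coord_fiber_type n B \<Longrightarrow>
         fibers_over fun_scale (Cn (Suc n)) A n B \<Longrightarrow> coord_fiber_type (Suc n) A"

definition fiber_type ::
  "(complex \<Rightarrow> 'v::ab_group_add \<Rightarrow> 'v) \<Rightarrow> 'v set \<Rightarrow> 'v set set \<Rightarrow> bool" where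
  "fiber_type s V A \<longleftrightarrow>
     affine_arrangement s V A \<and>
     (vector_space.dim s V = 1 \<or> (\<exists>n B. coord_fiber_type n B \<and> fibers_over s V A n B))"

interpretation fun_vs: vector_space fun_scale
  by unfold_locales (auto simp: fun_scale_def algebra_simps fun_eq_iff)

definition unit_seq :: "nat \<Rightarrow> nat \<Rightarrow> complex" where
  "unit_seq j = (\<lambda>i. if i = j then 1 else 0)"

lemma subspace_Cn: "fun_vs.subspace (Cn n)"
  by (auto simp: fun_vs.subspace_def Cn_def fun_scale_def)

lemma unit_seq_inj: "inj unit_seq"
  by (auto simp: inj_def unit_seq_def fun_eq_iff split: if_splits)

lemma sum_unit_seq:
  assumes "finite J"
  shows "(\<Sum>j\<in>J. fun_scale (u j) (unit_seq j)) i = (if i \<in> J then u i else 0)"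
  using assms by (induction J rule: finite_induct) (auto simp: fun_scale_def unit_seq_def)

lemma dim_Cn: "fun_vs.dim (Cn n) = n"
proof -
  let ?B = "unit_seq ` {..<n}"
  have ind: "fun_vs.independent ?B"
  proof (rule fun_vs.independent_if_scalars_zero)
    fix f x assume *: "(\<Sum>x\<in>?B. fun_scale (f x) x) = 0" and "x \<in> ?B"
    then obtain i where i: "i < n" "x = unit_seq i" by auto
    have "(\<Sum>x\<in>?B. fun_scale (f x) x) = (\<Sum>j<n. fun_scale (f (unit_seq j)) (unit_seq j))"
      by (subst sum.reindex) (auto intro: inj_on_subset[OF unit_seq_inj])
    then have "(\<Sum>j<n. fun_scale (f (unit_seq j)) (unit_seq j)) i = 0" using * by simp
    then show "f x = 0" using i by (simp add: sum_unit_seq)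
  qed simp
  have sub: "?B \<subseteq> Cn n" by (auto simp: Cn_def unit_seq_def)
  have "Cn n \<subseteq> fun_vs.span ?B"
  proof
    fix x assume x: "x \<in> Cn n"
    have "x = (\<Sum>j<n. fun_scale (x j) (unit_seq j))"
      using x by (auto simp: fun_eq_iff sum_unit_seq Cn_def not_less)
    also have "\<dots> \<in> fun_vs.span ?B"
      by (intro fun_vs.span_sum fun_vs.span_scale fun_vs.span_base) auto
    finally show "x \<in> fun_vs.span ?B" .
  qed
  from fun_vs.dim_unique[OF sub this ind] show ?thesis
    by (simp add: card_image inj_on_subset[OF unit_seq_inj])
qed

lemma coordinates_Cn_dim:
  assumes "coordinates fun_scale (Cn n) m \<phi>"
  shows "m = n"
proof -
  have bij: "bij_betw \<phi> (Cn n) (Cn m)"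
    and add: "\<And>x y. x \<in> Cn n \<Longrightarrow> y \<in> Cn n \<Longrightarrow> \<phi> (x + y) = \<phi> x + \<phi> y"
    and sc: "\<And>c x. x \<in> Cn n \<Longrightarrow> \<phi> (fun_scale c x) = fun_scale c (\<phi> x)"
    using assms by (auto simp: coordinates_def)
  define \<psi> where "\<psi> x = \<phi> (proj n x)" for x
  have pC: "proj n x \<in> Cn n" for x by (simp add: proj_def Cn_def)
  have pid: "proj n x = x" if "x \<in> Cn n" for x
    using that by (auto simp: proj_def Cn_def fun_eq_iff)
  have lin: "Vector_Spaces.linear fun_scale fun_scale \<psi>"
  proof
    fix x y :: "nat \<Rightarrow> complex" and c
    have "proj n (x + y) = proj n x + proj n y" by (auto simp: proj_def fun_eq_iff)
    then show "\<psi> (x + y) = \<psi> x + \<psi> y" by (simp add: \<psi>_def add pC)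
    have "proj n (fun_scale c x) = fun_scale c (proj n x)"
      by (auto simp: proj_def fun_eq_iff fun_scale_def)
    then show "\<psi> (fun_scale c x) = fun_scale c (\<psi> x)" by (simp add: \<psi>_def sc pC)
  qed
  interpret psi: Vector_Spaces.linear fun_scale fun_scale \<psi> by (rule lin)
  have im: "\<psi> ` Cn n = Cn m" and inj: "inj_on \<psi> (Cn n)"
    using bij by (auto simp: \<psi>_def pid bij_betw_def inj_on_def image_def)
  obtain B where B: "B \<subseteq> Cn n" "fun_vs.independent B" "Cn n \<subseteq> fun_vs.span B"
      "card B = fun_vs.dim (Cn n)"
    by (rule fun_vs.basis_exists)
  have span: "fun_vs.span B = Cn n"
    using B(1,3) fun_vs.span_minimal[OF _ subspace_Cn] by blast
  have "fun_vs.dim (\<psi> ` Cn n) = card (\<psi> ` B)"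
  proof (rule fun_vs.dim_eq_card)
    show "fun_vs.span (\<psi> ` B) = fun_vs.span (\<psi> ` Cn n)"
      by (simp add: psi.span_image span fun_vs.span_eq_iff[THEN iffD2, OF subspace_Cn])
    show "fun_vs.independent (\<psi> ` B)"
      using B(2) inj by (intro psi.independent_injective_image) (auto simp: span)
  qed
  also have "\<dots> = fun_vs.dim (Cn n)"
    using B(1,4) inj by (simp add: card_image inj_on_subset)
  finally have "fun_vs.dim (\<psi> ` Cn n) = fun_vs.dim (Cn n)" .
  then show ?thesis by (simp add: im dim_Cn)
qed

lemma coord_fiber_type_iff: "coord_fiber_type n A \<longleftrightarrow> fiber_type fun_scale (Cn n) A"
proof
  assume "coord_fiber_type n A"
  then show "fiber_type fun_scale (Cn n) A"
    by cases (auto simp: fiber_type_def dim_Cn)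
next
  assume A: "fiber_type fun_scale (Cn n) A"
  show "coord_fiber_type n A"
  proof (cases "n = 1")
    case True
    with A show ?thesis using coord_fiber_type.line by (simp add: fiber_type_def)
  next
    case False
    with A obtain m B where B: "coord_fiber_type m B" "fibers_over fun_scale (Cn n) A m B"
      by (auto simp: fiber_type_def dim_Cn)
    then have "Suc m = n" using coordinates_Cn_dim by (auto simp: fibers_over_def)
    with A B show ?thesis by (auto simp: fiber_type_def intro: coord_fiber_type.step)
  qed
qed

end

theory Submission
  imports Defs
begin

text \<open>
  For an essential arrangement, an M-ideal of corank one is the set of layers containing a fixed
  direction \<open>v\<close>: its maximal elements are parallel lines, and modularity says that two intersecting
  hyperplanes transverse to \<open>v\<close> meet inside a hyperplane parallel to \<open>v\<close>. Projecting along \<open>v\<close>, the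
  transverse hyperplanes are graphs of affine functions on the base, and this condition says that
  the graphs never meet over the complement of the projected parallel hyperplanes. In that case
  the complement is a bundle of punctured planes, trivialised locally by moving the punctures with
  bump functions; conversely, a bundle has a constant number of punctures in its fibers, because
  that number is determined by the number of ends of the fiber. The ideal is isomorphic to the
  poset of layers of the projected arrangement, so the theorem follows by induction on the
  dimension.
\<close>

section \<open>Supersolvability and order isomorphisms\<close>

text \<open>Three obstacles shape the argument. A bundle names its base arrangement only through a
  complement, so the converse must first recover that arrangement: nonempty fibers identify the
  complement, and a union of hyperplanes determines its members because an affine set over an
  infinite field is not a finite union of proper affine pieces. The same fact yields a generic base
  point at which all transverse hyperplanes have different heights; a coincidence of heights
  elsewhere would then lower the number of punctures. Secondly, all base points must share one model
  fiber, so the local straightening is followed by a homeomorphism of the plane that moves the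
  punctures to fixed positions. Thirdly, essentiality has to survive the projection. It is therefore
  restated as the absence of a nonzero common direction, and it descends because the hyperplanes
  parallel to \<open>v\<close> through a point layer cut out exactly the line in direction
  \<open>v\<close>.\<close>

locale order_embedding =
  fixes f :: "'a \<Rightarrow> 'b" and P :: "'a set" and le :: "'a \<Rightarrow> 'a \<Rightarrow> bool" and le' :: "'b \<Rightarrow> 'b \<Rightarrow> bool"
  assumes inj: "inj_on f P"
    and le_iff: "\<And>x y. x \<in> P \<Longrightarrow> y \<in> P \<Longrightarrow> le' (f x) (f y) \<longleftrightarrow> le x y"
begin

lemma eq_iff: "x \<in> P \<Longrightarrow> y \<in> P \<Longrightarrow> f x = f y \<longleftrightarrow> x = y"
  using inj by (auto dest: inj_onD)

lemma mem_image_iff: "Q \<subseteq> P \<Longrightarrow> x \<in> P \<Longrightarrow> f x \<in> f ` Q \<longleftrightarrow> x \<in> Q"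
  using inj by (auto dest: inj_onD)

lemma image_eq_iff: "Q \<subseteq> P \<Longrightarrow> R \<subseteq> P \<Longrightarrow> f ` Q = f ` R \<longleftrightarrow> Q = R"
  using inj inj_on_image_eq_iff by blast

lemma image_filter:
  assumes "\<And>x. x \<in> Q \<Longrightarrow> R' (f x) \<longleftrightarrow> R x"
  shows "{y \<in> f ` Q. R' y} = f ` {x \<in> Q. R x}"
  using assms by auto

lemma maximals_image: "Q \<subseteq> P \<Longrightarrow> maximals (f ` Q) le' = f ` maximals Q le"
  unfolding maximals_def by (rule image_filter) (auto simp: le_iff eq_iff subset_iff)

lemma minimals_image: "Q \<subseteq> P \<Longrightarrow> minimals (f ` Q) le' = f ` minimals Q le"
  unfolding minimals_def by (rule image_filter) (auto simp: le_iff eq_iff subset_iff)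

lemma joins_image:
  assumes "Q \<subseteq> P" "S \<subseteq> P"
  shows "joins (f ` Q) le' (f ` S) = f ` joins Q le S"
proof -
  have "{u \<in> f ` Q. \<forall>s\<in>f ` S. le' s u} = f ` {u \<in> Q. \<forall>s\<in>S. le s u}"
    by (rule image_filter) (use assms in \<open>auto simp: le_iff subset_iff\<close>)
  then show ?thesis
    unfolding joins_def using assms by (auto intro!: minimals_image)
qed

lemma meets_image:
  assumes "Q \<subseteq> P" "S \<subseteq> P"
  shows "meets (f ` Q) le' (f ` S) = f ` meets Q le S"
proof -
  have "{u \<in> f ` Q. \<forall>s\<in>f ` S. le' u s} = f ` {u \<in> Q. \<forall>s\<in>S. le u s}"
    by (rule image_filter) (use assms in \<open>auto simp: le_iff subset_iff\<close>)
  then show ?thesis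
    unfolding meets_def using assms by (auto intro!: maximals_image)
qed

lemma below_image: "Q \<subseteq> P \<Longrightarrow> x \<in> P \<Longrightarrow> below (f ` Q) le' (f x) = f ` below Q le x"
  unfolding below_def by (rule image_filter) (auto simp: le_iff subset_iff)

lemma bottom_of_image: "Q \<subseteq> P \<Longrightarrow> x \<in> P \<Longrightarrow> bottom_of (f ` Q) le' (f x) \<longleftrightarrow> bottom_of Q le x"
  by (auto simp: bottom_of_def mem_image_iff le_iff subset_iff eq_iff)

lemma atoms_image:
  assumes "Q \<subseteq> P"
  shows "atoms (f ` Q) le' = f ` atoms Q le"
proof -
  have "{a \<in> f ` Q. \<not> bottom_of (f ` Q) le' a} = f ` {a \<in> Q. \<not> bottom_of Q le a}"
    by (rule image_filter) (use assms in \<open>auto simp: bottom_of_image subset_iff\<close>)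
  then show ?thesis
    unfolding atoms_def using assms by (auto intro!: minimals_image)
qed

lemma chain_image: "C \<subseteq> P \<Longrightarrow> Complete_Partial_Order.chain le' (f ` C) \<longleftrightarrow> Complete_Partial_Order.chain le C"
  by (auto simp: Complete_Partial_Order.chain_def le_iff subset_iff)

lemma elem_rank_image:
  assumes "Q \<subseteq> P" "x \<in> P"
  shows "elem_rank (f ` Q) le' (f x) = elem_rank Q le x"
proof -
  have b: "below Q le x \<subseteq> P" using assms by (auto simp: below_def)
  have inj_sub: "inj_on f C" if "C \<subseteq> P" for C using inj that inj_on_subset by blast
  have "{card C | C. finite C \<and> C \<subseteq> f ` below Q le x \<and> Complete_Partial_Order.chain le' C}
      = {card C | C. finite C \<and> C \<subseteq> below Q le x \<and> Complete_Partial_Order.chain le C}"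
    (is "?L = ?R")
  proof (intro equalityI subsetI)
    fix k assume "k \<in> ?L"
    then obtain C where C: "k = card C" "finite C" "C \<subseteq> f ` below Q le x" "Complete_Partial_Order.chain le' C"
      by auto
    then obtain D where D: "D \<subseteq> below Q le x" "C = f ` D" by (auto simp: subset_image_iff)
    then have DP: "D \<subseteq> P" using b by auto
    have "finite D" "card C = card D" "Complete_Partial_Order.chain le D"
      using C D DP inj_sub[OF DP] by (auto simp: finite_image_iff card_image chain_image)
    then show "k \<in> ?R" using C D by auto
  next
    fix k assume "k \<in> ?R"
    then obtain D where D: "k = card D" "finite D" "D \<subseteq> below Q le x" "Complete_Partial_Order.chain le D"
      by auto
    then have DP: "D \<subseteq> P" using b by auto
    have "finite (f ` D)" "k = card (f ` D)" "f ` D \<subseteq> f ` below Q le x"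
        "Complete_Partial_Order.chain le' (f ` D)"
      using D DP inj_sub[OF DP] by (auto simp: card_image chain_image)
    then show "k \<in> ?L" by blast
  qed
  then show ?thesis using assms by (simp add: elem_rank_def below_image)
qed

lemma pure_image:
  assumes "Q \<subseteq> P" "pure Q le"
  shows "pure (f ` Q) le'"
proof -
  obtain r where "\<forall>x\<in>maximals Q le. elem_rank Q le x = r" using assms(2) by (auto simp: pure_def)
  moreover have "maximals Q le \<subseteq> P" using assms(1) by (auto simp: maximals_def)
  ultimately have "\<forall>y\<in>maximals (f ` Q) le'. elem_rank (f ` Q) le' y = r"
    using assms(1) by (auto simp: maximals_image elem_rank_image)
  then show ?thesis by (auto simp: pure_def)
qed

lemma poset_rank_image:
  assumes "Q \<subseteq> P"
  shows "poset_rank (f ` Q) le' = poset_rank Q le"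
proof -
  have "maximals Q le \<subseteq> P" using assms by (auto simp: maximals_def)
  then have "elem_rank (f ` Q) le' ` f ` maximals Q le = elem_rank Q le ` maximals Q le"
    unfolding image_image using assms by (intro image_cong) (auto simp: elem_rank_image subset_iff)
  then show ?thesis using assms by (simp add: poset_rank_def maximals_image)
qed

lemma modular_in_image:
  assumes "L \<subseteq> P" "modular_in L le y"
  shows "modular_in (f ` L) le' (f y)"
proof -
  have y: "y \<in> L" using assms by (simp add: modular_in_def)
  have [simp]: "joins (f ` L) le' {f y, f z} = f ` joins L le {y, z}"
      "meets (f ` L) le' {f y, f z} = f ` meets L le {y, z}" if "z \<in> L" for z
    using that y assms joins_image[of L "{y, z}"] meets_image[of L "{y, z}"] by auto
  have *: "joins L le S \<subseteq> P" "meets L le S \<subseteq> P" "maximals L le \<subseteq> P" "minimals L le \<subseteq> P" for S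
    using assms by (auto simp: joins_def meets_def maximals_def minimals_def)
  have "complements (f ` L) le' (f y) = f ` complements L le y"
    unfolding complements_def
    by (rule image_filter) (simp add: maximals_image minimals_image assms image_eq_iff *)
  moreover have "complements L le y \<subseteq> P" using assms by (auto simp: complements_def)
  ultimately show ?thesis
    using assms y by (auto simp: modular_in_def le_iff subset_iff)
qed

lemma M_ideal_image:
  assumes "R \<subseteq> P" "M_ideal R le Q"
  shows "M_ideal (f ` R) le' (f ` Q)"
proof -
  have QR: "Q \<subseteq> R" using assms by (auto simp: M_ideal_def order_ideal_def)
  then have QP: "Q \<subseteq> P" using assms by auto
  have 1: "order_ideal (f ` R) le' (f ` Q)"
    unfolding order_ideal_def
  proof (intro conjI ballI impI)
    show "f ` Q \<subseteq> f ` R" using QR by blast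
  next
    fix v u assume vu: "v \<in> f ` Q" "u \<in> f ` R" "le' u v"
    then obtain y x where y: "y \<in> Q" "v = f y" and x: "x \<in> R" "u = f x" by blast
    then have "le x y" using vu le_iff[of x y] QP assms(1) by blast
    moreover have "order_ideal R le Q" using assms(2) unfolding M_ideal_def by blast
    ultimately show "u \<in> f ` Q" using x y unfolding order_ideal_def by blast
  qed
  have 2: "pure (f ` Q) le'" using assms QP pure_image by (auto simp: M_ideal_def)
  have 3: "join_closed (f ` R) le' (f ` Q)"
    unfolding join_closed_def
  proof (intro allI impI)
    fix S assume "S \<subseteq> f ` Q"
    then obtain T where T: "T \<subseteq> Q" "S = f ` T" by (auto simp: subset_image_iff)
    moreover from T have "joins R le T \<subseteq> Q" using assms by (auto simp: M_ideal_def join_closed_def)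
    ultimately show "joins (f ` R) le' S \<subseteq> f ` Q"
      using assms QP joins_image[of R T] by auto
  qed
  have atR: "atoms R le \<subseteq> R" by (auto simp: atoms_def minimals_def)
  have 4: "f a \<in> f ` Q" if "y \<in> Q" "a \<in> atoms R le" "joins (f ` R) le' {f a, f y} = {}" for y a
  proof -
    have "joins (f ` R) le' (f ` {a, y}) = f ` joins R le {a, y}"
      using that atR QP assms(1) by (intro joins_image) auto
    then have "joins R le {a, y} = {}" using that by simp
    then show ?thesis using that assms by (auto simp: M_ideal_def)
  qed
  have 5: "\<exists>y\<in>maximals (f ` Q) le'. modular_in (below (f ` R) le' (f x)) le' y"
    if x: "x \<in> maximals R le" for x
  proof -
    have xR: "x \<in> R" using x by (simp add: maximals_def)
    obtain y where y: "y \<in> maximals Q le" "modular_in (below R le x) le y"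
      using x assms by (auto simp: M_ideal_def)
    have "modular_in (f ` below R le x) le' (f y)"
      using y assms by (intro modular_in_image) (auto simp: below_def)
    moreover have "below (f ` R) le' (f x) = f ` below R le x"
      using assms xR by (intro below_image) auto
    ultimately show ?thesis using y QP by (auto simp: maximals_image)
  qed
  show ?thesis
    unfolding M_ideal_def atoms_image[OF assms(1)] maximals_image[OF assms(1)]
    using 1 2 3 4 5 by auto
qed

lemma supersolvable_image:
  assumes "supersolvable P le"
  shows "supersolvable (f ` P) le'"
proof -
  obtain n Q b where Q: "bottom_of P le b" "Q 0 = {b}" "Q n = P"
      "\<And>i. i < n \<Longrightarrow> Q i \<subset> Q (Suc i) \<and> M_ideal (Q (Suc i)) le (Q i)"
      "\<And>i. i \<le> n \<Longrightarrow> poset_rank (Q i) le = i"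
    using assms unfolding supersolvable_def by blast
  \<comment> \<open>The inclusion is known at the top, \<open>Q n = P\<close>, so the induction on
    \<open>i\<close> runs downwards.\<close>
  have QP: "Q i \<subseteq> P" if "i \<le> n" for i
    using that
  proof (induction rule: inc_induct)
    case (step i) then show ?case using Q(4)[of i] by auto
  qed (simp add: Q(3))
  have "bottom_of (f ` P) le' (f b)" using Q(1) by (simp add: bottom_of_image bottom_of_def[of P])
  moreover have "f ` Q i \<subset> f ` Q (Suc i)" if "i < n" for i
    using Q(4)[OF that] QP[of i] QP[of "Suc i"] that image_eq_iff[of "Q i" "Q (Suc i)"] by auto
  ultimately show ?thesis
    unfolding supersolvable_def using Q QP
    by (intro exI[of _ n] exI[of _ "\<lambda>i. f ` Q i"]) (auto simp: poset_rank_image M_ideal_image)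
qed

end

section \<open>Preimages of arrangements under surjections\<close>

definition pull :: "('a \<Rightarrow> 'b) \<Rightarrow> 'a set \<Rightarrow> 'b set \<Rightarrow> 'a set" where
  "pull g V X = {x \<in> V. g x \<in> X}"

text \<open>Preimages commute with intersections, and surjectivity keeps nonempty sets nonempty.
  This covers both maps that occur later: a coordinate isomorphism, and the projection along a
  direction, whose preimages are the hyperplanes parallel to that direction.\<close>

lemma layers_pull:
  assumes g: "g ` V' = V"
  shows "layers V' (pull g V' ` A) = pull g V' ` layers V A"
proof -
  have *: "V' \<inter> \<Inter>(pull g V' ` S) = pull g V' (V \<inter> \<Inter>S)" for S
    using g by (auto simp: pull_def)
  have ne: "pull g V' (V \<inter> \<Inter>S) \<noteq> {} \<longleftrightarrow> V \<inter> \<Inter>S \<noteq> {}" for S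
    using g by (auto simp: pull_def)
  show ?thesis
  proof (intro equalityI subsetI)
    fix L assume "L \<in> layers V' (pull g V' ` A)"
    then obtain S where S: "S \<subseteq> A" "L = V' \<inter> \<Inter>(pull g V' ` S)" "L \<noteq> {}"
      by (auto simp: layers_def subset_image_iff)
    then show "L \<in> pull g V' ` layers V A"
      unfolding layers_def using * ne by (auto intro!: imageI exI[of _ S])
  next
    fix L assume "L \<in> pull g V' ` layers V A"
    then obtain S where S: "S \<subseteq> A" "L = pull g V' (V \<inter> \<Inter>S)" "V \<inter> \<Inter>S \<noteq> {}"
      by (auto simp: layers_def)
    then have "L \<noteq> {}" "L = V' \<inter> \<Inter>(pull g V' ` S)" "pull g V' ` S \<subseteq> pull g V' ` A"
      using * ne by auto
    then show "L \<in> layers V' (pull g V' ` A)" unfolding layers_def by blast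
  qed
qed

lemma supersolvable_layers_pull:
  assumes g: "g ` V' = V"
  shows "supersolvable (layers V' (pull g V' ` A)) (\<lambda>X Y. Y \<subseteq> X)
    \<longleftrightarrow> supersolvable (layers V A) (\<lambda>X Y. Y \<subseteq> X)"
proof -
  have sub: "X \<subseteq> V" if "X \<in> layers V A" for X using that by (auto simp: layers_def)
  have le: "pull g V' X \<subseteq> pull g V' Y \<longleftrightarrow> X \<subseteq> Y" if "X \<in> layers V A" for X Y
    using sub[OF that] g by (auto simp: pull_def)
  have inj: "inj_on (pull g V') (layers V A)"
    by (rule inj_onI) (metis le subset_antisym order_refl)
  interpret F: order_embedding "pull g V'" "layers V A" "\<lambda>X Y. Y \<subseteq> X" "\<lambda>X Y. Y \<subseteq> X"
    by unfold_locales (use inj le in auto)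
  \<comment> \<open>\<open>supersolvable_image\<close> only transports forwards, so the converse
    takes the inverse map as an embedding of its own.\<close>
  let ?P' = "pull g V' ` layers V A" and ?k = "inv_into (layers V A) (pull g V')"
  interpret G: order_embedding ?k ?P' "\<lambda>X Y. Y \<subseteq> X" "\<lambda>X Y. Y \<subseteq> X"
  proof
    show "inj_on ?k ?P'" by (rule inj_on_inv_into) simp
    fix X Y assume "X \<in> ?P'" "Y \<in> ?P'"
    then show "?k Y \<subseteq> ?k X \<longleftrightarrow> Y \<subseteq> X"
      using le[of "?k Y" "?k X"] by (simp add: inv_into_into f_inv_into_f)
  qed
  have "?k ` ?P' = layers V A" using inj by (auto simp: image_iff)
  then show ?thesis
    unfolding layers_pull[OF g] using F.supersolvable_image G.supersolvable_image by auto
qed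

text \<open>A strictly monotone \<rho> is injective on chains and bounds their length; predecessors
  one step lower build a chain attaining the bound. That chain has \<open>Suc (\<rho> Z)\<close>
  elements, which the \<open>- 1\<close> in \<open>elem_rank\<close> turns into
  \<open>\<rho> Z\<close>.\<close>

lemma elem_rank_eq_rank_function:
  fixes P :: "'a set set" and \<rho> :: "'a set \<Rightarrow> nat"
  assumes mono: "\<And>X Y. X \<in> P \<Longrightarrow> Y \<in> P \<Longrightarrow> Y \<subset> X \<Longrightarrow> \<rho> X < \<rho> Y"
    and pred: "\<And>Y. Y \<in> P \<Longrightarrow> \<rho> Y > 0 \<Longrightarrow> \<exists>X\<in>P. Y \<subset> X \<and> \<rho> Y = Suc (\<rho> X)"
    and Z: "Z \<in> P"
  shows "elem_rank P (\<lambda>X Y. Y \<subseteq> X) Z = \<rho> Z"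
proof -
  let ?le = "\<lambda>X Y :: 'a set. Y \<subseteq> X"
  let ?S = "{card C | C. finite C \<and> C \<subseteq> below P ?le Z \<and> Complete_Partial_Order.chain ?le C}"
  have ub: "k \<le> Suc (\<rho> Z)" if "k \<in> ?S" for k
  proof -
    obtain C where C: "k = card C" "finite C" "C \<subseteq> below P ?le Z" "Complete_Partial_Order.chain ?le C"
      using \<open>k \<in> ?S\<close> by auto
    have "inj_on \<rho> C"
    proof (rule inj_onI)
      fix X Y assume XY: "X \<in> C" "Y \<in> C" "\<rho> X = \<rho> Y"
      then have "X \<in> P" "Y \<in> P" using C by (auto simp: below_def)
      moreover have "X \<subseteq> Y \<or> Y \<subseteq> X" using C XY by (auto simp: Complete_Partial_Order.chain_def)
      ultimately show "X = Y" using mono[of X Y] mono[of Y X] XY by (metis less_irrefl psubsetI)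
    qed
    moreover have "\<rho> ` C \<subseteq> {..\<rho> Z}"
    proof
      fix r assume "r \<in> \<rho> ` C"
      then obtain X where "X \<in> P" "Z \<subseteq> X" "r = \<rho> X" using C by (auto simp: below_def)
      then show "r \<in> {..\<rho> Z}" using mono[of X Z] Z
        by (metis atMost_iff le_less psubsetI)
    qed
    ultimately show ?thesis using C(1) card_inj_on_le[of \<rho> C "{..\<rho> Z}"] by simp
  qed
  have ex: "\<exists>C. finite C \<and> C \<subseteq> below P ?le Y \<and> Complete_Partial_Order.chain ?le C \<and> card C = Suc (\<rho> Y)"
    if "Y \<in> P" for Y
    using that
  proof (induction "\<rho> Y" arbitrary: Y)
    case 0
    then show ?case
      by (intro exI[of _ "{Y}"]) (auto simp: below_def Complete_Partial_Order.chain_def)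
  next
    case (Suc r)
    then obtain X where X: "X \<in> P" "Y \<subset> X" "\<rho> Y = Suc (\<rho> X)" using pred[of Y] by auto
    with Suc obtain C where C: "finite C" "C \<subseteq> below P ?le X" "Complete_Partial_Order.chain ?le C"
        "card C = Suc (\<rho> X)" by (metis nat.inject)
    have C': "Z \<in> P \<and> Y \<subset> Z" if "Z \<in> C" for Z
      using that C(2) X(2) unfolding below_def by blast
    then have "Y \<notin> C" by blast
    then have "card (insert Y C) = Suc (\<rho> Y)" using C X by simp
    moreover have "insert Y C \<subseteq> below P ?le Y" using C' Suc.prems unfolding below_def by blast
    moreover have "Complete_Partial_Order.chain ?le (insert Y C)"
      using C(3) C' unfolding Complete_Partial_Order.chain_def by blast
    ultimately show ?case using C by blast
  qed
  have "Max ?S = Suc (\<rho> Z)"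
  proof (rule Max_eqI)
    have "?S \<subseteq> {..Suc (\<rho> Z)}" by (rule subsetI, rule iffD2[OF atMost_iff], rule ub)
    then show "finite ?S" by (rule finite_subset) simp
    show "Suc (\<rho> Z) \<in> ?S" using ex[OF Z] by (metis (mono_tags, lifting) mem_Collect_eq)
  qed (rule ub)
  then show ?thesis by (simp add: elem_rank_def)
qed

section \<open>Arrangements in coordinate space and their layers\<close>

abbreviation (input) rev_incl :: "'a set \<Rightarrow> 'a set \<Rightarrow> bool" where
  "rev_incl \<equiv> \<lambda>X Y. Y \<subseteq> X"

text \<open>Translation invariance applies to hyperplanes, layers and their images alike. For a
  hyperplane it says that the defining functional vanishes at \<open>v\<close>.\<close>

definition par :: "'v::ab_group_add \<Rightarrow> 'v set \<Rightarrow> bool" where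
  "par v H \<longleftrightarrow> (\<forall>x\<in>H. x + v \<in> H)"

text \<open>This is the affine form of the standard test for a modular coatom of a geometric
  lattice: the join of any two distinct atoms not below it lies over an atom that is below it.
  Disjoint pairs have no join and impose nothing.\<close>

definition transverse_closed :: "'v::ab_group_add set set \<Rightarrow> 'v \<Rightarrow> bool" where
  "transverse_closed A v \<longleftrightarrow>
     (\<forall>H\<in>A. \<forall>K\<in>A. H \<noteq> K \<and> \<not> par v H \<and> \<not> par v K \<and> H \<inter> K \<noteq> {} \<longrightarrow>
        (\<exists>L\<in>A. par v L \<and> H \<inter> K \<subseteq> L))"

text \<open>Essentiality without the dual space: the common kernel of the linear parts is zero. In
  this form it passes easily through coordinate changes and to the projected arrangement.\<close>

definition no_common_direction :: "'v::ab_group_add set \<Rightarrow> 'v set set \<Rightarrow> bool" where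
  "no_common_direction V A \<longleftrightarrow> (\<forall>v\<in>V. (\<forall>H\<in>A. par v H) \<longrightarrow> v = 0)"

section \<open>Linear algebra inside \<open>Cn n\<close>\<close>

lemma Cn_add: "x \<in> Cn n \<Longrightarrow> y \<in> Cn n \<Longrightarrow> x + y \<in> Cn n"
  and Cn_diff: "x \<in> Cn n \<Longrightarrow> y \<in> Cn n \<Longrightarrow> x - y \<in> Cn n"
  and Cn_scale: "x \<in> Cn n \<Longrightarrow> fun_scale c x \<in> Cn n"
  and Cn_0: "0 \<in> Cn n"
  by (auto simp: Cn_def fun_scale_def)

lemmas Cn_closed = Cn_add Cn_diff Cn_scale Cn_0

lemma Cn_eq_span: "Cn n = fun_vs.span (unit_seq ` {..<n})"
proof
  show "Cn n \<subseteq> fun_vs.span (unit_seq ` {..<n})"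
  proof
    fix x assume x: "x \<in> Cn n"
    have "x = (\<Sum>j<n. fun_scale (x j) (unit_seq j))"
      using x by (auto simp: fun_eq_iff sum_unit_seq Cn_def not_less)
    also have "\<dots> \<in> fun_vs.span (unit_seq ` {..<n})"
      by (intro fun_vs.span_sum fun_vs.span_scale fun_vs.span_base) auto
    finally show "x \<in> fun_vs.span (unit_seq ` {..<n})" .
  qed
  show "fun_vs.span (unit_seq ` {..<n}) \<subseteq> Cn n"
    by (rule fun_vs.span_minimal[OF _ subspace_Cn]) (auto simp: Cn_def unit_seq_def)
qed

text \<open>The type \<open>nat \<Rightarrow> complex\<close> is infinite-dimensional, so
  comparisons of dimension draw the finiteness of bases from the containing
  \<open>Cn n\<close>.\<close>

lemma finite_independent_Cn: "B \<subseteq> Cn n \<Longrightarrow> fun_vs.independent B \<Longrightarrow> finite B"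
  using fun_vs.independent_span_bound[of "unit_seq ` {..<n}" B] by (simp add: Cn_eq_span)

lemma dim_psubset_Cn:
  assumes U: "fun_vs.subspace U" and W: "fun_vs.subspace W" and "U \<subset> W" "W \<subseteq> Cn n"
  shows "fun_vs.dim U < fun_vs.dim W"
proof -
  obtain B where B: "B \<subseteq> U" "fun_vs.independent B" "U \<subseteq> fun_vs.span B" "card B = fun_vs.dim U"
    by (rule fun_vs.basis_exists)
  obtain C where C: "C \<subseteq> W" "fun_vs.independent C" "W \<subseteq> fun_vs.span C" "card C = fun_vs.dim W"
    by (rule fun_vs.basis_exists)
  obtain u where u: "u \<in> W" "u \<notin> U" using assms by blast
  have "u \<notin> fun_vs.span B" using u fun_vs.span_minimal[OF B(1) U] by blast
  then have ind: "fun_vs.independent (insert u B)" using B(2) by (rule fun_vs.independent_insertI)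
  have fin: "finite C" "finite B"
    using finite_independent_Cn[of C n] finite_independent_Cn[of B n] B C assms by auto
  have "insert u B \<subseteq> fun_vs.span C" using u B C assms by blast
  then have "card (insert u B) \<le> card C"
    using fun_vs.independent_span_bound[OF fin(1) ind] by blast
  moreover have "u \<notin> B" using u B by blast
  ultimately show ?thesis using B C fin by simp
qed

lemma dim_subset_Cn:
  assumes "fun_vs.subspace U" "fun_vs.subspace W" "U \<subseteq> W" "W \<subseteq> Cn n"
  shows "fun_vs.dim U \<le> fun_vs.dim W"
  using dim_psubset_Cn[of U W n] assms by (metis le_less psubsetI)

lemma dim_zero_set: "fun_vs.dim {0} = 0"
  using fun_vs.dim_le_card[of "{0}" "{}"] by simp

lemma dim_eq_0_Cn:
  assumes "fun_vs.subspace U" "U \<subseteq> Cn n" "fun_vs.dim U = 0"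
  shows "U = {0}"
proof (rule ccontr)
  assume "U \<noteq> {0}"
  then have "{0} \<subset> U" using fun_vs.subspace_0[OF assms(1)] by blast
  from dim_psubset_Cn[OF fun_vs.subspace_single_0 assms(1) this assms(2)] assms(3)
  show False by simp
qed

lemma functional_simps:
  assumes "Vector_Spaces.linear fun_scale (*) f"
  shows "f (x + y) = f x + f y" "f (x - y) = f x - f y" "f (fun_scale c x) = c * f x" "f 0 = 0"
proof -
  interpret Vector_Spaces.linear fun_scale "(*)" f by fact
  show "f (x + y) = f x + f y" "f (x - y) = f x - f y" "f (fun_scale c x) = c * f x" "f 0 = 0"
    by (simp_all add: add diff scale zero)
qed

lemma dim_kernel_Cn:
  assumes U: "fun_vs.subspace U" "U \<subseteq> Cn n" and f: "Vector_Spaces.linear fun_scale (*) f"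
  shows "fun_vs.dim U \<le> Suc (fun_vs.dim (U \<inter> {x. f x = 0}))"
proof (cases "U \<subseteq> {x. f x = 0}")
  case True
  then show ?thesis by (simp add: inf.absorb1)
next
  case False
  then obtain u where u: "u \<in> U" "f u \<noteq> 0" by blast
  note [simp] = functional_simps[OF f]
  obtain B where B: "B \<subseteq> U \<inter> {x. f x = 0}" "fun_vs.independent B"
      "U \<inter> {x. f x = 0} \<subseteq> fun_vs.span B" "card B = fun_vs.dim (U \<inter> {x. f x = 0})"
    by (rule fun_vs.basis_exists)
  have fin: "finite B" using finite_independent_Cn[of B n] B U by auto
  have "U \<subseteq> fun_vs.span (insert u B)"
  proof
    fix w assume w: "w \<in> U"
    have "w - fun_scale (f w / f u) u \<in> U \<inter> {x. f x = 0}"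
      using u w U(1) by (auto intro!: fun_vs.subspace_diff fun_vs.subspace_scale)
    then have "w - fun_scale (f w / f u) u \<in> fun_vs.span B" using B by blast
    then show "w \<in> fun_vs.span (insert u B)" using fun_vs.span_insert by blast
  qed
  then have "fun_vs.dim U \<le> card (insert u B)" using fin fun_vs.dim_le_card by blast
  also have "\<dots> \<le> Suc (card B)" by (rule card_insert_le_m1) (auto simp: fin)
  finally show ?thesis using B by simp
qed

lemma joins_rev_incl_eq:
  assumes "J \<in> P" "\<And>s. s \<in> S \<Longrightarrow> J \<subseteq> s" "\<And>u. u \<in> P \<Longrightarrow> (\<forall>s\<in>S. u \<subseteq> s) \<Longrightarrow> u \<subseteq> J"
  shows "joins P rev_incl S = {J}"
proof -
  let ?U = "{u \<in> P. \<forall>s\<in>S. u \<subseteq> s}"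
  have J: "J \<in> ?U" and le: "\<And>u. u \<in> ?U \<Longrightarrow> u \<subseteq> J" using assms by auto
  have "minimals ?U rev_incl = {J}"
    unfolding minimals_def
  proof (intro equalityI subsetI)
    fix u assume "u \<in> {x \<in> ?U. \<forall>y\<in>?U. x \<subseteq> y \<longrightarrow> y = x}"
    then have u: "u \<in> ?U" "\<forall>y\<in>?U. u \<subseteq> y \<longrightarrow> y = u" by simp_all
    have "J = u" using u(2)[rule_format, OF J le[OF u(1)]] .
    then show "u \<in> {J}" by simp
  next
    fix u assume "u \<in> {J}"
    then show "u \<in> {x \<in> ?U. \<forall>y\<in>?U. x \<subseteq> y \<longrightarrow> y = x}"
      using J le by (simp add: subset_antisym)
  qed
  then show ?thesis by (simp add: joins_def)
qed

text \<open>Fixes one equation \<open>ff H x = cc H\<close> per hyperplane. The functionals are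
  linear on the whole sequence type, but only their restriction to \<open>Cn n\<close> describes
  \<open>H\<close>; hence \<open>nz\<close> asks for a witness there.\<close>

locale arrangement =
  fixes n :: nat and A :: "(nat \<Rightarrow> complex) set set"
    and ff :: "(nat \<Rightarrow> complex) set \<Rightarrow> (nat \<Rightarrow> complex) \<Rightarrow> complex"
    and cc :: "(nat \<Rightarrow> complex) set \<Rightarrow> complex"
  assumes fin: "finite A"
    and lin: "H \<in> A \<Longrightarrow> Vector_Spaces.linear fun_scale (*) (ff H)"
    and nz: "H \<in> A \<Longrightarrow> \<exists>w\<in>Cn n. ff H w \<noteq> 0"
    and mem_iff: "H \<in> A \<Longrightarrow> x \<in> H \<longleftrightarrow> x \<in> Cn n \<and> ff H x = cc H"

lemma arrangement_exists:
  assumes "affine_arrangement fun_scale (Cn n) A"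
  obtains ff cc where "arrangement n A ff cc"
proof -
  have "\<forall>H\<in>A. \<exists>p. Vector_Spaces.linear fun_scale (*) (fst p) \<and> (\<exists>w\<in>Cn n. fst p w \<noteq> 0) \<and>
      H = {v \<in> Cn n. fst p v = snd p}"
    using assms by (force simp: affine_arrangement_def affine_hyperplane_def)
  from bchoice[OF this] obtain p where p: "\<forall>H\<in>A. Vector_Spaces.linear fun_scale (*) (fst (p H)) \<and>
      (\<exists>w\<in>Cn n. fst (p H) w \<noteq> 0) \<and> H = {v \<in> Cn n. fst (p H) v = snd (p H)}" by blast
  have "arrangement n A (fst \<circ> p) (snd \<circ> p)"
  proof (rule arrangement.intro)
    fix H x assume H: "H \<in> A"
    then have "H = {v \<in> Cn n. fst (p H) v = snd (p H)}" using p by blast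
    then show "x \<in> H \<longleftrightarrow> x \<in> Cn n \<and> (fst \<circ> p) H x = (snd \<circ> p) H"
      unfolding comp_def by blast
  qed (use p assms in \<open>auto simp: affine_arrangement_def\<close>)
  then show thesis by (rule that)
qed

context arrangement
begin

abbreviation "P \<equiv> layers (Cn n) A"

definition dir :: "(nat \<Rightarrow> complex) set \<Rightarrow> (nat \<Rightarrow> complex) set" where
  "dir X = {v \<in> Cn n. par v X}"

lemma sub_arrangement: "B \<subseteq> A \<Longrightarrow> arrangement n B ff cc"
  by (rule arrangement.intro) (use fin lin nz mem_iff finite_subset in blast)+

lemma ff_simps:
  assumes "H \<in> A"
  shows "ff H (x + y) = ff H x + ff H y" "ff H (x - y) = ff H x - ff H y"
    "ff H (fun_scale c x) = c * ff H x" "ff H 0 = 0"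
  using functional_simps[OF lin[OF assms]] by auto

lemma hyp_nonempty: assumes H: "H \<in> A" shows "H \<noteq> {}"
proof -
  obtain w where w: "w \<in> Cn n" "ff H w \<noteq> 0" using nz[OF H] by blast
  then have "fun_scale (cc H / ff H w) w \<in> H"
    using H by (simp add: mem_iff ff_simps Cn_closed)
  then show ?thesis by blast
qed

lemma hyp_subset: "H \<in> A \<Longrightarrow> H \<subseteq> Cn n"
  using mem_iff by blast

lemma par_iff: assumes "H \<in> A" "v \<in> Cn n" shows "par v H \<longleftrightarrow> ff H v = 0"
  using hyp_nonempty[OF assms(1)] assms by (auto simp: par_def mem_iff ff_simps Cn_closed)

lemma hyp_meets_line:
  assumes H: "H \<in> A" "v \<in> Cn n" "\<not> par v H" and x: "x \<in> Cn n"
  shows "\<exists>t. x + fun_scale t v \<in> H"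
  using assms by (intro exI[of _ "(cc H - ff H x) / ff H v"])
    (simp add: mem_iff ff_simps Cn_closed par_iff)

text \<open>Inclusion passes to the kernels of the linear parts, and codimension one leaves no room
  for a proper inclusion. So hyperplanes form an antichain, which is what makes them the
  atoms.\<close>

lemma hyp_subset_eq:
  assumes H: "H \<in> A" and K: "K \<in> A" and sub: "H \<subseteq> K"
  shows "H = K"
proof
  show "K \<subseteq> H"
  proof
    fix x assume x: "x \<in> K"
    obtain a where a: "a \<in> H" using hyp_nonempty[OF H] by blast
    have C: "a \<in> Cn n" "x \<in> Cn n" using a x mem_iff H K by auto
    have ker: "ff K v = 0" if "v \<in> Cn n" "ff H v = 0" for v
    proof -
      have "a + v \<in> H" using a that H C by (simp add: mem_iff ff_simps Cn_closed)
      then have "a + v \<in> K" "a \<in> K" using sub a by auto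
      then show ?thesis using K by (simp add: mem_iff ff_simps)
    qed
    obtain w where w: "w \<in> Cn n" "ff K w \<noteq> 0" using nz[OF K] by blast
    then have wH: "ff H w \<noteq> 0" using ker by blast
    \<comment> \<open>With this \<open>t\<close> the vector \<open>x - a - fun_scale t w\<close> is
      killed by \<open>ff H\<close>, hence by \<open>ff K\<close>; as \<open>ff K\<close> also kills
      \<open>x - a\<close>, this forces \<open>t = 0\<close>.\<close>
    define t where "t = ff H (x - a) / ff H w"
    have "ff K (x - a - fun_scale t w) = 0"
      using C w wH H by (intro ker) (auto simp: t_def ff_simps Cn_closed)
    moreover have "ff K (x - a) = 0" using a x sub K by (auto simp: mem_iff ff_simps)
    ultimately have "t = 0" using w K by (simp add: ff_simps)
    then show "x \<in> H" using a wH C H by (simp add: t_def ff_simps mem_iff)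
  qed
qed (rule sub)

text \<open>The hyperplanes through a flat of codimension two form a pencil, and any two distinct
  members of it cut out exactly that flat.\<close>

lemma codim_two_exchange:
  assumes A: "H \<in> A" "K \<in> A" "L \<in> A" and "H \<inter> K \<noteq> {}" "H \<noteq> L" "H \<inter> K \<subseteq> L"
  shows "H \<inter> L \<subseteq> K"
proof
  fix y assume y: "y \<in> H \<inter> L"
  obtain x where x: "x \<in> H" "x \<in> K" "x \<in> L" using assms by blast
  have C: "x \<in> Cn n" "y \<in> Cn n" using x y mem_iff A by auto
  have ker: "ff L v = 0" if "v \<in> Cn n" "ff H v = 0" "ff K v = 0" for v
  proof -
    have "x + v \<in> H \<inter> K" using x that A C by (simp add: mem_iff ff_simps Cn_closed)
    then have "x + v \<in> L" using assms by blast
    then show ?thesis using A x by (simp add: mem_iff ff_simps)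
  qed
  obtain z where z: "z \<in> H" "z \<notin> L" using hyp_subset_eq[of H L] assms by blast
  have zC: "z \<in> Cn n" using z A mem_iff by blast
  define w where "w = z - x"
  have w: "w \<in> Cn n" "ff H w = 0" "ff L w \<noteq> 0"
    using z zC x A C by (auto simp: w_def mem_iff ff_simps Cn_closed)
  define v where "v = y - x"
  have v: "v \<in> Cn n" "ff H v = 0" "ff L v = 0"
    using y x A C by (auto simp: v_def mem_iff ff_simps Cn_closed)
  have "ff K v = 0"
  proof (rule ccontr)
    \<comment> \<open>Otherwise a multiple of \<open>v\<close> corrects \<open>w\<close> into the
      kernels of both \<open>ff H\<close> and \<open>ff K\<close>, hence of \<open>ff L\<close>; but
      \<open>ff L\<close> kills \<open>v\<close> and not \<open>w\<close>.\<close>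
    assume nz: "ff K v \<noteq> 0"
    have "ff L (w - fun_scale (ff K w / ff K v) v) = 0"
      by (rule ker) (use v w nz A in \<open>auto simp: ff_simps Cn_closed\<close>)
    then show False using v w A by (simp add: ff_simps)
  qed
  then show "y \<in> K" using x A C by (simp add: v_def mem_iff ff_simps)
qed

lemma layerE:
  assumes "X \<in> P"
  obtains S where "S \<subseteq> A" "X = Cn n \<inter> \<Inter>S" "X \<noteq> {}"
  using assms by (auto simp: layers_def)

lemma layer_nonempty: "X \<in> P \<Longrightarrow> X \<noteq> {}" and layer_subset: "X \<in> P \<Longrightarrow> X \<subseteq> Cn n"
  by (auto simp: layers_def)

lemma whole_layer: "Cn n \<in> P"
  unfolding layers_def using Cn_0 by (intro CollectI conjI exI[of _ "{}"]) auto

lemma hyp_layer: "H \<in> A \<Longrightarrow> H \<in> P"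
  unfolding layers_def using hyp_nonempty hyp_subset by (intro CollectI conjI exI[of _ "{H}"]) auto

lemma layer_Inter:
  assumes "S \<subseteq> P" "Cn n \<inter> \<Inter>S \<noteq> {}"
  shows "Cn n \<inter> \<Inter>S \<in> P"
proof -
  have "\<forall>X\<in>S. \<exists>T. T \<subseteq> A \<and> X = Cn n \<inter> \<Inter>T" using assms(1) by (auto simp: layers_def)
  from bchoice[OF this] obtain T where T: "\<forall>X\<in>S. T X \<subseteq> A \<and> X = Cn n \<inter> \<Inter>(T X)" by blast
  have "Cn n \<inter> \<Inter>S = Cn n \<inter> \<Inter>(\<Union>X\<in>S. T X)"
  proof -
    have "x \<in> X \<longleftrightarrow> x \<in> Cn n \<and> (\<forall>H\<in>T X. x \<in> H)" if "X \<in> S" for x X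
      using T that by blast
    then show ?thesis by blast
  qed
  moreover have "(\<Union>X\<in>S. T X) \<subseteq> A" using T by blast
  ultimately show ?thesis using assms(2) unfolding layers_def by blast
qed

lemma layer_Int: "X \<in> P \<Longrightarrow> Y \<in> P \<Longrightarrow> X \<inter> Y \<noteq> {} \<Longrightarrow> X \<inter> Y \<in> P"
  using layer_Inter[of "{X, Y}"] layer_subset[of X] by (simp add: Int_absorb1 inf.coboundedI1)

lemma layer_eq_Inter_hyps: "X \<in> P \<Longrightarrow> X = Cn n \<inter> \<Inter>{H \<in> A. X \<subseteq> H}"
  by (auto simp: layers_def)

lemma layer_subset_hyp: "X \<in> P \<Longrightarrow> X \<noteq> Cn n \<Longrightarrow> \<exists>H\<in>A. X \<subseteq> H"
  using layer_eq_Inter_hyps[of X] by blast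

lemma finite_P: "finite P"
proof -
  have "P \<subseteq> (\<lambda>S. Cn n \<inter> \<Inter>S) ` Pow A" by (auto simp: layers_def)
  then show ?thesis using fin finite_subset by blast
qed

text \<open>Every functional of a hyperplane through \<open>X\<close> is constant on
  \<open>X\<close>, so a single base point decides whether a translation preserves
  \<open>X\<close>.\<close>

lemma layer_translate_iff:
  assumes X: "X \<in> P" "x \<in> X" "v \<in> Cn n"
  shows "x + v \<in> X \<longleftrightarrow> v \<in> dir X"
proof -
  obtain S where S: "S \<subseteq> A" "X = Cn n \<inter> \<Inter>S" using X(1) by (rule layerE)
  have SA: "H \<in> A" if "H \<in> S" for H using that S by blast
  have *: "z + v \<in> X \<longleftrightarrow> (\<forall>H\<in>S. ff H v = 0)" if z: "z \<in> X" for z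
  proof -
    have "z \<in> Cn n" "\<forall>H\<in>S. ff H z = cc H" using z S SA mem_iff by auto
    then show ?thesis using S(2) SA X(3) by (auto simp: mem_iff ff_simps Cn_closed)
  qed
  then show ?thesis using X by (auto simp: dir_def par_def)
qed

lemma dir_subset: "dir X \<subseteq> Cn n"
  by (auto simp: dir_def)

lemma dir_hyp: "H \<in> A \<Longrightarrow> dir H = {v \<in> Cn n. ff H v = 0}"
  by (auto simp: dir_def par_iff)

lemma dir_diff:
  assumes "X \<in> P" "x \<in> X" "y \<in> X" shows "y - x \<in> dir X"
proof -
  have "x + (y - x) \<in> X" using assms by simp
  then show ?thesis using layer_translate_iff[of X x "y - x"] assms layer_subset[of X]
    by (auto simp: Cn_closed subset_iff)
qed

lemma dir_mono:
  assumes "X \<in> P" "Y \<in> P" "X \<subseteq> Y" shows "dir X \<subseteq> dir Y"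
proof
  fix v assume v: "v \<in> dir X"
  obtain x where x: "x \<in> X" using layer_nonempty assms by blast
  then have "x + v \<in> Y" using v assms by (auto simp: dir_def par_def)
  then show "v \<in> dir Y" using layer_translate_iff[of Y x v] x v assms dir_subset by blast
qed

lemma dir_Int_hyp:
  assumes X: "X \<in> P" "H \<in> A" "X \<inter> H \<noteq> {}"
  shows "dir (X \<inter> H) = dir X \<inter> {v. ff H v = 0}"
proof -
  obtain x where x: "x \<in> X" "x \<in> H" using X by blast
  have L: "X \<inter> H \<in> P" using layer_Int hyp_layer X by blast
  have "v \<in> dir (X \<inter> H) \<longleftrightarrow> v \<in> dir X \<inter> {v. ff H v = 0}" if "v \<in> Cn n" for v
    using layer_translate_iff[OF L, of x v] layer_translate_iff[OF X(1) x(1) that] that x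
      layer_translate_iff[OF hyp_layer[OF X(2)] x(2) that] dir_hyp[OF X(2)] by auto
  then show ?thesis using dir_subset by blast
qed

lemma subspace_dir:
  assumes "X \<in> P" shows "fun_vs.subspace (dir X)"
proof -
  obtain S where S: "S \<subseteq> A" "X = Cn n \<inter> \<Inter>S" "X \<noteq> {}" using assms by (rule layerE)
  obtain x where x: "x \<in> X" using S by blast
  have SA: "H \<in> A" if "H \<in> S" for H using that S by blast
  have "dir X = {v \<in> Cn n. \<forall>H\<in>S. ff H v = 0}"
  proof -
    have "v \<in> dir X \<longleftrightarrow> (\<forall>H\<in>S. ff H v = 0)" if "v \<in> Cn n" for v
    proof -
      have "x \<in> Cn n" "\<forall>H\<in>S. ff H x = cc H" using x S SA mem_iff by auto
      then have "x + v \<in> X \<longleftrightarrow> (\<forall>H\<in>S. ff H v = 0)"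
        using S(2) SA that by (auto simp: mem_iff ff_simps Cn_closed)
      then show ?thesis using layer_translate_iff[OF assms x that] by simp
    qed
    then show ?thesis using dir_subset by blast
  qed
  then show ?thesis using SA by (auto simp: fun_vs.subspace_def Cn_closed ff_simps)
qed

lemma dir_strict:
  assumes "X \<in> P" "Y \<in> P" "X \<subset> Y" shows "dir X \<subset> dir Y"
proof -
  obtain x y where xy: "x \<in> X" "y \<in> Y" "y \<notin> X" using layer_nonempty assms by blast
  have "y - x \<in> dir Y" using dir_diff xy assms by blast
  moreover have "y - x \<notin> dir X"
    using layer_translate_iff[of X x "y - x"] xy assms layer_subset
    by (auto simp: Cn_closed subset_iff)
  ultimately show ?thesis using dir_mono assms by blast
qed

text \<open>The codimension; by \<open>dim_dir_le\<close> the subtraction is never truncated on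
  layers.\<close>

definition rnk :: "(nat \<Rightarrow> complex) set \<Rightarrow> nat" where
  "rnk X = n - fun_vs.dim (dir X)"

lemma dim_dir_le: "X \<in> P \<Longrightarrow> fun_vs.dim (dir X) \<le> n"
  using dim_subset_Cn[OF subspace_dir subspace_Cn dir_subset order_refl] by (simp add: dim_Cn)

lemma dim_dir_strict: "X \<in> P \<Longrightarrow> Y \<in> P \<Longrightarrow> X \<subset> Y \<Longrightarrow> fun_vs.dim (dir X) < fun_vs.dim (dir Y)"
  using dim_psubset_Cn[OF subspace_dir subspace_dir dir_strict dir_subset] by blast

text \<open>In a defining set of least size no hyperplane is redundant: dropping one strictly
  enlarges the layer, and a single equation accounts for at most one dimension.\<close>

lemma layer_cover:
  assumes Y: "Y \<in> P" "Y \<noteq> Cn n"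
  shows "\<exists>X\<in>P. Y \<subset> X \<and> fun_vs.dim (dir X) = Suc (fun_vs.dim (dir Y))"
proof -
  let ?R = "\<lambda>S. S \<subseteq> A \<and> Y = Cn n \<inter> \<Inter>S"
  obtain S0 where "?R S0" using Y(1) by (auto simp: layers_def)
  then obtain S where S: "?R S" and min: "\<And>T. ?R T \<Longrightarrow> card S \<le> card T"
    using ex_has_least_nat[of ?R S0 card] by blast
  have "S \<noteq> {}" using S Y by auto
  then obtain H where H: "H \<in> S" by blast
  let ?X = "Cn n \<inter> \<Inter>(S - {H})"
  have YX: "Y = ?X \<inter> H" using S H by blast
  have "finite S" using S fin finite_subset by blast
  then have "card (S - {H}) < card S" using H by (rule card_Diff1_less)
  then have "?X \<noteq> Y" using min[of "S - {H}"] S by (metis Diff_subset dual_order.trans not_le)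
  have "?X \<noteq> {}" using YX layer_nonempty[OF Y(1)] by force
  moreover have "S - {H} \<subseteq> A" using S by blast
  ultimately have XP: "?X \<in> P" unfolding layers_def by blast
  have HA: "H \<in> A" using S H by blast
  have lt: "fun_vs.dim (dir Y) < fun_vs.dim (dir ?X)"
    using dim_dir_strict[OF Y(1) XP] YX \<open>?X \<noteq> Y\<close> by blast
  have "fun_vs.dim (dir ?X) \<le> Suc (fun_vs.dim (dir ?X \<inter> {v. ff H v = 0}))"
    by (rule dim_kernel_Cn[OF subspace_dir[OF XP] dir_subset lin[OF HA]])
  also have "dir ?X \<inter> {v. ff H v = 0} = dir Y"
    using dir_Int_hyp[OF XP HA] YX layer_nonempty[OF Y(1)] by simp
  finally show ?thesis using lt XP YX \<open>?X \<noteq> Y\<close> by (intro bexI[of _ ?X]) auto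
qed

lemma elem_rank_layer:
  assumes "X \<in> P" shows "elem_rank P rev_incl X = rnk X"
proof (rule elem_rank_eq_rank_function)
  fix X Y assume "X \<in> P" "Y \<in> P" "Y \<subset> X"
  then show "rnk X < rnk Y"
    using dim_dir_strict[of Y X] dim_dir_le[of X] by (simp add: rnk_def)
next
  fix Y assume Y: "Y \<in> P" "0 < rnk Y"
  have "dir (Cn n) = Cn n" by (auto simp: dir_def par_def Cn_closed)
  then have "Y \<noteq> Cn n" using Y by (auto simp: rnk_def dim_Cn)
  then obtain X where X: "X \<in> P" "Y \<subset> X" "fun_vs.dim (dir X) = Suc (fun_vs.dim (dir Y))"
    using layer_cover Y by blast
  then have "rnk Y = Suc (rnk X)" using dim_dir_le[of X] by (auto simp: rnk_def)
  then show "\<exists>X\<in>P. Y \<subset> X \<and> rnk Y = Suc (rnk X)" using X by blast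
qed (rule assms)

end

section \<open>M-ideals of corank one and transverse directions\<close>

lemma maximals_rev_incl: "maximals P rev_incl = {X \<in> P. \<forall>Y\<in>P. Y \<subseteq> X \<longrightarrow> Y = X}"
  by (simp add: maximals_def)

lemma elem_rank_order_ideal:
  assumes "order_ideal P le Q" "x \<in> Q"
  shows "elem_rank Q le x = elem_rank P le x"
proof -
  have "below Q le x = below P le x"
    using assms unfolding below_def order_ideal_def by blast
  then show ?thesis by (simp add: elem_rank_def)
qed

section \<open>Atoms, joins and complements in the poset of layers\<close>

context arrangement
begin

lemma mem_layer_iff: "X \<in> P \<Longrightarrow> y \<in> X \<longleftrightarrow> y \<in> Cn n \<and> (\<forall>H\<in>A. X \<subseteq> H \<longrightarrow> y \<in> H)"
  by (auto simp: layers_def)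

lemma bottom_of_P_iff: "bottom_of P rev_incl X \<longleftrightarrow> X = Cn n"
proof
  assume "bottom_of P rev_incl X"
  then have "X \<in> P" "Cn n \<subseteq> X" using whole_layer unfolding bottom_of_def by blast+
  then show "X = Cn n" using layer_subset by blast
next
  assume "X = Cn n"
  then show "bottom_of P rev_incl X" using whole_layer layer_subset by (simp add: bottom_of_def)
qed

lemma hyp_not_whole: "H \<in> A \<Longrightarrow> H \<noteq> Cn n"
proof
  assume H: "H \<in> A" "H = Cn n"
  obtain w where w: "w \<in> Cn n" "ff H w \<noteq> 0" using nz[OF H(1)] by blast
  then have "0 \<in> H" "w \<in> H" using H(2) Cn_0 by auto
  then show False using w H(1) by (simp add: mem_iff ff_simps)
qed

lemma atoms_P: "atoms P rev_incl = A"
proof (intro equalityI subsetI)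
  fix a assume "a \<in> atoms P rev_incl"
  then have a: "a \<in> P" "a \<noteq> Cn n" and min: "\<And>y. y \<in> P \<Longrightarrow> y \<noteq> Cn n \<Longrightarrow> a \<subseteq> y \<Longrightarrow> y = a"
    by (auto simp: atoms_def minimals_def bottom_of_P_iff)
  obtain H where "H \<in> A" "a \<subseteq> H" using layer_subset_hyp[OF a] by blast
  then show "a \<in> A" using min[of H] hyp_layer hyp_not_whole by auto
next
  fix a assume a: "a \<in> A"
  have "y = a" if y: "y \<in> P" "y \<noteq> Cn n" "a \<subseteq> y" for y
  proof -
    obtain H where "H \<in> A" "y \<subseteq> H" using layer_subset_hyp[OF y(1,2)] by blast
    then show ?thesis using hyp_subset_eq[of a H] a y(3) by auto
  qed
  then show "a \<in> atoms P rev_incl"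
    using a by (simp add: atoms_def minimals_def bottom_of_P_iff hyp_layer hyp_not_whole)
qed

lemma joins_P_Inter:
  assumes "S \<subseteq> P" "Cn n \<inter> \<Inter>S \<noteq> {}"
  shows "joins P rev_incl S = {Cn n \<inter> \<Inter>S}"
proof (rule joins_rev_incl_eq)
  show "Cn n \<inter> \<Inter>S \<in> P" by (rule layer_Inter[OF assms])
  fix u assume "u \<in> P" "\<forall>s\<in>S. u \<subseteq> s"
  then show "u \<subseteq> Cn n \<inter> \<Inter>S" using layer_subset by blast
qed blast

lemma joins_P_empty:
  assumes "Cn n \<inter> \<Inter>S = {}" shows "joins P rev_incl S = {}"
proof -
  have "\<not> (\<forall>s\<in>S. u \<subseteq> s)" if u: "u \<in> P" for u
  proof
    assume "\<forall>s\<in>S. u \<subseteq> s"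
    then have "u \<subseteq> Cn n \<inter> \<Inter>S" using layer_subset[OF u] by blast
    then show False using layer_nonempty[OF u] assms by simp
  qed
  then have "{u \<in> P. \<forall>s\<in>S. u \<subseteq> s} = {}" by blast
  then show ?thesis unfolding joins_def minimals_def by simp
qed

lemma pair_Inter: "X \<in> P \<Longrightarrow> Cn n \<inter> \<Inter>{X, Y} = X \<inter> Y"
  using layer_subset by blast

lemma joins_P_pair:
  assumes "X \<in> P" "Y \<in> P"
  shows "joins P rev_incl {X, Y} = (if X \<inter> Y = {} then {} else {X \<inter> Y})"
  using joins_P_Inter[of "{X, Y}"] joins_P_empty[of "{X, Y}"] pair_Inter[OF assms(1), of Y] assms
  by auto

lemma exists_maximal_below:
  assumes "Q \<subseteq> P" "X \<in> Q"
  shows "\<exists>Y\<in>maximals Q rev_incl. Y \<subseteq> X"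
proof -
  have "finite Q" using assms finite_P finite_subset by blast
  from finite_has_minimal2[OF this assms(2)] show ?thesis
    by (auto simp: maximals_rev_incl)
qed

text \<open>A transverse hyperplane would be hit by the line in direction \<open>v\<close> through
  any point of \<open>X\<close>, and that line stays in \<open>X\<close>. This turns (M1), which
  speaks of missing joins, into a statement about parallelism.\<close>

lemma dir_par_disjoint:
  assumes X: "X \<in> P" "H \<in> A" "X \<inter> H = {}" "v \<in> dir X"
  shows "par v H"
proof (rule ccontr)
  assume np: "\<not> par v H"
  obtain x where x: "x \<in> X" using layer_nonempty[OF X(1)] by blast
  have v: "v \<in> Cn n" using X(4) dir_subset by blast
  obtain t where t: "x + fun_scale t v \<in> H"
    using hyp_meets_line[OF X(2) v np, of x] x layer_subset[OF X(1)] by blast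
  have "fun_scale t v \<in> dir X" using X(4) subspace_dir[OF X(1)] fun_vs.subspace_scale by blast
  then have "x + fun_scale t v \<in> X" using layer_translate_iff[OF X(1) x] v Cn_closed by blast
  then show False using t X(3) by blast
qed

lemma dir_singleton: assumes "{x} \<in> P" shows "dir {x} = {0}"
  using Cn_0 by (auto simp: dir_def par_def)

lemma dir_zero_singleton:
  assumes "X \<in> P" "dir X = {0}" "x \<in> X" shows "X = {x}"
proof -
  have "y = x" if "y \<in> X" for y using dir_diff[OF assms(1,3) that] assms(2) by simp
  then show ?thesis using assms(3) by blast
qed

lemma singleton_maximal:
  assumes "{x} \<in> P" shows "{x} \<in> maximals P rev_incl"
proof -
  have "Y = {x}" if "Y \<in> P" "Y \<subseteq> {x}" for Y
    using subset_singletonD[OF that(2)] layer_nonempty[OF that(1)] by simp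
  then show ?thesis using assms by (simp add: maximals_rev_incl)
qed

text \<open>Below a point \<open>x\<close> the poset is the lattice of layers through
  \<open>x\<close>, with top \<open>{x}\<close> and bottom \<open>Cn n\<close>. A meet is trivial
  exactly when no hyperplane contains both layers, because every layer other than
  \<open>Cn n\<close> lies in a hyperplane.\<close>

lemma mem_complements_below:
  assumes x: "{x} \<in> P" and y: "y \<in> P" "x \<in> y" and z: "z \<in> P" "x \<in> z"
  shows "z \<in> complements (below P rev_incl {x}) rev_incl y \<longleftrightarrow>
    y \<inter> z = {x} \<and> (\<forall>H\<in>A. y \<subseteq> H \<longrightarrow> \<not> z \<subseteq> H)"
proof -
  let ?L = "below P rev_incl {x}"
  have L: "X \<in> ?L \<longleftrightarrow> X \<in> P \<and> x \<in> X" for X by (auto simp: below_def)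
  have V: "Cn n \<in> ?L" using whole_layer x layer_subset by (auto simp: L)
  have max: "maximals ?L rev_incl = {{x}}"
  proof (intro equalityI subsetI)
    fix X assume "X \<in> maximals ?L rev_incl"
    then have X: "X \<in> ?L" "\<forall>Y\<in>?L. Y \<subseteq> X \<longrightarrow> Y = X" by (auto simp: maximals_def)
    then show "X \<in> {{x}}" using x L[of "{x}"] L[of X] by auto
  next
    fix X assume "X \<in> {{x}}"
    then show "X \<in> maximals ?L rev_incl" using x by (auto simp: maximals_rev_incl L)
  qed
  have min: "minimals ?L rev_incl = {Cn n}"
  proof (intro equalityI subsetI)
    fix X assume "X \<in> minimals ?L rev_incl"
    then have X: "X \<in> ?L" "\<forall>Y\<in>?L. X \<subseteq> Y \<longrightarrow> Y = X" by (auto simp: minimals_def)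
    then show "X \<in> {Cn n}" using V layer_subset[of X] L[of X] by auto
  next
    fix X assume X: "X \<in> {Cn n}"
    have "Y = Cn n" if "Y \<in> ?L" "Cn n \<subseteq> Y" for Y
      using that layer_subset[of Y] L[of Y] by blast
    then show "X \<in> minimals ?L rev_incl" using V X by (simp add: minimals_def)
  qed
  have yz: "y \<inter> z \<in> P" using layer_Int y z by blast
  have "joins ?L rev_incl {y, z} = {y \<inter> z}"
    by (rule joins_rev_incl_eq) (use y z yz in \<open>auto simp: L\<close>)
  then have j: "joins ?L rev_incl {y, z} = maximals ?L rev_incl \<longleftrightarrow> y \<inter> z = {x}"
    using max by simp
  have m: "meets ?L rev_incl {y, z} = minimals ?L rev_incl \<longleftrightarrow> (\<forall>H\<in>A. y \<subseteq> H \<longrightarrow> \<not> z \<subseteq> H)"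
  proof
    assume me: "meets ?L rev_incl {y, z} = minimals ?L rev_incl"
    show "\<forall>H\<in>A. y \<subseteq> H \<longrightarrow> \<not> z \<subseteq> H"
    proof (intro ballI impI notI)
      fix H assume H: "H \<in> A" "y \<subseteq> H" "z \<subseteq> H"
      have "Cn n \<in> meets ?L rev_incl {y, z}" using me min by simp
      then have "\<forall>l\<in>?L. y \<subseteq> l \<and> z \<subseteq> l \<and> l \<subseteq> Cn n \<longrightarrow> l = Cn n"
        by (simp add: meets_def maximals_def)
      moreover have "H \<in> ?L" using hyp_layer[OF H(1)] H y by (auto simp: L)
      ultimately show False using H hyp_subset hyp_not_whole by blast
    qed
  next
    assume no: "\<forall>H\<in>A. y \<subseteq> H \<longrightarrow> \<not> z \<subseteq> H"
    have "l = Cn n" if "l \<in> ?L" "y \<subseteq> l" "z \<subseteq> l" for l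
      using that no layer_subset_hyp[of l] L[of l] by (meson subset_trans)
    then have "{l \<in> ?L. \<forall>s\<in>{y, z}. s \<subseteq> l} = {Cn n}"
      using V layer_subset[OF y(1)] layer_subset[OF z(1)] by auto
    then show "meets ?L rev_incl {y, z} = minimals ?L rev_incl"
      unfolding meets_def min by (auto simp: maximals_def)
  qed
  show ?thesis unfolding complements_def using j m z L by simp
qed

end

section \<open>Essential arrangements and their point layers\<close>

locale essential_arrangement = arrangement +
  assumes ess: "no_common_direction (Cn n) A"
begin

text \<open>A maximal layer is contained in each hyperplane or disjoint from it. Either way its
  directions are parallel to every hyperplane, and essentiality leaves only zero.\<close>

lemma maximal_singleton:
  assumes Y: "Y \<in> maximals P rev_incl"
  obtains x where "Y = {x}"
proof -
  have YP: "Y \<in> P" and max: "\<And>X. X \<in> P \<Longrightarrow> X \<subseteq> Y \<Longrightarrow> X = Y"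
    using Y by (auto simp: maximals_rev_incl)
  have "v = 0" if v: "v \<in> dir Y" for v
  proof -
    have vC: "v \<in> Cn n" using v dir_subset by blast
    have "par v H" if H: "H \<in> A" for H
    proof (cases "Y \<inter> H = {}")
      case True
      then show ?thesis using dir_par_disjoint YP H v by blast
    next
      case False
      then have "Y \<subseteq> H" using max[of "Y \<inter> H"] layer_Int[OF YP hyp_layer[OF H]] by blast
      then have "v \<in> dir H" using dir_mono[OF YP hyp_layer[OF H]] v by blast
      then show ?thesis by (simp add: dir_def)
    qed
    then show ?thesis using ess vC by (auto simp: no_common_direction_def)
  qed
  moreover have "0 \<in> dir Y" using fun_vs.subspace_0[OF subspace_dir[OF YP]] .
  ultimately have "dir Y = {0}" by blast
  moreover obtain x where "x \<in> Y" using layer_nonempty[OF YP] by blast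
  ultimately show thesis using dir_zero_singleton[OF YP] that by blast
qed

lemma point_in_layer:
  assumes "X \<in> P" obtains x where "{x} \<in> P" "x \<in> X"
proof -
  obtain Y where Y: "Y \<in> maximals P rev_incl" "Y \<subseteq> X"
    using exists_maximal_below[OF order_refl assms] by blast
  obtain x where "Y = {x}" using maximal_singleton[OF Y(1)] .
  then show thesis using Y that by (auto simp: maximals_rev_incl)
qed

lemma poset_rank_P: "poset_rank P rev_incl = n"
proof -
  have "elem_rank P rev_incl Y = n" if Y: "Y \<in> maximals P rev_incl" for Y
  proof -
    obtain x where x: "Y = {x}" using maximal_singleton[OF Y] .
    have YP: "Y \<in> P" using Y by (simp add: maximals_rev_incl)
    then have "dir Y = {0}" using dir_singleton x by simp
    then show ?thesis using elem_rank_layer[OF YP] by (simp add: rnk_def dim_zero_set)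
  qed
  moreover have "maximals P rev_incl \<noteq> {}"
    using exists_maximal_below[OF order_refl whole_layer] by blast
  ultimately have "elem_rank P rev_incl ` maximals P rev_incl = {n}" by auto
  then show ?thesis by (simp add: poset_rank_def)
qed

end

text \<open>Purity, join-closedness and (M1) force all maximal elements of the M-ideal to be lines with
  one common direction, and the ideal consists of the layers in that direction.\<close>

lemma (in essential_arrangement) M_ideal_direction:
  assumes n: "n = Suc m" and M: "M_ideal P rev_incl Q" and rk: "poset_rank Q rev_incl = m"
    and Qne: "Q \<noteq> {}"
  shows "\<exists>v\<in>Cn n. v \<noteq> 0 \<and> transverse_closed A v \<and> Q = layers (Cn n) {H \<in> A. par v H}"
proof -
  have ideal: "order_ideal P rev_incl Q" and pureQ: "pure Q rev_incl" and jc: "join_closed P rev_incl Q"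
    and M1: "\<And>y a. y \<in> Q \<Longrightarrow> a \<in> A \<Longrightarrow> joins P rev_incl {a, y} = {} \<Longrightarrow> a \<in> Q"
    and M2: "\<And>x. x \<in> maximals P rev_incl \<Longrightarrow>
      \<exists>y\<in>maximals Q rev_incl. modular_in (below P rev_incl x) rev_incl y"
    using M by (auto simp: M_ideal_def atoms_P)
  have QP: "Q \<subseteq> P" and down: "\<And>X Y. Y \<in> Q \<Longrightarrow> X \<in> P \<Longrightarrow> Y \<subseteq> X \<Longrightarrow> X \<in> Q"
    using ideal by (auto simp: order_ideal_def)
  \<comment> \<open>By purity every maximal element of \<open>Q\<close> has rank \<open>m\<close> in
    dimension \<open>Suc m\<close>, so it is a line.\<close>
  have dim1: "fun_vs.dim (dir y) = 1" if y: "y \<in> maximals Q rev_incl" for y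
  proof -
    obtain r where r: "\<forall>x\<in>maximals Q rev_incl. elem_rank Q rev_incl x = r"
      using pureQ by (auto simp: pure_def)
    then have "elem_rank Q rev_incl ` maximals Q rev_incl = {r}" using y by auto
    then have "r = m" using rk by (simp add: poset_rank_def)
    moreover have yQ: "y \<in> Q" using y by (simp add: maximals_rev_incl)
    ultimately have "rnk y = m"
      using r y elem_rank_order_ideal[OF ideal yQ] elem_rank_layer[of y] QP by auto
    moreover have "fun_vs.dim (dir y) \<le> n" using dim_dir_le yQ QP by blast
    ultimately show ?thesis using n unfolding rnk_def by linarith
  qed
  \<comment> \<open>If \<open>y\<close> and \<open>a\<close> meet, their join is in \<open>Q\<close>
    and maximality of \<open>y\<close> puts \<open>y\<close> inside \<open>a\<close>; if they are
    disjoint, \<open>a\<close> is parallel to \<open>y\<close>.\<close>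
  have dir_in: "dir y \<subseteq> dir a" if y: "y \<in> maximals Q rev_incl" and a: "a \<in> A" "a \<in> Q" for y a
  proof -
    have yQ: "y \<in> Q" and ymax: "\<And>X. X \<in> Q \<Longrightarrow> X \<subseteq> y \<Longrightarrow> X = y"
      using y by (auto simp: maximals_rev_incl)
    have yP: "y \<in> P" using yQ QP by blast
    show ?thesis
    proof (cases "y \<inter> a = {}")
      case True
      then show ?thesis using dir_par_disjoint[OF yP a(1)] dir_subset by (auto simp: dir_def)
    next
      case False
      have "{y, a} \<subseteq> Q" using yQ a by blast
      then have "joins P rev_incl {y, a} \<subseteq> Q" using jc by (simp add: join_closed_def)
      then have "y \<inter> a \<in> Q" using joins_P_pair[OF yP hyp_layer[OF a(1)]] False by simp
      then have "y \<subseteq> a" using ymax[of "y \<inter> a"] by blast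
      then show ?thesis using dir_mono[OF yP hyp_layer[OF a(1)]] by blast
    qed
  qed
  \<comment> \<open>(M1) excludes an empty intersection, and since \<open>Q\<close> is an order
    ideal the line \<open>y\<close> does not lie in \<open>a\<close>; it therefore meets
    \<open>a\<close> in a single point.\<close>
  have meet: "y \<inter> a \<noteq> {} \<and> dir (y \<inter> a) = {0}"
    if y: "y \<in> maximals Q rev_incl" and a: "a \<in> A" "a \<notin> Q" for y a
  proof -
    have yQ: "y \<in> Q" using y by (simp add: maximals_rev_incl)
    have yP: "y \<in> P" using yQ QP by blast
    have ne: "y \<inter> a \<noteq> {}" using M1[OF yQ a(1)] a(2) joins_P_pair[OF hyp_layer[OF a(1)] yP]
      by (auto simp: Int_commute)
    have L: "y \<inter> a \<in> P" using layer_Int[OF yP hyp_layer[OF a(1)] ne] .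
    have "\<not> y \<subseteq> a" using down[OF yQ hyp_layer[OF a(1)]] a by blast
    then have "y \<inter> a \<subset> y" by blast
    then have "fun_vs.dim (dir (y \<inter> a)) < 1" using dim_dir_strict[OF L yP] dim1[OF y] by simp
    then show ?thesis using ne dim_eq_0_Cn[OF subspace_dir[OF L] dir_subset] by simp
  qed
  obtain y0 where y0: "y0 \<in> maximals Q rev_incl" using exists_maximal_below[OF QP] Qne by blast
  have y0P: "y0 \<in> P" using y0 QP by (auto simp: maximals_rev_incl)
  have "dir y0 \<noteq> {0}" using dim1[OF y0] dim_zero_set by (metis zero_neq_one)
  moreover have "0 \<in> dir y0" using fun_vs.subspace_0[OF subspace_dir[OF y0P]] .
  ultimately obtain v where v: "v \<in> dir y0" "v \<noteq> 0" by blast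
  have vC: "v \<in> Cn n" using v dir_subset by blast
  \<comment> \<open>The direction of the single line \<open>y0\<close> thus decides for every
    hyperplane whether it belongs to \<open>Q\<close>.\<close>
  have par: "par v a \<longleftrightarrow> a \<in> Q" if a: "a \<in> A" for a
  proof
    assume p: "par v a"
    show "a \<in> Q"
    proof (rule ccontr)
      assume "a \<notin> Q"
      from meet[OF y0 a this] have ne: "y0 \<inter> a \<noteq> {}" and d: "dir (y0 \<inter> a) = {0}" by auto
      have "v \<in> dir y0 \<inter> {v. ff a v = 0}" using v p par_iff[OF a vC] by simp
      then have "v \<in> dir (y0 \<inter> a)" using dir_Int_hyp[OF y0P a ne] by simp
      then show False using d v(2) by simp
    qed
  next
    assume "a \<in> Q"
    then show "par v a" using dir_in[OF y0 a] v by (auto simp: dir_def)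
  qed
  have tc: "transverse_closed A v"
    unfolding transverse_closed_def
  proof (intro ballI impI, elim conjE)
    fix H K assume H: "H \<in> A" and K: "K \<in> A" and HK: "H \<noteq> K" "\<not> par v H" "\<not> par v K" "H \<inter> K \<noteq> {}"
    have HQ: "H \<notin> Q" "K \<notin> Q" using HK par H K by auto
    have z: "H \<inter> K \<in> P" using layer_Int[OF hyp_layer[OF H] hyp_layer[OF K] HK(4)] .
    obtain x where x: "{x} \<in> P" "x \<in> H \<inter> K" using point_in_layer[OF z] .
    obtain y where y: "y \<in> maximals Q rev_incl" "modular_in (below P rev_incl {x}) rev_incl y"
      using M2[OF singleton_maximal[OF x(1)]] by blast
    have yP: "y \<in> P" and xy: "x \<in> y" using y(2) by (auto simp: modular_in_def below_def)
    have yQ: "y \<in> Q" using y(1) by (simp add: maximals_rev_incl)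
    have yH: "y \<inter> H = {x}"
    proof -
      have "dir (y \<inter> H) = {0}" "y \<inter> H \<in> P"
        using meet[OF y(1) H HQ(1)] layer_Int[OF yP hyp_layer[OF H]] by auto
      moreover have "x \<in> y \<inter> H" using x xy by simp
      ultimately show ?thesis using dir_zero_singleton by metis
    qed
    have up: "a \<in> Q" if "a \<in> A" "y \<subseteq> a" for a using down[OF yQ hyp_layer] that by blast
    show "\<exists>L\<in>A. par v L \<and> H \<inter> K \<subseteq> L"
    proof (rule ccontr)
      assume no: "\<not> (\<exists>L\<in>A. par v L \<and> H \<inter> K \<subseteq> L)"
      \<comment> \<open>Without a parallel hyperplane containing \<open>H \<inter> K\<close>, both
        \<open>H\<close> and \<open>H \<inter> K\<close> are complements of \<open>y\<close>. They
        are comparable, so modularity of \<open>y\<close> identifies them, which gives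
        \<open>H = K\<close>.\<close>
      have "H \<in> complements (below P rev_incl {x}) rev_incl y"
      proof -
        have "\<not> H \<subseteq> a" if "a \<in> A" "y \<subseteq> a" for a
          using hyp_subset_eq[OF H that(1)] up[OF that] HQ(1) by auto
        then show ?thesis
          using mem_complements_below[OF x(1) yP xy hyp_layer[OF H]] x(2) yH by simp
      qed
      moreover have "H \<inter> K \<in> complements (below P rev_incl {x}) rev_incl y"
      proof -
        have "\<not> H \<inter> K \<subseteq> a" if "a \<in> A" "y \<subseteq> a" for a
          using no par[OF that(1)] up[OF that] that(1) by blast
        moreover have "y \<inter> (H \<inter> K) = {x}" using yH x(2) by blast
        ultimately show ?thesis
          using mem_complements_below[OF x(1) yP xy z] x(2) by simp
      qed
      ultimately have "H = H \<inter> K"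
        using y(2) unfolding modular_in_def by (metis Int_lower1)
      then have "H \<subseteq> K" by blast
      then show False using hyp_subset_eq[OF H K] HK(1) by simp
    qed
  qed
  have "Q = layers (Cn n) {H \<in> A. par v H}"
  proof (intro equalityI subsetI)
    fix X assume X: "X \<in> Q"
    then have XP: "X \<in> P" using QP by blast
    have "H \<in> Q" if "H \<in> A" "X \<subseteq> H" for H using down[OF X hyp_layer] that by blast
    then have "{H \<in> A. X \<subseteq> H} \<subseteq> {H \<in> A. par v H}" using par by blast
    then show "X \<in> layers (Cn n) {H \<in> A. par v H}"
      unfolding layers_def mem_Collect_eq
      using layer_eq_Inter_hyps[OF XP] layer_nonempty[OF XP] by metis
  next
    fix X assume "X \<in> layers (Cn n) {H \<in> A. par v H}"
    then obtain S where S: "S \<subseteq> {H \<in> A. par v H}" "X = Cn n \<inter> \<Inter>S" "X \<noteq> {}"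
      by (auto simp: layers_def)
    have "S \<subseteq> Q" using S(1) par by blast
    then have "joins P rev_incl S \<subseteq> Q" using jc by (simp add: join_closed_def)
    moreover have "S \<subseteq> P" using S(1) hyp_layer by blast
    ultimately show "X \<in> Q" using joins_P_Inter[of S] S by auto
  qed
  then show ?thesis using vC v tc by blast
qed

lemma (in essential_arrangement) supersolvable_imp_direction:
  assumes n: "n = Suc m" and "supersolvable P rev_incl"
  shows "\<exists>v\<in>Cn n. v \<noteq> 0 \<and> transverse_closed A v \<and>
    supersolvable (layers (Cn n) {H \<in> A. par v H}) rev_incl"
proof -
  obtain N Q b where Q: "bottom_of P rev_incl b" "Q 0 = {b}" "Q N = P"
      "\<And>i. i < N \<Longrightarrow> Q i \<subset> Q (Suc i) \<and> M_ideal (Q (Suc i)) rev_incl (Q i)"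
      "\<And>i. i \<le> N \<Longrightarrow> poset_rank (Q i) rev_incl = i"
    using assms(2) unfolding supersolvable_def by blast
  \<comment> \<open>Each \<open>Q i\<close> has rank \<open>i\<close> and \<open>P\<close> has rank
    \<open>n\<close>, so the chain has length \<open>n\<close> and \<open>Q m\<close> is its last
    proper member.\<close>
  have N: "N = Suc m" using Q(5)[of N] Q(3) poset_rank_P n by simp
  have b: "b \<in> Q i" if "i \<le> N" for i
    using that
  proof (induction i)
    case (Suc i) then show ?case using Q(4)[of i] by auto
  qed (simp add: Q(2))
  have bm: "bottom_of (Q m) rev_incl b"
    using Q(1) Q(4)[of m] Q(3) b[of m] N by (auto simp: bottom_of_def)
  have ss: "supersolvable (Q m) rev_incl"
    unfolding supersolvable_def using Q bm N
    by (intro exI[of _ m] exI[of _ Q] conjI exI[of _ b]) auto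
  obtain v where v: "v \<in> Cn n" "v \<noteq> 0" "transverse_closed A v"
      "Q m = layers (Cn n) {H \<in> A. par v H}"
    using Q(4)[of m] Q(5)[of m] Q(3) b[of m] N M_ideal_direction[OF n, of "Q m"] by auto
  show ?thesis using ss v(1-3) unfolding v(4) by (intro bexI[of _ v] conjI)
qed


lemma supersolvable_extend:
  assumes "supersolvable Q le" "M_ideal P le Q" "Q \<subset> P" "poset_rank P le = Suc (poset_rank Q le)"
    and "\<And>b. bottom_of Q le b \<Longrightarrow> bottom_of P le b"
  shows "supersolvable P le"
proof -
  obtain N R b where R: "bottom_of Q le b" "R 0 = {b}" "R N = Q"
      "\<And>i. i < N \<Longrightarrow> R i \<subset> R (Suc i) \<and> M_ideal (R (Suc i)) le (R i)"
      "\<And>i. i \<le> N \<Longrightarrow> poset_rank (R i) le = i"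
    using assms(1) unfolding supersolvable_def by blast
  define R' where "R' = R(Suc N := P)"
  have "bottom_of P le b" using assms(5) R(1) .
  moreover have "R' 0 = {b}" "R' (Suc N) = P" using R by (auto simp: R'_def)
  moreover have "R' i \<subset> R' (Suc i) \<and> M_ideal (R' (Suc i)) le (R' i)" if "i < Suc N" for i
    using that R(3) R(4)[of i] assms(2,3) by (cases "i = N") (auto simp: R'_def)
  moreover have "poset_rank (R' i) le = i" if "i \<le> Suc N" for i
    using that R(3) R(5)[of i] R(5)[of N] assms(4) by (cases "i = Suc N") (auto simp: R'_def)
  ultimately show ?thesis unfolding supersolvable_def by blast
qed

section \<open>The ideal attached to a transverse-closed direction\<close>

locale transverse_arrangement = essential_arrangement +
  fixes v :: "nat \<Rightarrow> complex"
  assumes v: "v \<in> Cn n" "v \<noteq> 0" and tc: "transverse_closed A v"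
begin

abbreviation "Av \<equiv> {H \<in> A. par v H}"

sublocale Q: arrangement n Av ff cc
  by (rule sub_arrangement) blast

definition line_through :: "(nat \<Rightarrow> complex) \<Rightarrow> (nat \<Rightarrow> complex) set" where
  "line_through x = range (\<lambda>t. x + fun_scale t v)"

text \<open>If all hyperplanes through \<open>x\<close> were parallel to \<open>v\<close>, their
  intersection would contain \<open>x + v\<close> besides \<open>x\<close>.\<close>

lemma point_transverse:
  assumes x: "{x} \<in> P"
  obtains H where "H \<in> A" "x \<in> H" "\<not> par v H"
proof -
  have xC: "x \<in> Cn n" using layer_subset[OF x] by simp
  have "x + v \<notin> {x}" using v(2) by simp
  then obtain H where H: "H \<in> A" "x \<in> H" "x + v \<notin> H"
    using mem_layer_iff[OF x, of "x + v"] Cn_add[OF xC v(1)] by auto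
  then show thesis using that[of H] by (auto simp: par_def)
qed

text \<open>A point \<open>y\<close> of the intersection is slid along \<open>v\<close> onto one
  transverse hyperplane \<open>H\<close> through \<open>x\<close>; transverse closure and the
  exchange lemma then place it on every other transverse hyperplane through \<open>x\<close>. The
  slid point is therefore \<open>x\<close> itself.\<close>

lemma line_eq_Inter:
  assumes x: "{x} \<in> P"
  shows "line_through x = Cn n \<inter> \<Inter>{H \<in> Av. x \<in> H}"
proof (intro equalityI subsetI)
  have xC: "x \<in> Cn n" using layer_subset[OF x] by simp
  fix y assume "y \<in> line_through x"
  then obtain t where t: "y = x + fun_scale t v" by (auto simp: line_through_def)
  then show "y \<in> Cn n \<inter> \<Inter>{H \<in> Av. x \<in> H}"
    using xC v(1) by (auto simp: mem_iff ff_simps Cn_closed par_iff)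
next
  have xC: "x \<in> Cn n" using layer_subset[OF x] by simp
  fix y assume "y \<in> Cn n \<inter> \<Inter>{H \<in> Av. x \<in> H}"
  then have yC: "y \<in> Cn n" and yH: "\<And>H. H \<in> Av \<Longrightarrow> x \<in> H \<Longrightarrow> y \<in> H" by auto
  obtain H where H: "H \<in> A" "x \<in> H" "\<not> par v H" using point_transverse[OF x] .
  obtain t where t: "y + fun_scale t v \<in> H" using hyp_meets_line[OF H(1) v(1) H(3) yC] by blast
  define z where "z = y + fun_scale t v"
  have zC: "z \<in> Cn n" using yC v by (auto simp: z_def Cn_closed)
  have zv: "z \<in> L" if L: "L \<in> Av" "x \<in> L" for L
  proof -
    have "y \<in> L" using yH[OF L] .
    then show ?thesis using L v(1) zC by (auto simp: z_def mem_iff ff_simps Cn_closed par_iff)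
  qed
  have "z \<in> K" if K: "K \<in> A" "x \<in> K" for K
  proof (cases "par v K \<or> K = H")
    case True
    then show ?thesis using zv K t z_def by auto
  next
    case False
    then obtain L where L: "L \<in> A" "par v L" "H \<inter> K \<subseteq> L"
      using tc H K unfolding transverse_closed_def by blast
    have "H \<noteq> L" using L H by blast
    then have "H \<inter> L \<subseteq> K" using codim_two_exchange[OF H(1) K(1) L(1)] H K L by blast
    moreover have "z \<in> L" using zv[of L] L H K by blast
    ultimately show ?thesis using t z_def by blast
  qed
  then have "z \<in> {x}" using zC mem_layer_iff[OF x, of z] by simp
  then have "y = x + fun_scale (- t) v"
    by (auto simp: z_def fun_scale_def fun_eq_iff eq_diff_eq)
  then show "y \<in> line_through x" unfolding line_through_def by (rule range_eqI)
qed

lemma mem_line: "x \<in> line_through x"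
  unfolding line_through_def by (rule range_eqI[of _ _ 0]) (simp add: fun_scale_def fun_eq_iff)

lemma line_layer:
  assumes x: "{x} \<in> P" shows "line_through x \<in> Q.P"
  unfolding layers_def mem_Collect_eq
proof (intro conjI exI)
  show "line_through x \<noteq> {}" using mem_line by blast
  show "line_through x = Cn n \<inter> \<Inter>{H \<in> Av. x \<in> H}" by (rule line_eq_Inter[OF x])
qed blast

lemma Q_subset: "Q.P \<subseteq> P"
  unfolding layers_def by blast

lemma dim_dir_line:
  assumes x: "{x} \<in> P" shows "fun_vs.dim (Q.dir (line_through x)) = 1"
proof -
  have "Q.dir (line_through x) = fun_vs.span {v}"
  proof -
    have "w \<in> Q.dir (line_through x) \<longleftrightarrow> (\<exists>t. w = fun_scale t v)" if "w \<in> Cn n" for w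
      using Q.layer_translate_iff[OF line_layer[OF x] mem_line that]
      by (auto simp: line_through_def)
    moreover have "fun_scale t v \<in> Cn n" for t using v Cn_closed by blast
    ultimately have "Q.dir (line_through x) = range (\<lambda>t. fun_scale t v)"
      using Q.dir_subset by blast
    then show ?thesis by (simp add: fun_vs.span_singleton)
  qed
  moreover have "fun_vs.independent {v}" using v by simp
  ultimately show ?thesis using fun_vs.dim_span_eq_card_independent[of "{v}"] by simp
qed

lemma maximal_line:
  assumes "y \<in> maximals Q.P rev_incl"
  obtains x where "{x} \<in> P" "y = line_through x"
proof -
  have yQ: "y \<in> Q.P" and max: "\<And>X. X \<in> Q.P \<Longrightarrow> X \<subseteq> y \<Longrightarrow> X = y"
    using assms by (auto simp: maximals_rev_incl)
  obtain x where x: "{x} \<in> P" "x \<in> y" using point_in_layer[of y] yQ Q_subset by blast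
  have "line_through x \<subseteq> y"
    using line_eq_Inter[OF x(1)] Q.mem_layer_iff[OF yQ] x(2) by auto
  then show thesis using max[OF line_layer[OF x(1)]] x that by blast
qed

text \<open>A maximal element inside the line is again of the form \<open>line_through x'\<close>,
  so the dimensions agree and the inclusion cannot be strict.\<close>

lemma line_maximal:
  assumes x: "{x} \<in> P" shows "line_through x \<in> maximals Q.P rev_incl"
proof -
  obtain y where y: "y \<in> maximals Q.P rev_incl" "y \<subseteq> line_through x"
    using Q.exists_maximal_below[OF order_refl line_layer[OF x]] by blast
  obtain x' where x': "{x'} \<in> P" "y = line_through x'" using maximal_line[OF y(1)] .
  have "y = line_through x"
  proof (rule ccontr)
    assume "y \<noteq> line_through x"
    then have "y \<subset> line_through x" using y by blast
    then have "fun_vs.dim (Q.dir y) < fun_vs.dim (Q.dir (line_through x))"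
      using Q.dim_dir_strict line_layer x x' by blast
    then show False using dim_dir_line x x' by simp
  qed
  then show ?thesis using y by simp
qed

lemma elem_rank_maximal_Q:
  assumes "y \<in> maximals Q.P rev_incl" shows "elem_rank Q.P rev_incl y = n - 1"
proof -
  obtain x where x: "{x} \<in> P" "y = line_through x" using maximal_line[OF assms] .
  then show ?thesis
    using Q.elem_rank_layer[OF line_layer[OF x(1)]] dim_dir_line[OF x(1)] by (simp add: Q.rnk_def)
qed

lemma poset_rank_Q: "poset_rank Q.P rev_incl = n - 1"
proof -
  obtain x where "{x} \<in> P" using point_in_layer[OF whole_layer] .
  then have "maximals Q.P rev_incl \<noteq> {}" using line_maximal by blast
  then have "elem_rank Q.P rev_incl ` maximals Q.P rev_incl = {n - 1}"
    using elem_rank_maximal_Q by auto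
  then show ?thesis by (simp add: poset_rank_def)
qed

lemma order_ideal_Q: "order_ideal P rev_incl Q.P"
  unfolding order_ideal_def
proof (intro conjI ballI impI)
  show "Q.P \<subseteq> P" by (rule Q_subset)
  fix Y X assume Y: "Y \<in> Q.P" and X: "X \<in> P" "Y \<subseteq> X"
  have "par v H" if H: "H \<in> A" "X \<subseteq> H" for H
  proof -
    obtain S where S: "S \<subseteq> Av" "Y = Cn n \<inter> \<Inter>S" "Y \<noteq> {}" using Y by (rule Q.layerE)
    obtain y where y: "y \<in> Y" using S by blast
    have "y + v \<in> Y" using y S v by (auto simp: par_def Cn_closed)
    then have "y \<in> H" "y + v \<in> H" using y X H by auto
    then show ?thesis using H(1) v(1) by (simp add: par_iff mem_iff ff_simps)
  qed
  then have "{H \<in> A. X \<subseteq> H} \<subseteq> Av" by blast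
  then show "X \<in> Q.P"
    unfolding layers_def mem_Collect_eq
    using layer_eq_Inter_hyps[OF X(1)] layer_nonempty[OF X(1)] by metis
qed

text \<open>A complement \<open>z\<close> of the line is not the whole space and lies in no
  hyperplane parallel to \<open>v\<close>, since those through \<open>x\<close> contain the line.
  Two transverse hyperplanes containing \<open>z\<close> would by closure put it into a parallel
  one. So \<open>z\<close> is a single hyperplane, and hyperplanes form an antichain.\<close>

lemma modular_line:
  assumes x: "{x} \<in> P"
  shows "modular_in (below P rev_incl {x}) rev_incl (line_through x)"
proof -
  let ?L = "below P rev_incl {x}" and ?y = "line_through x"
  have yP: "?y \<in> P" using line_layer[OF x] Q_subset by blast
  have L: "X \<in> ?L \<longleftrightarrow> X \<in> P \<and> x \<in> X" for X by (auto simp: below_def)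
  have yH: "?y \<subseteq> H" if "H \<in> Av" "x \<in> H" for H using line_eq_Inter[OF x] that by blast
  have hyp: "z \<in> A" if z: "z \<in> complements ?L rev_incl ?y" for z
  proof -
    have zP: "z \<in> P" "x \<in> z" using z L by (auto simp: complements_def)
    have c: "?y \<inter> z = {x}" "\<And>H. H \<in> A \<Longrightarrow> ?y \<subseteq> H \<Longrightarrow> \<not> z \<subseteq> H"
      using z mem_complements_below[OF x yP mem_line zP] by auto
    have "x + v \<in> ?y" unfolding line_through_def
      by (rule range_eqI[of _ _ 1]) (simp add: fun_scale_def fun_eq_iff)
    moreover have "x + v \<notin> {x}" using v(2) by simp
    ultimately have "x + v \<notin> z" unfolding c(1)[symmetric] by blast
    moreover have "x + v \<in> Cn n" using v layer_subset[OF x] Cn_closed by simp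
    ultimately have "z \<noteq> Cn n" by blast
    then obtain H where H: "H \<in> A" "z \<subseteq> H" using layer_subset_hyp[OF zP(1)] by blast
    have np: "\<not> par v K" if K: "K \<in> A" "z \<subseteq> K" for K
      using c(2)[OF K(1)] yH[of K] K zP by blast
    have uniq: "K = H" if K: "K \<in> A" "z \<subseteq> K" for K
    proof (rule ccontr)
      assume "K \<noteq> H"
      moreover have "K \<inter> H \<noteq> {}" using K H zP by blast
      ultimately obtain M where M: "M \<in> A" "par v M" "K \<inter> H \<subseteq> M"
        using tc K(1) H(1) np[OF K] np[OF H] unfolding transverse_closed_def by blast
      then show False using np[of M] K H by blast
    qed
    have "z = H"
    proof (rule subset_antisym[OF H(2)], rule subsetI)
      fix u assume "u \<in> H"
      then show "u \<in> z" using mem_layer_iff[OF zP(1), of u] uniq hyp_subset[OF H(1)] by auto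
    qed
    then show ?thesis using H by simp
  qed
  show ?thesis
    unfolding modular_in_def
  proof (intro conjI ballI impI)
    show "?y \<in> ?L" using yP mem_line L by blast
    fix z w assume "z \<in> complements ?L rev_incl ?y" "w \<in> complements ?L rev_incl ?y" "w \<subseteq> z"
    then show "z = w" using hyp_subset_eq[of w z] hyp by blast
  qed
qed

lemma M_ideal_Q: "M_ideal P rev_incl Q.P"
  unfolding M_ideal_def
proof (intro conjI ballI impI)
  show "order_ideal P rev_incl Q.P" by (rule order_ideal_Q)
  show "pure Q.P rev_incl" using elem_rank_maximal_Q unfolding pure_def by blast
  show "join_closed P rev_incl Q.P"
    unfolding join_closed_def
  proof (intro allI impI)
    fix S assume S: "S \<subseteq> Q.P"
    then have SP: "S \<subseteq> P" using Q_subset by blast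
    show "joins P rev_incl S \<subseteq> Q.P"
    proof (cases "Cn n \<inter> \<Inter>S = {}")
      case True
      then show ?thesis using joins_P_empty by simp
    next
      case False
      then show ?thesis using joins_P_Inter[OF SP] Q.layer_Inter[OF S] by simp
    qed
  qed
next
  fix y a assume y: "y \<in> Q.P" and a: "a \<in> atoms P rev_incl" and e: "joins P rev_incl {a, y} = {}"
  have aA: "a \<in> A" using a atoms_P by simp
  have yP: "y \<in> P" using y Q_subset by blast
  have "y \<inter> a = {}" using e joins_P_pair[OF hyp_layer[OF aA] yP] by (auto split: if_splits)
  moreover have "v \<in> dir y"
  proof -
    obtain S where S: "S \<subseteq> Av" "y = Cn n \<inter> \<Inter>S" using y by (rule Q.layerE)
    then show ?thesis using v by (auto simp: dir_def par_def Cn_closed)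
  qed
  ultimately have "par v a" using dir_par_disjoint[OF yP aA] by blast
  then show "a \<in> Q.P" using Q.hyp_layer aA by blast
next
  fix X assume X: "X \<in> maximals P rev_incl"
  obtain x where x: "X = {x}" using maximal_singleton[OF X] .
  then have xP: "{x} \<in> P" using X by (simp add: maximals_rev_incl)
  show "\<exists>y\<in>maximals Q.P rev_incl. modular_in (below P rev_incl X) rev_incl y"
    using line_maximal[OF xP] modular_line[OF xP] x by blast
qed

lemma supersolvable_if_direction:
  assumes "supersolvable Q.P rev_incl"
  shows "supersolvable P rev_incl"
proof (rule supersolvable_extend[OF assms M_ideal_Q])
  \<comment> \<open>A nonzero \<open>v\<close> forces \<open>n > 0\<close>, so the rank
    \<open>n - 1\<close> of the ideal really is one less than \<open>n\<close>.\<close>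
  have "n \<noteq> 0" using v by (auto simp: Cn_def fun_eq_iff)
  then show rk: "poset_rank P rev_incl = Suc (poset_rank Q.P rev_incl)"
    by (simp add: poset_rank_Q poset_rank_P)
  then have "Q.P \<noteq> P" by auto
  then show "Q.P \<subset> P" using Q_subset by blast
  show "bottom_of P rev_incl b" if "bottom_of Q.P rev_incl b" for b
    using that bottom_of_P_iff Q.bottom_of_P_iff by simp
qed

text \<open>A common direction of the hyperplanes parallel to \<open>v\<close> preserves the line through a point
  layer, hence is a multiple of \<open>v\<close>.\<close>

lemma common_direction_Q:
  assumes w: "w \<in> Cn n" "\<And>H. H \<in> Av \<Longrightarrow> par w H"
  obtains t where "w = fun_scale t v"
proof -
  obtain x where x: "{x} \<in> P" using point_in_layer[OF whole_layer] .
  have xC: "x \<in> Cn n" using layer_subset[OF x] by simp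
  have "x + w \<in> Cn n \<inter> \<Inter>{H \<in> Av. x \<in> H}"
    using w xC by (auto simp: Cn_closed par_def)
  then have "x + w \<in> line_through x" using line_eq_Inter[OF x] by simp
  then obtain t where "x + w = x + fun_scale t v" unfolding line_through_def by (rule rangeE)
  then have "w = fun_scale t v" by simp
  then show thesis by (rule that)
qed

end

section \<open>Ends of the punctured plane\<close>

text \<open>\<open>None\<close> is the end at infinity and \<open>Some s\<close> the end at the
  puncture \<open>s\<close>. The radius \<open>1 / \<epsilon>\<close> lets one small parameter
  shrink all ends at once.\<close>

fun end_nbhd :: "real \<Rightarrow> complex option \<Rightarrow> complex set" where
  "end_nbhd \<epsilon> None = - cball 0 (1 / \<epsilon>)"
| "end_nbhd \<epsilon> (Some s) = ball s \<epsilon> - {s}"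

definition ends :: "complex set \<Rightarrow> complex option set" where
  "ends S = insert None (Some ` S)"

lemma finite_ends: "finite S \<Longrightarrow> finite (ends S)"
  by (simp add: ends_def)

lemma card_ends: "finite S \<Longrightarrow> card (ends S) = Suc (card S)"
  by (simp add: ends_def card_image)

lemma open_end_nbhd: "open (end_nbhd \<epsilon> j)"
  by (cases j) (auto intro: open_Diff)

lemma connected_end_nbhd: "connected (end_nbhd \<epsilon> j)"
  by (cases j) (auto intro: connected_complement_bounded_convex connected_punctured_ball)

lemma end_nbhd_mono: "0 < \<delta> \<Longrightarrow> \<delta> \<le> \<epsilon> \<Longrightarrow> end_nbhd \<delta> j \<subseteq> end_nbhd \<epsilon> j"
proof (cases j)
  case None
  assume "0 < \<delta>" "\<delta> \<le> \<epsilon>"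
  then have "1 / \<epsilon> \<le> 1 / \<delta>" by (simp add: frac_le)
  then show ?thesis using None by auto
qed auto

lemma end_nbhd_nonempty:
  assumes "0 < \<epsilon>" shows "end_nbhd \<epsilon> j \<noteq> {}"
proof (cases j)
  case None
  have "complex_of_real (1 / \<epsilon> + 1) \<in> end_nbhd \<epsilon> None"
    using assms unfolding end_nbhd.simps by (simp add: norm_of_real del: of_real_add of_real_divide)
  then show ?thesis using None by auto
next
  case (Some s)
  have "s + of_real (\<epsilon> / 2) \<in> end_nbhd \<epsilon> (Some s)"
    using assms by (auto simp: dist_norm)
  then show ?thesis using Some by auto
qed

text \<open>Stated as an eventuality in the radius, so that finitely many smallness conditions
  combine by filter reasoning instead of explicit minima.\<close>

lemma eventually_end_nbhd_disjoint_compact: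
  assumes K: "compact K" and j: "\<And>t. j = Some t \<Longrightarrow> t \<notin> K"
  shows "\<forall>\<^sub>F \<epsilon> in at_right 0. end_nbhd \<epsilon> j \<inter> K = {}"
proof (cases j)
  case None
  obtain B where B: "B > 0" "\<And>x. x \<in> K \<Longrightarrow> norm x \<le> B"
    using compact_imp_bounded[OF K] bounded_pos by blast
  have "end_nbhd \<epsilon> j \<inter> K = {}" if "0 < \<epsilon>" "\<epsilon> < 1 / B" for \<epsilon>
  proof -
    have "B < 1 / \<epsilon>" using that B by (simp add: field_simps)
    then show ?thesis using B None by force
  qed
  then show ?thesis using B by (auto simp: eventually_at_right_field intro!: exI[of _ "1 / B"])
next
  case (Some t)
  have "open (- K)" "t \<in> - K" using K j Some compact_imp_closed by auto
  then obtain e where e: "e > 0" "ball t e \<subseteq> - K" using open_contains_ball by blast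
  have "end_nbhd \<epsilon> j \<inter> K = {}" if "0 < \<epsilon>" "\<epsilon> < e" for \<epsilon>
    using e(2) Some subset_ball[of \<epsilon> e t] that by auto
  then show ?thesis using e by (auto simp: eventually_at_right_field intro!: exI[of _ e])
qed

lemma eventually_end_nbhd_disjoint:
  assumes "i \<noteq> j"
  shows "\<forall>\<^sub>F \<epsilon> in at_right 0. end_nbhd \<epsilon> i \<inter> end_nbhd \<epsilon> j = {}"
proof -
  \<comment> \<open>For radius below 1 every punctured disc at \<open>t\<close> lies in the fixed
    compact disc \<open>cball t 1\<close>, which the end at infinity eventually leaves.\<close>
  have None_Some: "\<forall>\<^sub>F \<epsilon> in at_right 0. end_nbhd \<epsilon> None \<inter> end_nbhd \<epsilon> (Some t) = {}" for t
  proof -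
    have "\<forall>\<^sub>F \<epsilon> in at_right 0. end_nbhd \<epsilon> None \<inter> cball t 1 = {}"
      by (rule eventually_end_nbhd_disjoint_compact) auto
    moreover have "\<forall>\<^sub>F \<epsilon> in at_right (0::real). \<epsilon> < 1"
      by (auto simp: eventually_at_right_field intro!: exI[of _ 1])
    ultimately show ?thesis by eventually_elim auto
  qed
  have Some_Some: "\<forall>\<^sub>F \<epsilon> in at_right 0. end_nbhd \<epsilon> (Some s) \<inter> end_nbhd \<epsilon> (Some t) = {}"
    if "s \<noteq> t" for s t
  proof -
    have "end_nbhd \<epsilon> (Some s) \<inter> end_nbhd \<epsilon> (Some t) = {}" if "\<epsilon> < dist s t / 2" for \<epsilon>
    proof -
      have False if "z \<in> ball s \<epsilon>" "z \<in> ball t \<epsilon>" for z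
        using that dist_triangle2[of s t z] \<open>\<epsilon> < dist s t / 2\<close> by (auto simp: dist_commute)
      then show ?thesis by fastforce
    qed
    then show ?thesis using that unfolding eventually_at_right_field
      by (intro exI[of _ "dist s t / 2"]) (simp del: end_nbhd.simps)
  qed
  show ?thesis
  proof (cases i; cases j)
    fix t assume "i = Some t" "j = None"
    then show ?thesis using None_Some[of t] by (simp add: Int_commute)
  qed (use assms None_Some Some_Some in auto)
qed

text \<open>The neighbourhood of \<open>Some t\<close> omits \<open>t\<close> by definition, so only
  the other punctures remain to be avoided, and they form a compact set.\<close>

lemma eventually_end_nbhd_avoids:
  assumes "finite S"
  shows "\<forall>\<^sub>F \<epsilon> in at_right 0. end_nbhd \<epsilon> j \<inter> S = {}"
proof -
  have "\<forall>\<^sub>F \<epsilon> in at_right 0. end_nbhd \<epsilon> j \<inter> (S - {t. j = Some t}) = {}"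
    by (rule eventually_end_nbhd_disjoint_compact) (use assms finite_imp_compact in auto)
  then show ?thesis
  proof eventually_elim
    case (elim \<epsilon>)
    then show ?case by (cases j) auto
  qed
qed

text \<open>What remains is the closed disc of radius \<open>1 / \<epsilon>\<close> minus open discs
  around the punctures, each puncture lying in its own disc.\<close>

lemma compact_core:
  assumes "finite S"  "0 < \<epsilon>"
  shows "compact (UNIV - S - (\<Union>j\<in>ends S. end_nbhd \<epsilon> j))"
proof -
  have "UNIV - S - (\<Union>j\<in>ends S. end_nbhd \<epsilon> j) = cball 0 (1 / \<epsilon>) - (\<Union>s\<in>S. ball s \<epsilon>)"
    using assms(2) by (auto simp: ends_def)
  moreover have "compact (cball 0 (1 / \<epsilon>) - (\<Union>s\<in>S. ball s \<epsilon>))"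
    by (intro compact_diff) auto
  ultimately show ?thesis by simp
qed

lemma connected_subset_of_disjoint_open:
  assumes "connected C" and "\<And>i. i \<in> I \<Longrightarrow> open (U i)" and "C \<subseteq> (\<Union>i\<in>I. U i)"
    and disj: "\<And>i j. i \<in> I \<Longrightarrow> j \<in> I \<Longrightarrow> i \<noteq> j \<Longrightarrow> U i \<inter> U j = {}"
    and i: "i \<in> I" "C \<inter> U i \<noteq> {}"
  shows "C \<subseteq> U i"
proof -
  let ?W = "\<Union>j\<in>I - {i}. U j"
  have "open ?W" using assms by auto
  moreover have "U i \<inter> ?W \<inter> C = {}" using disj i by blast
  moreover have "C \<subseteq> U i \<union> ?W" using assms by blast
  ultimately have "U i \<inter> C = {} \<or> ?W \<inter> C = {}"
    using connectedD[OF assms(1), of "U i" ?W] assms(2) i by blast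
  then show ?thesis using i \<open>C \<subseteq> U i \<union> ?W\<close> by blast
qed

text \<open>Outside a compact set, each end neighbourhood on one side lies in exactly one on the other.\<close>

lemma card_punctures_le:
  fixes S T :: "complex set"
  assumes S: "finite S" and T: "finite T" and hom: "homeomorphism (UNIV - S) (UNIV - T) h k"
  shows "card S \<le> card T"
proof -
  have "\<forall>\<^sub>F \<epsilon> in at_right (0::real). 0 < \<epsilon>" by (simp add: eventually_at_right_less)
  moreover have "\<forall>\<^sub>F \<epsilon> in at_right 0. \<forall>i\<in>ends S. end_nbhd \<epsilon> i \<inter> S = {}"
    using finite_ends[OF S] eventually_end_nbhd_avoids[OF S] by (simp add: eventually_ball_finite)
  moreover have "\<forall>\<^sub>F \<epsilon> in at_right 0. \<forall>i\<in>ends S. \<forall>j\<in>ends S. i \<noteq> j \<longrightarrow> end_nbhd \<epsilon> i \<inter> end_nbhd \<epsilon> j = {}"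
  proof (intro eventually_ball_finite finite_ends[OF S] ballI)
    fix i j
    show "\<forall>\<^sub>F \<epsilon> in at_right 0. i \<noteq> j \<longrightarrow> end_nbhd \<epsilon> i \<inter> end_nbhd \<epsilon> j = {}"
      using eventually_end_nbhd_disjoint by (cases "i = j") auto
  qed
  ultimately have "\<forall>\<^sub>F \<epsilon> in at_right 0. 0 < \<epsilon> \<and> (\<forall>i\<in>ends S. end_nbhd \<epsilon> i \<inter> S = {}) \<and>
      (\<forall>i\<in>ends S. \<forall>j\<in>ends S. i \<noteq> j \<longrightarrow> end_nbhd \<epsilon> i \<inter> end_nbhd \<epsilon> j = {})"
    by eventually_elim blast
  from eventually_happens'[OF trivial_limit_at_right_real this] obtain \<epsilon> where \<epsilon>: "0 < \<epsilon>" "\<And>i. i \<in> ends S \<Longrightarrow> end_nbhd \<epsilon> i \<inter> S = {}"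
      "\<And>i j. i \<in> ends S \<Longrightarrow> j \<in> ends S \<Longrightarrow> i \<noteq> j \<Longrightarrow> end_nbhd \<epsilon> i \<inter> end_nbhd \<epsilon> j = {}"
    by blast
  let ?U = "end_nbhd \<epsilon>"
  define K where "K = UNIV - S - (\<Union>j\<in>ends S. ?U j)"
  have hk: "\<And>x. x \<notin> S \<Longrightarrow> h x \<notin> T \<and> k (h x) = x" "\<And>y. y \<notin> T \<Longrightarrow> k y \<notin> S \<and> h (k y) = y"
    and cont: "continuous_on (UNIV - S) h" "continuous_on (UNIV - T) k"
    using hom by (auto simp: homeomorphism_def)
  have K: "compact K" "K \<inter> S = {}" using compact_core[OF S \<epsilon>(1)] by (auto simp: K_def)
  then have "compact (h ` K)"
    by (intro compact_continuous_image continuous_on_subset[OF cont(1)]) auto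
  moreover have hKT: "h ` K \<inter> T = {}" using hk K by blast
  ultimately have "\<forall>\<^sub>F \<delta> in at_right 0. \<forall>j\<in>ends T. end_nbhd \<delta> j \<inter> h ` K = {}"
    by (intro eventually_ball_finite finite_ends[OF T] ballI eventually_end_nbhd_disjoint_compact)
      (auto simp: ends_def)
  moreover have "\<forall>\<^sub>F \<delta> in at_right 0. \<forall>j\<in>ends T. end_nbhd \<delta> j \<inter> T = {}"
    using finite_ends[OF T] eventually_end_nbhd_avoids[OF T] by (simp add: eventually_ball_finite)
  moreover have "\<forall>\<^sub>F \<delta> in at_right (0::real). 0 < \<delta>" by (simp add: eventually_at_right_less)
  ultimately have "\<forall>\<^sub>F \<delta> in at_right 0. 0 < \<delta> \<and> (\<forall>j\<in>ends T. end_nbhd \<delta> j \<inter> T = {}) \<and>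
      (\<forall>j\<in>ends T. end_nbhd \<delta> j \<inter> h ` K = {})"
    by eventually_elim blast
  from eventually_happens'[OF trivial_limit_at_right_real this] obtain \<delta> where \<delta>: "0 < \<delta>" "\<And>j. j \<in> ends T \<Longrightarrow> end_nbhd \<delta> j \<inter> T = {}"
      "\<And>j. j \<in> ends T \<Longrightarrow> end_nbhd \<delta> j \<inter> h ` K = {}"
    by blast
  let ?D = "end_nbhd \<delta>"
  \<comment> \<open>An end neighbourhood is connected, and its image avoids the punctures
    \<open>S\<close> and the core \<open>K\<close>; so it stays in one of the disjoint sets
    \<open>?U i\<close>.\<close>
  have in_U: "k ` ?D j \<subseteq> ?U i" if "j \<in> ends T" "i \<in> ends S" "k ` ?D j \<inter> ?U i \<noteq> {}" for i j
  proof (rule connected_subset_of_disjoint_open[of _ "ends S"])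
    show "connected (k ` ?D j)"
      by (intro connected_continuous_image connected_end_nbhd continuous_on_subset[OF cont(2)])
        (use \<delta>(2) that in blast)
    show "k ` ?D j \<subseteq> (\<Union>i\<in>ends S. ?U i)"
    proof
      fix x assume "x \<in> k ` ?D j"
      then obtain y where y: "y \<in> ?D j" "x = k y" by blast
      then have "y \<notin> T" using \<delta>(2) that by blast
      then have "x \<notin> S" "h x = y" using hk y by auto
      moreover have "x \<notin> K" using \<delta>(3)[OF that(1)] y \<open>h x = y\<close> by (metis disjoint_iff imageI)
      ultimately show "x \<in> (\<Union>i\<in>ends S. ?U i)" by (auto simp: K_def)
    qed
  qed (use \<epsilon> that open_end_nbhd in auto)
  \<comment> \<open>If no end of \<open>T\<close> came near \<open>i\<close>, then
    \<open>?U i\<close> would lie in the image of the compact core \<open>C\<close>, whereas small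
    neighbourhoods of an end leave every compact set that misses its puncture.\<close>
  have ex: "\<exists>j\<in>ends T. k ` ?D j \<inter> ?U i \<noteq> {}" if i: "i \<in> ends S" for i
  proof (rule ccontr)
    assume no: "\<not> (\<exists>j\<in>ends T. k ` ?D j \<inter> ?U i \<noteq> {})"
    define C where "C = UNIV - T - (\<Union>j\<in>ends T. ?D j)"
    have C: "compact C" using compact_core[OF T \<delta>(1)] by (simp add: C_def)
    have "?U i \<subseteq> k ` C"
    proof
      fix x assume x: "x \<in> ?U i"
      then have "x \<notin> S" using \<epsilon>(2) i by blast
      then have "h x \<notin> T" "k (h x) = x" using hk by auto
      moreover have "h x \<notin> ?D j" if "j \<in> ends T" for j
        using no that x \<open>k (h x) = x\<close> by (metis disjoint_iff imageI)
      ultimately show "x \<in> k ` C" unfolding C_def by (intro image_eqI[of _ _ "h x"]) auto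
    qed
    moreover have kC: "compact (k ` C)"
      by (intro compact_continuous_image C continuous_on_subset[OF cont(2)]) (auto simp: C_def)
    moreover have "k ` C \<inter> S = {}" using hk by (auto simp: C_def)
    then have "\<forall>\<^sub>F e in at_right 0. end_nbhd e i \<inter> k ` C = {}"
      using i by (intro eventually_end_nbhd_disjoint_compact kC) (auto simp: ends_def)
    moreover have "\<forall>\<^sub>F e in at_right (0::real). 0 < e" by (simp add: eventually_at_right_less)
    moreover have "\<forall>\<^sub>F e in at_right (0::real). e < \<epsilon>"
      using \<epsilon>(1) by (auto simp: eventually_at_right_field)
    ultimately have "\<forall>\<^sub>F e in at_right (0::real). False"
    proof (elim eventually_rev_mp, intro always_eventually allI impI)
      fix e :: real assume e: "e < \<epsilon>" "0 < e" "end_nbhd e i \<inter> k ` C = {}" "?U i \<subseteq> k ` C"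
      then have "end_nbhd e i \<subseteq> end_nbhd e i \<inter> k ` C" using end_nbhd_mono[OF e(2) less_imp_le[OF e(1)], of i] by blast
      then show False using e(3) end_nbhd_nonempty[OF e(2), of i] by simp
    qed
    then show False by (simp add: trivial_limit_at_right_real)
  qed
  from ex have "\<forall>i\<in>ends S. \<exists>j. j \<in> ends T \<and> k ` ?D j \<inter> ?U i \<noteq> {}" by blast
  \<comment> \<open>A section of the assignment from ends of \<open>T\<close> to ends of
    \<open>S\<close>; it is injective because each \<open>?D j\<close> is mapped into only one
    \<open>?U i\<close>.\<close>
  from bchoice[OF this] obtain \<sigma> where \<sigma>: "\<forall>i\<in>ends S. \<sigma> i \<in> ends T \<and> k ` ?D (\<sigma> i) \<inter> ?U i \<noteq> {}" by blast
  have "inj_on \<sigma> (ends S)"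
  proof (rule inj_onI, rule ccontr)
    fix i i' assume i: "i \<in> ends S" "i' \<in> ends S" "\<sigma> i = \<sigma> i'" "i \<noteq> i'"
    have sub: "k ` ?D (\<sigma> l) \<subseteq> ?U l" if "l \<in> ends S" for l
      using in_U[of "\<sigma> l" l] \<sigma> that by simp
    obtain y where "y \<in> ?D (\<sigma> i)" using end_nbhd_nonempty[OF \<delta>(1), of "\<sigma> i"] by blast
    then have "k y \<in> ?U i" "k y \<in> ?U i'" using sub[OF i(1)] sub[OF i(2)] i(3) by auto
    then show False using \<epsilon>(3)[OF i(1,2,4)] by (metis disjoint_iff)
  qed
  then have "card (ends S) \<le> card (ends T)"
    using \<sigma> finite_ends[OF T] by (intro card_inj_on_le[of \<sigma>]) auto
  then show ?thesis by (simp add: card_ends S T)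
qed

lemma card_punctures_eq:
  fixes S T :: "complex set"
  assumes "finite S" "finite T" "(UNIV - S) homeomorphic (UNIV - T)"
  shows "card S = card T"
proof -
  obtain h k where hk: "homeomorphism (UNIV - S) (UNIV - T) h k"
    using assms(3) by (auto simp: homeomorphic_def)
  then have "homeomorphism (UNIV - T) (UNIV - S) k h" by (rule homeomorphism_symD)
  then show ?thesis using card_punctures_le[OF assms(1,2) hk] card_punctures_le[OF assms(2,1)] by simp
qed

section \<open>Local triviality over the base\<close>

text \<open>Each point is pushed along by a bump function; for base points close to \<open>b0\<close> the displacement is
  a contraction, so the resulting maps are homeomorphisms of the plane by Banach's fixed point
  theorem.\<close>

lemma local_straightening:
  fixes X :: "'b::topological_space set" and G :: "('b \<Rightarrow> complex) set"
  assumes G: "finite G" and cont: "\<And>g. g \<in> G \<Longrightarrow> continuous_on X g" and b0: "b0 \<in> X"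
    and inj: "inj_on (\<lambda>g. g b0) G"
  obtains U \<Phi> \<Phi>' where "openin (top_of_set X) U" "b0 \<in> U"
    "continuous_on (U \<times> UNIV) (\<lambda>(b, y). \<Phi> b y)" "continuous_on (U \<times> UNIV) (\<lambda>(b, z). \<Phi>' b z)"
    "\<And>b y. b \<in> U \<Longrightarrow> \<Phi>' b (\<Phi> b y) = y" "\<And>b z. b \<in> U \<Longrightarrow> \<Phi> b (\<Phi>' b z) = (z::complex)"
    "\<And>b g. b \<in> U \<Longrightarrow> g \<in> G \<Longrightarrow> \<Phi> b (g b0) = g b"
proof -
  \<comment> \<open>The element 1 keeps \<open>D\<close> nonempty when \<open>G\<close> has fewer
    than two functions.\<close>
  define D where "D = insert 1 {dist (g b0) (g' b0) | g g'. g \<in> G \<and> g' \<in> G \<and> g \<noteq> g'}"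
  have "finite {dist (g b0) (g' b0) | g g'. g \<in> G \<and> g' \<in> G \<and> g \<noteq> g'}"
  proof (rule finite_subset)
    show "{dist (g b0) (g' b0) | g g'. g \<in> G \<and> g' \<in> G \<and> g \<noteq> g'}
        \<subseteq> (\<lambda>(g, g'). dist (g b0) (g' b0)) ` (G \<times> G)" by force
  qed (use G in simp)
  then have finD: "finite D" by (simp add: D_def)
  define r where "r = Min D"
  have "d > 0" if "d \<in> D" for d using that inj by (auto simp: D_def inj_on_def)
  then have r: "r > 0" unfolding r_def using finD by (subst Min_gr_iff) (auto simp: D_def)
  have sep: "r \<le> norm (g b0 - g' b0)" if "g \<in> G" "g' \<in> G" "g \<noteq> g'" for g g'
  proof -
    have "norm (g b0 - g' b0) \<in> D" using that unfolding D_def by (auto simp: dist_norm)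
    then show ?thesis unfolding r_def using finD by simp
  qed
  \<comment> \<open>\<open>w b\<close> is the total displacement of the values of \<open>G\<close>.
    The bound \<open>r / 2\<close> on it, against bumps of slope \<open>1 / r\<close>, gives the
    displacement \<open>\<delta> b\<close> the Lipschitz constant 1/2.\<close>
  define w where "w b = (\<Sum>g\<in>G. norm (g b - g b0))" for b
  define U where "U = X \<inter> w -` {..<r / 2}"
  have wcont: "continuous_on X w" unfolding w_def by (intro continuous_intros cont)
  \<comment> \<open>A cone of height 1 and radius \<open>r\<close>: it equals 1 at its own point
    and, by \<open>sep\<close>, 0 at the others, so \<open>\<Phi> b\<close> carries each
    \<open>g b0\<close> exactly to \<open>g b\<close>.\<close>
  define bump where "bump g y = max 0 (1 - norm (y - g b0) / r)" for g :: "'b \<Rightarrow> complex" and y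
  have bump_lip: "\<bar>bump g y - bump g y'\<bar> \<le> norm (y - y') / r" for g y y'
  proof -
    have "\<bar>norm (y - g b0) - norm (y' - g b0)\<bar> \<le> norm (y - y')"
      using norm_triangle_ineq3[of "y - g b0" "y' - g b0"] by simp
    then have "\<bar>norm (y - g b0) / r - norm (y' - g b0) / r\<bar> \<le> norm (y - y') / r"
      using r by (simp add: diff_divide_distrib[symmetric] divide_right_mono)
    then show ?thesis unfolding bump_def by linarith
  qed
  define \<delta> where "\<delta> b y = (\<Sum>g\<in>G. (g b - g b0) * of_real (bump g y))" for b y
  have lip: "norm (\<delta> b y - \<delta> b y') \<le> norm (y - y') / 2" if b: "b \<in> U" for b y y'
  proof -
    have "\<delta> b y - \<delta> b y' = (\<Sum>g\<in>G. (g b - g b0) * of_real (bump g y - bump g y'))"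
      by (simp add: \<delta>_def sum_subtractf[symmetric] algebra_simps)
    also have "norm \<dots> \<le> (\<Sum>g\<in>G. norm ((g b - g b0) * of_real (bump g y - bump g y')))"
      by (rule norm_sum)
    also have "\<dots> \<le> (\<Sum>g\<in>G. norm (g b - g b0) * (norm (y - y') / r))"
      unfolding norm_mult norm_of_real by (intro sum_mono mult_left_mono bump_lip) auto
    also have "\<dots> = w b * (norm (y - y') / r)" by (simp only: w_def sum_distrib_right)
    also have "\<dots> \<le> (r / 2) * (norm (y - y') / r)"
      using b r by (intro mult_right_mono) (auto simp: U_def)
    also have "\<dots> = norm (y - y') / 2" using r by simp
    finally show ?thesis .
  qed
  define \<Phi> where "\<Phi> b y = y + \<delta> b y" for b y
  \<comment> \<open>This bound serves twice: for injectivity of \<open>\<Phi> b\<close>, and for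
    continuity of its inverse jointly in the base point and the fiber.\<close>
  have expand: "norm (y - y') \<le> 2 * norm (\<Phi> b y - \<Phi> b y')" if "b \<in> U" for b y y'
  proof -
    have "y - y' = (\<Phi> b y - \<Phi> b y') - (\<delta> b y - \<delta> b y')" by (simp add: \<Phi>_def)
    then have "norm (y - y') \<le> norm (\<Phi> b y - \<Phi> b y') + norm (\<delta> b y - \<delta> b y')"
      by (metis norm_triangle_ineq4)
    then show ?thesis using lip[OF that, of y y'] by linarith
  qed
  have injP: "inj (\<Phi> b)" if "b \<in> U" for b
  proof (rule injI)
    fix y y' assume "\<Phi> b y = \<Phi> b y'"
    then show "y = y'" using expand[OF that, of y y'] by simp
  qed
  have surjP: "surj (\<Phi> b)" if "b \<in> U" for b
  proof -
    have "\<exists>y. \<Phi> b y = z" for z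
    proof -
      \<comment> \<open>Solving \<open>\<Phi> b y = z\<close> means finding a fixed point of
        \<open>\<lambda>y. z - \<delta> b y\<close>.\<close>
      have "dist (z - \<delta> b y) (z - \<delta> b y') \<le> 1 / 2 * dist y y'" for y y'
        using lip[OF that, of y' y] by (simp add: dist_norm norm_minus_commute)
      then obtain y where "z - \<delta> b y = y"
        using banach_fix_type[of "1 / 2" "\<lambda>y. z - \<delta> b y"] by auto
      then show ?thesis by (intro exI[of _ y]) (simp add: \<Phi>_def algebra_simps)
    qed
    then show ?thesis by (metis surjI)
  qed
  have contP: "continuous_on (U \<times> UNIV) (\<lambda>(b, y). \<Phi> b y)"
  proof -
    have "continuous_on (U \<times> UNIV) (\<lambda>p. g (fst p))" if "g \<in> G" for g
      by (rule continuous_on_compose2[OF cont[OF that]]) (auto intro: continuous_intros simp: U_def)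
    then show ?thesis
      unfolding \<Phi>_def \<delta>_def bump_def case_prod_beta using r
      by (intro continuous_intros) auto
  qed
  \<comment> \<open>With \<open>\<Phi> b1 y1 = z1\<close>, the bound \<open>expand\<close> gives
    \<open>norm (inv (\<Phi> b) z - y1) \<le> 2 * norm (z - \<Phi> b y1)\<close>, and the right side
    tends to 0 by continuity of \<open>\<Phi>\<close> for the fixed \<open>y1\<close>.\<close>
  have contI: "continuous_on (U \<times> UNIV) (\<lambda>(b, z). inv (\<Phi> b) z)"
    unfolding continuous_on_def
  proof
    fix p :: "'b \<times> complex" assume p: "p \<in> U \<times> UNIV"
    obtain b1 z1 where p_eq: "p = (b1, z1)" and b1: "b1 \<in> U" using p by auto
    define y1 where "y1 = inv (\<Phi> b1) z1"
    have z1: "\<Phi> b1 y1 = z1" unfolding y1_def by (rule surj_f_inv_f[OF surjP[OF b1]])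
    let ?F = "at p within U \<times> UNIV"
    have "continuous_on (U \<times> UNIV) (\<lambda>q. (\<lambda>(b, y). \<Phi> b y) (fst q, y1))"
      by (rule continuous_on_compose2[OF contP]) (auto intro!: continuous_intros)
    then have "continuous_on (U \<times> UNIV) (\<lambda>q. 2 * norm (snd q - \<Phi> (fst q) y1))"
      by (auto intro!: continuous_intros)
    then have "((\<lambda>q. 2 * norm (snd q - \<Phi> (fst q) y1)) \<longlongrightarrow> 2 * norm (snd p - \<Phi> (fst p) y1)) ?F"
      using p unfolding continuous_on_def by blast
    then have lim: "((\<lambda>q. 2 * norm (snd q - \<Phi> (fst q) y1)) \<longlongrightarrow> 0) ?F" using z1 p_eq by simp
    have "\<forall>\<^sub>F q in ?F. norm ((\<lambda>(b, z). inv (\<Phi> b) z) q - y1) \<le> 2 * norm (snd q - \<Phi> (fst q) y1)"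
      unfolding eventually_at_filter
    proof (intro always_eventually allI impI)
      fix q :: "'b \<times> complex" assume "q \<in> U \<times> UNIV"
      then have q: "fst q \<in> U" by auto
      show "norm ((\<lambda>(b, z). inv (\<Phi> b) z) q - y1) \<le> 2 * norm (snd q - \<Phi> (fst q) y1)"
        using expand[OF q, of "inv (\<Phi> (fst q)) (snd q)" y1] surj_f_inv_f[OF surjP[OF q], of "snd q"]
        by (simp add: case_prod_beta)
    qed
    then have "((\<lambda>q. (\<lambda>(b, z). inv (\<Phi> b) z) q - y1) \<longlongrightarrow> 0) ?F"
      using lim by (rule Lim_null_comparison)
    then have "((\<lambda>(b, z). inv (\<Phi> b) z) \<longlongrightarrow> y1) ?F" by (simp add: LIM_zero_iff)
    then show "((\<lambda>(b, z). inv (\<Phi> b) z) \<longlongrightarrow> (case p of (b, z) \<Rightarrow> inv (\<Phi> b) z)) ?F"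
      by (simp add: p_eq y1_def)
  qed
  have val: "\<Phi> b (g b0) = g b" if "g \<in> G" for b g
  proof -
    have "bump g' (g b0) = (if g' = g then 1 else 0)" if "g' \<in> G" for g'
      using sep[OF \<open>g \<in> G\<close> that] r by (auto simp: bump_def)
    then have "\<delta> b (g b0) = (\<Sum>g'\<in>G. if g' = g then g b - g b0 else 0)"
      unfolding \<delta>_def by (intro sum.cong) auto
    also have "\<dots> = g b - g b0" using G that by simp
    finally show ?thesis by (simp add: \<Phi>_def)
  qed
  show thesis
  proof (rule that[of U \<Phi> "\<lambda>b. inv (\<Phi> b)"])
    show "openin (top_of_set X) U"
      unfolding U_def by (rule continuous_openin_preimage_gen[OF wcont]) simp
    show "b0 \<in> U" using b0 r by (simp add: U_def w_def)
    show "inv (\<Phi> b) (\<Phi> b y) = y" if "b \<in> U" for b y by (rule inv_f_f[OF injP[OF that]])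
    show "\<Phi> b (inv (\<Phi> b) z) = z" if "b \<in> U" for b z by (rule surj_f_inv_f[OF surjP[OF that]])
  qed (use contP contI val in auto)
qed

text \<open>A bundle has one model fiber for all base points, so the punctures over each chosen base
  point are moved to positions independent of that point.\<close>

lemma homeomorphism_plane_moving_finite:
  fixes p q :: "'i \<Rightarrow> complex"
  assumes "finite I" "inj_on p I" "inj_on q I"
  obtains f f' where "homeomorphism UNIV UNIV f f'" "\<And>i. i \<in> I \<Longrightarrow> f (p i) = q i"
proof -
  have pw: "pairwise (\<lambda>i j. p i \<noteq> p j \<and> q i \<noteq> q j) I"
    using assms by (auto simp: pairwise_def inj_on_def)
  show thesis
  proof (rule homeomorphism_moving_points_exists[of UNIV UNIV I p q])
    fix f f' assume "homeomorphism (UNIV :: complex set) UNIV f f'" "\<And>i. i \<in> I \<Longrightarrow> f (p i) = q i"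
    then show thesis by (rule that)
  qed (use assms(1) pw in auto)
qed

section \<open>Bundles over coordinate projections\<close>

lemma continuous_on_proj: "continuous_on S (proj m)"
proof (rule continuous_on_coordinatewise_then_product)
  fix i
  have "continuous_on S (\<lambda>x. x i)"
    by (rule continuous_on_subset[OF continuous_on_product_coordinates]) simp
  then show "continuous_on S (\<lambda>x. proj m x i)" by (cases "i < m") (auto simp: proj_def)
qed

lemma proj_in_Cn: "proj m x \<in> Cn m"
  by (simp add: proj_def Cn_def)

lemma proj_fun_upd: "b \<in> Cn m \<Longrightarrow> proj m (b(m := z)) = b"
  by (auto simp: proj_def Cn_def fun_eq_iff)

lemma fun_upd_in_Cn: "b \<in> Cn m \<Longrightarrow> b(m := z) \<in> Cn (Suc m)"
  by (auto simp: Cn_def)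

lemma proj_upd_last: "x \<in> Cn (Suc m) \<Longrightarrow> (proj m x)(m := x m) = x"
  by (auto simp: proj_def Cn_def fun_eq_iff)

lemma top_of_set_restrict:
  "subtopology (top_of_set E) {e \<in> topspace (top_of_set E). Q e} = top_of_set {e \<in> E. Q e}"
proof -
  have "E \<inter> {e \<in> E. Q e} = {e \<in> E. Q e}" by blast
  then show ?thesis by (simp add: subtopology_subtopology)
qed

lemma prod_top_of_set:
  "U \<subseteq> X \<Longrightarrow> prod_topology (subtopology (top_of_set X) U) (top_of_set F) = top_of_set (U \<times> F)"
  by (simp add: subtopology_subtopology Int_absorb1)

text \<open>A local trivialisation preserves the base coordinate, so it restricts to the slice over
  \<open>b\<close>; there a point is determined by its last coordinate.\<close>

lemma fiber_bundle_fiber: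
  assumes fb: "fiber_bundle (top_of_set E) (top_of_set X) (proj m) (top_of_set F)"
    and E: "E \<subseteq> Cn (Suc m)" and X: "X \<subseteq> Cn m" and b: "b \<in> X"
  shows "F homeomorphic {z. b(m := z) \<in> E}"
proof -
  obtain U h where U: "openin (top_of_set X) U" "b \<in> U"
    and h: "homeomorphic_map (subtopology (top_of_set E) {e \<in> topspace (top_of_set E). proj m e \<in> U})
          (prod_topology (subtopology (top_of_set X) U) (top_of_set F)) h"
    and fst: "\<And>e. e \<in> E \<Longrightarrow> proj m e \<in> U \<Longrightarrow> fst (h e) = proj m e"
    using fb b unfolding fiber_bundle_def by auto
  have UX: "U \<subseteq> X" using U(1) by (auto dest: openin_imp_subset)
  define EU where "EU = {e \<in> E. proj m e \<in> U}"
  obtain k where hk: "homeomorphic_maps (top_of_set EU) (top_of_set (U \<times> F)) h k"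
    using h unfolding homeomorphic_map_maps top_of_set_restrict prod_top_of_set[OF UX] EU_def by blast
  then have ch: "continuous_on EU h" "h ` EU \<subseteq> U \<times> F" and ck: "continuous_on (U \<times> F) k" "k ` (U \<times> F) \<subseteq> EU"
    and inv: "\<And>e. e \<in> EU \<Longrightarrow> k (h e) = e" "\<And>q. q \<in> U \<times> F \<Longrightarrow> h (k q) = q"
    by (auto simp: homeomorphic_maps_def image_subset_iff_funcset)
  have bC: "b \<in> Cn m" using b X by blast
  let ?Z = "{z. b(m := z) \<in> E}"
  have up: "b(m := z) \<in> EU" if "z \<in> ?Z" for z
    using that U(2) proj_fun_upd[OF bC] by (simp add: EU_def)
  have kb: "b(m := k (b, y) m) = k (b, y)" if y: "y \<in> F" for y
  proof -
    have e: "k (b, y) \<in> EU" using ck(2) y U(2) by blast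
    have "h (k (b, y)) = (b, y)" using inv(2) y U(2) by blast
    then have "proj m (k (b, y)) = b" using fst[of "k (b, y)"] e by (simp add: EU_def)
    then show ?thesis using proj_upd_last[of "k (b, y)" m] e E by (auto simp: EU_def)
  qed
  have hb: "h (b(m := z)) = (b, snd (h (b(m := z))))" if "z \<in> ?Z" for z
    using fst[of "b(m := z)"] up[OF that] proj_fun_upd[OF bC] by (simp add: EU_def prod_eq_iff)
  have "homeomorphism F ?Z (\<lambda>y. k (b, y) m) (\<lambda>z. snd (h (b(m := z))))"
  proof (rule homeomorphismI)
    have "continuous_on F (\<lambda>y. k (b, y))"
      by (rule continuous_on_compose2[OF ck(1)]) (use U in \<open>auto intro!: continuous_intros\<close>)
    then show "continuous_on F (\<lambda>y. k (b, y) m)" by (rule continuous_on_product_then_coordinatewise)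
    have "continuous_on ?Z (\<lambda>z. b(m := z))"
    proof (rule continuous_on_coordinatewise_then_product)
      fix i show "continuous_on ?Z (\<lambda>z. (b(m := z)) i)" by (cases "i = m") auto
    qed
    then have "continuous_on ?Z (\<lambda>z. h (b(m := z)))"
      by (rule continuous_on_compose2[OF ch(1)]) (use up in auto)
    then show "continuous_on ?Z (\<lambda>z. snd (h (b(m := z))))" by (intro continuous_intros)
    show "(\<lambda>y. k (b, y) m) ` F \<subseteq> ?Z" using kb ck(2) U(2) by (auto simp: EU_def)
    show "(\<lambda>z. snd (h (b(m := z)))) ` ?Z \<subseteq> F"
    proof (rule image_subsetI)
      fix z assume "z \<in> ?Z"
      then have "h (b(m := z)) \<in> U \<times> F" using ch(2) up by blast
      then show "snd (h (b(m := z))) \<in> F" by auto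
    qed
    show "snd (h (b(m := k (b, y) m))) = y" if "y \<in> F" for y
      using kb[OF that] inv(2)[of "(b, y)"] U(2) that by simp
    show "k (b, snd (h (b(m := z)))) m = z" if "z \<in> ?Z" for z
      using hb[OF that] inv(1)[OF up[OF that]] by (metis fun_upd_same)
  qed
  then show ?thesis unfolding homeomorphic_def by blast
qed

lemma fiber_bundle_graph_complement:
  fixes X :: "(nat \<Rightarrow> complex) set" and G :: "((nat \<Rightarrow> complex) \<Rightarrow> complex) set"
  assumes X: "X \<subseteq> Cn m" and G: "finite G" and cont: "\<And>g. g \<in> G \<Longrightarrow> continuous_on X g"
    and inj: "\<And>b. b \<in> X \<Longrightarrow> inj_on (\<lambda>g. g b) G"
    and E: "E = {x \<in> Cn (Suc m). proj m x \<in> X \<and> (\<forall>g\<in>G. x m \<noteq> g (proj m x))}"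
  obtains S where "finite S"
    "fiber_bundle (top_of_set E) (top_of_set X) (proj m) (top_of_set (UNIV - S :: complex set))"
proof -
  \<comment> \<open>The punctures of the model fiber are the numbers 0, 1, 2 and so on, one for each
    function in \<open>G\<close>.\<close>
  obtain \<nu> where \<nu>: "bij_betw \<nu> G {0..<card G}" using ex_bij_betw_finite_nat[OF G] by blast
  define \<sigma> where "\<sigma> g = complex_of_nat (\<nu> g)" for g
  have inj\<sigma>: "inj_on \<sigma> G" using \<nu> by (auto simp: \<sigma>_def bij_betw_def inj_on_def)
  define S where "S = \<sigma> ` G"
  have "\<exists>U h. openin (top_of_set X) U \<and> b0 \<in> U \<and>
        homeomorphic_map (subtopology (top_of_set E) {e \<in> topspace (top_of_set E). proj m e \<in> U})
          (prod_topology (subtopology (top_of_set X) U) (top_of_set (UNIV - S))) h \<and>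
        (\<forall>e\<in>topspace (top_of_set E). proj m e \<in> U \<longrightarrow> fst (h e) = proj m e)"
    if b0: "b0 \<in> X" for b0
  proof -
    obtain U \<Phi> \<Phi>' where U: "openin (top_of_set X) U" "b0 \<in> U"
      and c\<Phi>: "continuous_on (U \<times> UNIV) (\<lambda>(b, y). \<Phi> b y)" and c\<Phi>': "continuous_on (U \<times> UNIV) (\<lambda>(b, z). \<Phi>' b z)"
      and inv: "\<And>b y. b \<in> U \<Longrightarrow> \<Phi>' b (\<Phi> b y) = y" "\<And>b z. b \<in> U \<Longrightarrow> \<Phi> b (\<Phi>' b z) = z"
      and val: "\<And>b g. b \<in> U \<Longrightarrow> g \<in> G \<Longrightarrow> \<Phi> b (g b0) = g b"
    proof (rule local_straightening[OF G _ b0 inj[OF b0]])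
      fix g assume "g \<in> G"
      then show "continuous_on X g" by (rule cont)
    qed (rule that)
    obtain f f' where f: "homeomorphism UNIV UNIV f f'" "\<And>g. g \<in> G \<Longrightarrow> f (\<sigma> g) = g b0"
      by (rule homeomorphism_plane_moving_finite[OF G inj\<sigma> inj[OF b0]]) blast
    have ff: "f' (f y) = y" "f (f' y) = y" "continuous_on UNIV f" "continuous_on UNIV f'" for y
      using f(1) by (auto simp: homeomorphism_def)
    have UX: "U \<subseteq> X" using U(1) by (auto dest: openin_imp_subset)
    define EU where "EU = {e \<in> E. proj m e \<in> U}"
    \<comment> \<open>\<open>\<Phi>'\<close> moves the fiber over a nearby point onto the one over
      \<open>b0\<close>, and \<open>f'\<close> moves that onto the model fiber; \<open>k\<close>
      undoes both.\<close>
    define h where "h e = (proj m e, f' (\<Phi>' (proj m e) (e m)))" for e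
    define k where "k q = (fst q)(m := \<Phi> (fst q) (f (snd q)))" for q :: "(nat \<Rightarrow> complex) \<times> complex"
    have mem: "b(m := \<Phi> b (f y)) \<in> E \<longleftrightarrow> y \<notin> S" if "b \<in> U" for b y
    proof -
      have bC: "b \<in> Cn m" "b \<in> X" using that UX X by auto
      have "\<Phi> b (f y) = g b \<longleftrightarrow> y = \<sigma> g" if "g \<in> G" for g
        using val[OF \<open>b \<in> U\<close> that] f(2)[OF that] inv(1)[OF \<open>b \<in> U\<close>] ff(1) by metis
      then show ?thesis
        using bC by (auto simp: E S_def proj_fun_upd fun_upd_in_Cn)
    qed
    have "homeomorphic_maps (top_of_set EU) (top_of_set (U \<times> (UNIV - S))) h k"
      unfolding homeomorphic_maps_def
    proof (intro conjI ballI)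
      have "continuous_on EU (\<lambda>e. (\<lambda>(b, z). \<Phi>' b z) (proj m e, e m))"
      proof (rule continuous_on_compose2[OF c\<Phi>'])
        show "continuous_on EU (\<lambda>e. (proj m e, e m))"
          by (intro continuous_intros continuous_on_proj
              continuous_on_subset[OF continuous_on_product_coordinates]) auto
      qed (auto simp: EU_def)
      then have "continuous_on EU (\<lambda>e. f' (\<Phi>' (proj m e) (e m)))"
        using continuous_on_compose2[OF ff(4)] by simp
      then have "continuous_on EU h" unfolding h_def by (intro continuous_intros continuous_on_proj)
      moreover have "h e \<in> U \<times> (UNIV - S)" if e: "e \<in> EU" for e
      proof -
        have eU: "proj m e \<in> U" "e \<in> E" "e \<in> Cn (Suc m)" using e by (auto simp: EU_def E)
        have "(proj m e)(m := \<Phi> (proj m e) (f (f' (\<Phi>' (proj m e) (e m))))) \<in> E"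
          using eU by (simp add: ff inv proj_upd_last)
        then show ?thesis using mem[OF eU(1)] eU by (simp add: h_def)
      qed
      ultimately show "continuous_map (top_of_set EU) (top_of_set (U \<times> (UNIV - S))) h" by auto
      have "continuous_on (U \<times> (UNIV - S)) (\<lambda>q. f (snd q))"
        by (rule continuous_on_compose2[OF ff(3)]) (auto intro: continuous_intros)
      then have "continuous_on (U \<times> (UNIV - S)) (\<lambda>q. (\<lambda>(b, y). \<Phi> b y) (fst q, f (snd q)))"
        by (intro continuous_on_compose2[OF c\<Phi>] continuous_on_Pair continuous_on_fst continuous_on_id) auto
      then have cm: "continuous_on (U \<times> (UNIV - S)) (\<lambda>q. \<Phi> (fst q) (f (snd q)))" by simp
      have "continuous_on (U \<times> (UNIV - S)) k"
      proof (rule continuous_on_coordinatewise_then_product)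
        fix i
        have "continuous_on (U \<times> (UNIV - S)) (\<lambda>q. fst q i)"
          by (rule continuous_on_product_then_coordinatewise[OF continuous_on_fst[OF continuous_on_id]])
        then show "continuous_on (U \<times> (UNIV - S)) (\<lambda>q. k q i)"
          using cm by (cases "i = m") (auto simp: k_def)
      qed
      moreover have "k q \<in> EU" if "q \<in> U \<times> (UNIV - S)" for q
        using that mem[of "fst q" "snd q"] UX X by (auto simp: k_def EU_def proj_fun_upd subset_iff)
      ultimately show "continuous_map (top_of_set (U \<times> (UNIV - S))) (top_of_set EU) k" by auto
    next
      fix e assume "e \<in> topspace (top_of_set EU)"
      then have "proj m e \<in> U" "e \<in> Cn (Suc m)" by (auto simp: EU_def E)
      then show "k (h e) = e" by (simp add: k_def h_def ff inv proj_upd_last)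
    next
      fix q assume "q \<in> topspace (top_of_set (U \<times> (UNIV - S)))"
      then have "fst q \<in> U" by auto
      moreover then have "fst q \<in> Cn m" using UX X by blast
      ultimately show "h (k q) = q" by (simp add: k_def h_def ff inv proj_fun_upd)
    qed
    then have "homeomorphic_map (subtopology (top_of_set E) {e \<in> topspace (top_of_set E). proj m e \<in> U})
          (prod_topology (subtopology (top_of_set X) U) (top_of_set (UNIV - S))) h"
      unfolding homeomorphic_map_maps top_of_set_restrict prod_top_of_set[OF UX] EU_def by blast
    then show ?thesis using U by (intro exI[of _ U] exI[of _ h]) (auto simp: h_def)
  qed
  moreover have "continuous_map (top_of_set E) (top_of_set X) (proj m)"
    using continuous_on_proj by (auto simp: E)
  ultimately have "fiber_bundle (top_of_set E) (top_of_set X) (proj m) (top_of_set (UNIV - S))"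
    unfolding fiber_bundle_def by simp
  then show thesis using that[of S] G by (simp add: S_def)
qed

section \<open>Coordinate projections of arrangements\<close>

lemma functionalI:
  assumes "\<And>x y. f (x + y) = f x + f y" "\<And>c x. f (fun_scale c x) = c * f x"
  shows "Vector_Spaces.linear fun_scale (*) f"
  by unfold_locales (use assms in \<open>auto simp: algebra_simps\<close>)

text \<open>On \<open>Cn m\<close> a functional is a finite combination of coordinates. The
  restriction matters, since a linear functional on all sequences may be discontinuous in the
  product topology.\<close>

lemma continuous_on_functional:
  assumes f: "Vector_Spaces.linear fun_scale (*) f" and S: "S \<subseteq> Cn m"
  shows "continuous_on S f"
proof -
  interpret Vector_Spaces.linear fun_scale "(*)" f by fact
  have "f b = (\<Sum>j<m. b j * f (unit_seq j))" if "b \<in> S" for b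
  proof -
    have "b = (\<Sum>j<m. fun_scale (b j) (unit_seq j))"
      using that S by (auto simp: fun_eq_iff sum_unit_seq Cn_def not_less)
    then have "f b = f (\<Sum>j<m. fun_scale (b j) (unit_seq j))" by simp
    also have "\<dots> = (\<Sum>j<m. b j * f (unit_seq j))" by (simp add: sum scale)
    finally show ?thesis .
  qed
  moreover have "continuous_on S (\<lambda>b. \<Sum>j<m. b j * f (unit_seq j))"
    by (intro continuous_intros continuous_on_subset[OF continuous_on_product_coordinates]) auto
  ultimately show ?thesis by (simp cong: continuous_on_cong)
qed

lemma proj_add: "proj m (x + y) = proj m x + proj m y"
  by (auto simp: proj_def fun_eq_iff)

lemma proj_scale: "proj m (fun_scale c x) = fun_scale c (proj m x)"
  by (auto simp: proj_def fun_eq_iff fun_scale_def)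

lemma proj_id: "x \<in> Cn m \<Longrightarrow> proj m x = x"
  by (auto simp: proj_def Cn_def fun_eq_iff)

lemma Cn_Suc: "x \<in> Cn m \<Longrightarrow> x \<in> Cn (Suc m)"
  by (auto simp: Cn_def)

lemma unit_seq_Cn: "unit_seq m \<in> Cn (Suc m)"
  by (auto simp: unit_seq_def Cn_def)

lemma Cn_Suc_decomp: "x \<in> Cn (Suc m) \<Longrightarrow> x = proj m x + fun_scale (x m) (unit_seq m)"
  by (auto simp: proj_def Cn_def fun_eq_iff fun_scale_def unit_seq_def)

lemma proj_image_Cn: "proj m ` Cn (Suc m) = Cn m"
proof
  show "Cn m \<subseteq> proj m ` Cn (Suc m)"
    using proj_id Cn_Suc by (metis image_eqI subsetI)
qed (use proj_in_Cn in auto)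

text \<open>Over an infinite field an affine set is not a finite union of proper affine pieces. If
  \<open>x\<close> avoids all of \<open>S\<close> and \<open>y\<close> avoids \<open>H\<close>, the
  line through them meets each hyperplane of \<open>S\<close> at most once and \<open>H\<close> only
  at \<open>x\<close>, so finitely many points would cover it.\<close>

lemma (in arrangement) affine_subset_cover:
  assumes Y: "\<And>x y t. x \<in> Y \<Longrightarrow> y \<in> Y \<Longrightarrow> x + fun_scale t (y - x) \<in> Y" "Y \<subseteq> Cn n" "Y \<noteq> {}"
    and S: "S \<subseteq> A" "Y \<subseteq> \<Union>S"
  shows "\<exists>H\<in>S. Y \<subseteq> H"
proof -
  have "finite S" using S fin finite_subset by blast
  then show ?thesis using S
  proof (induction S)
    case empty
    then show ?case using Y(3) by simp
  next
    case (insert H S)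
    show ?case
    proof (rule ccontr)
      assume no: "\<not> (\<exists>K\<in>insert H S. Y \<subseteq> K)"
      have HA: "H \<in> A" and SA: "\<And>K. K \<in> S \<Longrightarrow> K \<in> A" using insert.prems by auto
      have "\<not> Y \<subseteq> \<Union>S" using insert no by blast
      then obtain x where x: "x \<in> Y" "\<And>K. K \<in> S \<Longrightarrow> x \<notin> K" by blast
      then have xH: "x \<in> H" using insert.prems by blast
      obtain y where y: "y \<in> Y" "y \<notin> H" using no by blast
      have C: "x \<in> Cn n" "y \<in> Cn n" using x y Y by auto
      let ?p = "\<lambda>t. x + fun_scale t (y - x)"
      have pC: "?p t \<in> Cn n" for t using C Cn_closed by simp
      have one: "finite {t. ?p t \<in> K}" if K: "K \<in> S" for K
      proof -
        have "t = t'" if "?p t \<in> K" "?p t' \<in> K" for t t'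
        proof -
          have e: "ff K x + t * (ff K y - ff K x) = cc K" "ff K x + t' * (ff K y - ff K x) = cc K"
            using that SA[OF K] by (auto simp: mem_iff ff_simps)
          moreover have "ff K x \<noteq> cc K" using x(2)[OF K] SA[OF K] C by (simp add: mem_iff)
          ultimately show ?thesis
            by (metis add_left_cancel mult_cancel_right mult_zero_right add.right_neutral)
        qed
        then have "{t. ?p t \<in> K} = {} \<or> (\<exists>t. {t. ?p t \<in> K} = {t})" by blast
        then show ?thesis by (elim disjE exE) simp_all
      qed
      have "UNIV - {0} \<subseteq> (\<Union>K\<in>S. {t. ?p t \<in> K})"
      proof
        fix t :: complex assume t: "t \<in> UNIV - {0}"
        have "ff H y \<noteq> cc H" "ff H x = cc H" using y xH HA C by (auto simp: mem_iff)
        then have "?p t \<notin> H" using t HA by (auto simp: mem_iff ff_simps)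
        moreover have "?p t \<in> \<Union>(insert H S)" using Y(1)[OF x(1) y(1)] insert.prems by blast
        ultimately show "t \<in> (\<Union>K\<in>S. {t. ?p t \<in> K})" by blast
      qed
      then have "finite (UNIV - {0 :: complex})"
        using one insert.hyps finite_subset by (metis (no_types, lifting) finite_UN_I)
      then show False using infinite_UNIV_char_0[where 'a = complex] by simp
    qed
  qed
qed

lemma (in arrangement) hyp_affine:
  assumes "H \<in> A" "x \<in> H" "y \<in> H" shows "x + fun_scale t (y - x) \<in> H"
  using assms by (auto simp: mem_iff ff_simps Cn_closed)

lemma (in arrangement) complement_nonempty:
  "arr_complement (Cn n) A \<noteq> {}"
proof
  assume "arr_complement (Cn n) A = {}"
  then have "Cn n \<subseteq> \<Union>A" by (auto simp: arr_complement_def)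
  moreover have "Cn n \<noteq> {}" using Cn_0 by blast
  ultimately have "\<exists>H\<in>A. Cn n \<subseteq> H"
    by (intro affine_subset_cover) (auto simp: Cn_closed)
  then obtain H where "H \<in> A" "Cn n \<subseteq> H" by blast
  then obtain w where "w \<in> Cn n" "ff H w \<noteq> 0" "w \<in> H" "0 \<in> H" using nz Cn_0 by blast
  then show False using \<open>H \<in> A\<close> by (simp add: mem_iff ff_simps)
qed

text \<open>Every hyperplane of \<open>A\<close> lies in one of \<open>B\<close>, which lies in one
  of \<open>A\<close>; the antichain property collapses this chain. It allows an arrangement to be
  read off from its complement.\<close>

lemma arrangement_subset_if_Union_eq:
  assumes "affine_arrangement fun_scale (Cn n) A" "affine_arrangement fun_scale (Cn n) B"
    and U: "\<Union>A = \<Union>B"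
  shows "A \<subseteq> B"
proof
  fix H assume H: "H \<in> A"
  obtain ff cc where "arrangement n A ff cc" using arrangement_exists[OF assms(1)] .
  then interpret A: arrangement n A ff cc .
  obtain gg dd where "arrangement n B gg dd" using arrangement_exists[OF assms(2)] .
  then interpret B: arrangement n B gg dd .
  have "H \<subseteq> \<Union>B" using H U by blast
  from B.affine_subset_cover[OF A.hyp_affine[OF H] A.hyp_subset[OF H] A.hyp_nonempty[OF H] order_refl this]
  obtain K where K: "K \<in> B" "H \<subseteq> K" by auto
  have "K \<subseteq> \<Union>A" using K U by blast
  from A.affine_subset_cover[OF B.hyp_affine[OF K(1)] B.hyp_subset[OF K(1)] B.hyp_nonempty[OF K(1)]
      order_refl this]
  obtain H' where H': "H' \<in> A" "K \<subseteq> H'" by auto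
  have "H = H'" using A.hyp_subset_eq[OF H H'(1)] K(2) H'(2) by (meson subset_trans)
  then have "H = K" using K(2) H'(2) by (simp add: subset_antisym)
  then show "H \<in> B" using K(1) by simp
qed

section \<open>Projection along the last coordinate\<close>

locale projected_arrangement = arrangement "Suc m" A ff cc for m A ff cc
begin

abbreviation "e \<equiv> unit_seq m"
abbreviation "Av \<equiv> {H \<in> A. par e H}"
abbreviation "Ah \<equiv> {H \<in> A. \<not> par e H}"

definition Bv :: "(nat \<Rightarrow> complex) set set" where
  "Bv = (\<lambda>H. proj m ` H) ` Av"

text \<open>The last coordinate of the point of \<open>H\<close> over \<open>b\<close>; meaningful
  for \<open>H\<close> in \<open>Ah\<close>, where \<open>ff H e\<close> is nonzero and
  \<open>H\<close> is the graph of its height.\<close>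

definition height :: "(nat \<Rightarrow> complex) set \<Rightarrow> (nat \<Rightarrow> complex) \<Rightarrow> complex" where
  "height H b = (cc H - ff H b) / ff H e"

abbreviation "Gs \<equiv> height ` Ah"
abbreviation "X \<equiv> arr_complement (Cn m) Bv"

lemma ff_decomp: "H \<in> A \<Longrightarrow> x \<in> Cn (Suc m) \<Longrightarrow> ff H x = ff H (proj m x) + x m * ff H e"
  using ff_simps[of H] Cn_Suc_decomp[of x m] by metis

lemma vertical_mem_proj:
  assumes H: "H \<in> Av" shows "b \<in> proj m ` H \<longleftrightarrow> b \<in> Cn m \<and> ff H b = cc H"
proof
  have HA: "H \<in> A" "ff H e = 0" using H par_iff[OF _ unit_seq_Cn] by auto
  show "b \<in> Cn m \<and> ff H b = cc H" if "b \<in> proj m ` H"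
    using that HA ff_decomp[OF HA(1)] proj_in_Cn by (auto simp: mem_iff)
  show "b \<in> proj m ` H" if "b \<in> Cn m \<and> ff H b = cc H"
    using that HA by (intro image_eqI[of _ _ b]) (auto simp: mem_iff proj_id Cn_Suc)
qed

lemma vertical_mem:
  assumes H: "H \<in> Av" and x: "x \<in> Cn (Suc m)" shows "x \<in> H \<longleftrightarrow> proj m x \<in> proj m ` H"
proof -
  have HA: "H \<in> A" "ff H e = 0" using H par_iff[OF _ unit_seq_Cn] by auto
  then show ?thesis
    using vertical_mem_proj[OF H] ff_decomp[OF HA(1) x] x by (auto simp: mem_iff proj_in_Cn)
qed

lemma horizontal_mem:
  assumes H: "H \<in> Ah" and x: "x \<in> Cn (Suc m)" shows "x \<in> H \<longleftrightarrow> x m = height H (proj m x)"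
proof -
  have HA: "H \<in> A" "ff H e \<noteq> 0" using H par_iff[OF _ unit_seq_Cn] by auto
  then show ?thesis using ff_decomp[OF HA(1) x] x by (auto simp: mem_iff height_def field_simps)
qed

lemma Bv_affine: "affine_arrangement fun_scale (Cn m) Bv"
  unfolding affine_arrangement_def
proof (intro conjI ballI)
  show "finite Bv" using fin by (simp add: Bv_def)
  fix K assume "K \<in> Bv"
  then obtain H where H: "H \<in> Av" "K = proj m ` H" by (auto simp: Bv_def)
  then have HA: "H \<in> A" "ff H e = 0" using par_iff[OF _ unit_seq_Cn] by auto
  obtain w where w: "w \<in> Cn (Suc m)" "ff H w \<noteq> 0" using nz[OF HA(1)] by blast
  then have "ff H (proj m w) \<noteq> 0" using ff_decomp[OF HA(1) w(1)] HA(2) by simp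
  moreover have "K = {b \<in> Cn m. ff H b = cc H}" using vertical_mem_proj[OF H(1)] H(2) by blast
  ultimately show "affine_hyperplane fun_scale (Cn m) K"
    unfolding affine_hyperplane_def using lin[OF HA(1)] proj_in_Cn by blast
qed

lemma pull_Bv: "pull (proj m) (Cn (Suc m)) ` Bv = Av"
proof -
  have "pull (proj m) (Cn (Suc m)) (proj m ` H) = H" if H: "H \<in> Av" for H
  proof -
    have "H \<subseteq> Cn (Suc m)" using H hyp_subset by blast
    then show ?thesis using vertical_mem[OF H] unfolding pull_def by blast
  qed
  then show ?thesis unfolding Bv_def image_image by (auto simp: image_iff)
qed

lemma supersolvable_Bv_iff:
  "supersolvable (layers (Cn (Suc m)) Av) rev_incl \<longleftrightarrow> supersolvable (layers (Cn m) Bv) rev_incl"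
  using supersolvable_layers_pull[OF proj_image_Cn, of m Bv] by (simp add: pull_Bv)

lemma complement_eq:
  "arr_complement (Cn (Suc m)) A = {x \<in> Cn (Suc m). proj m x \<in> X \<and> (\<forall>g\<in>Gs. x m \<noteq> g (proj m x))}"
proof -
  have "x \<notin> \<Union>A \<longleftrightarrow> proj m x \<in> X \<and> (\<forall>g\<in>Gs. x m \<noteq> g (proj m x))" if x: "x \<in> Cn (Suc m)" for x
  proof -
    have "x \<notin> \<Union>A \<longleftrightarrow> (\<forall>H\<in>Av. x \<notin> H) \<and> (\<forall>H\<in>Ah. x \<notin> H)" by blast
    also have "(\<forall>H\<in>Av. x \<notin> H) \<longleftrightarrow> (\<forall>H\<in>Av. proj m x \<notin> proj m ` H)"
      using vertical_mem[OF _ x] by simp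
    also have "\<dots> \<longleftrightarrow> proj m x \<in> X" using proj_in_Cn by (auto simp: arr_complement_def Bv_def)
    also have "(\<forall>H\<in>Ah. x \<notin> H) \<longleftrightarrow> (\<forall>g\<in>Gs. x m \<noteq> g (proj m x))"
      using horizontal_mem[OF _ x] by simp
    finally show ?thesis .
  qed
  then show ?thesis unfolding arr_complement_def[of "Cn (Suc m)"] by blast
qed

lemma X_subset: "X \<subseteq> Cn m"
  by (auto simp: arr_complement_def)

lemma upd_mem_complement:
  assumes "b \<in> Cn m"
  shows "b(m := z) \<in> arr_complement (Cn (Suc m)) A \<longleftrightarrow> b \<in> X \<and> z \<notin> (\<lambda>g. g b) ` Gs"
  unfolding complement_eq using assms by (auto simp: proj_fun_upd fun_upd_in_Cn)

lemma height_eq_mem: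
  assumes "H \<in> Ah" "b \<in> Cn m" shows "b(m := height H b) \<in> H"
  using horizontal_mem[OF assms(1) fun_upd_in_Cn[OF assms(2)]] by (simp add: proj_fun_upd[OF assms(2)])

lemma height_continuous: "H \<in> Ah \<Longrightarrow> continuous_on X (height H)"
  unfolding height_def using par_iff[OF _ unit_seq_Cn, of H]
  by (intro continuous_intros continuous_on_functional[OF lin X_subset]) auto

text \<open>If two heights agreed over \<open>b\<close>, the common point would lie in a hyperplane
  of \<open>A\<close> parallel to \<open>e\<close>, and the projection of that hyperplane would
  contain \<open>b\<close>.\<close>

lemma fiber_bundle_if_transverse_closed:
  assumes tc: "transverse_closed A e"
  obtains S where "finite S" "fiber_bundle (top_of_set (arr_complement (Cn (Suc m)) A)) (top_of_set X)
    (proj m) (top_of_set (UNIV - S :: complex set))"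
proof (rule fiber_bundle_graph_complement[OF X_subset _ _ _ complement_eq])
  show "finite Gs" using fin by simp
  show "continuous_on X g" if "g \<in> Gs" for g using that height_continuous by auto
  show "inj_on (\<lambda>g. g b) Gs" if b: "b \<in> X" for b
  proof (rule inj_onI, rule ccontr)
    fix g g' assume g: "g \<in> Gs" "g' \<in> Gs" "g b = g' b" "g \<noteq> g'"
    then obtain H K where HK: "H \<in> Ah" "K \<in> Ah" "g = height H" "g' = height K" by blast
    have bC: "b \<in> Cn m" using b X_subset by blast
    let ?x = "b(m := g b)"
    have x: "?x \<in> H \<inter> K" using height_eq_mem[OF HK(1) bC] height_eq_mem[OF HK(2) bC] HK g(3) by simp
    have "H \<noteq> K" using HK(3,4) g(4) by auto
    moreover have "H \<inter> K \<noteq> {}" using x by auto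
    ultimately have "\<exists>L\<in>A. par e L \<and> H \<inter> K \<subseteq> L"
      using tc HK(1,2) unfolding transverse_closed_def by simp
    then obtain L where L: "L \<in> Av" "H \<inter> K \<subseteq> L" by auto
    then have "?x \<in> L" using x by blast
    then have "proj m ?x \<in> proj m ` L" by (rule imageI)
    then have "b \<in> proj m ` L" by (simp add: proj_fun_upd[OF bC])
    then show False using b L(1) by (auto simp: arr_complement_def Bv_def)
  qed
qed (use that in auto)

text \<open>A difference of heights is affine on the base. Were its linear part zero, one
  coincidence would make the heights equal everywhere and hence \<open>H = K\<close>.\<close>

lemma height_diff_hyperplane:
  assumes H: "H \<in> Ah" and K: "K \<in> Ah" and "H \<noteq> K" and ne: "{b \<in> Cn m. height H b = height K b} \<noteq> {}"
  shows "affine_hyperplane fun_scale (Cn m) {b \<in> Cn m. height H b = height K b}"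
proof -
  have HA: "H \<in> A" "ff H e \<noteq> 0" "K \<in> A" "ff K e \<noteq> 0"
    using H K par_iff[OF _ unit_seq_Cn] by auto
  define d where "d b = ff H b / ff H e - ff K b / ff K e" for b
  define c where "c = cc H / ff H e - cc K / ff K e"
  have height: "height H b = height K b \<longleftrightarrow> d b = c" for b
    by (auto simp: height_def d_def c_def diff_divide_distrib algebra_simps)
  have "Vector_Spaces.linear fun_scale (*) d"
    by (rule functionalI)
      (simp_all add: d_def ff_simps[OF HA(1)] ff_simps[OF HA(3)] add_divide_distrib algebra_simps)
  moreover have "\<exists>w\<in>Cn m. d w \<noteq> 0"
  proof (rule ccontr)
    assume "\<not> ?thesis"
    then have "height H b = height K b" if "b \<in> Cn m" for b
      using ne that height by auto
    then have "x \<in> H \<longleftrightarrow> x \<in> K" if "x \<in> Cn (Suc m)" for x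
      using horizontal_mem[OF H that] horizontal_mem[OF K that] proj_in_Cn by simp
    then have "H = K" using hyp_subset HA(1,3) by blast
    then show False using \<open>H \<noteq> K\<close> by simp
  qed
  ultimately show ?thesis unfolding affine_hyperplane_def height by blast
qed

text \<open>Off the vertical hyperplanes and the coincidence loci, which are finitely many hyperplanes of the
  base, all heights are distinct.\<close>

lemma generic_base_point:
  obtains b where "b \<in> X" "inj_on (\<lambda>H. height H b) Ah"
proof -
  let ?K = "\<lambda>(H, K). {b \<in> Cn m. height H b = height K b}"
  \<comment> \<open>Transverse hyperplanes that are disjoint have an empty coincidence locus, which
    is no hyperplane and is therefore removed.\<close>
  define C where "C = Bv \<union> (?K ` {(H, K). H \<in> Ah \<and> K \<in> Ah \<and> H \<noteq> K} - {{}})"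
  have "{(H, K). H \<in> Ah \<and> K \<in> Ah \<and> H \<noteq> K} \<subseteq> A \<times> A" by blast
  then have "finite {(H, K). H \<in> Ah \<and> K \<in> Ah \<and> H \<noteq> K}" using fin finite_subset by blast
  then have "affine_arrangement fun_scale (Cn m) C"
    using Bv_affine height_diff_hyperplane unfolding affine_arrangement_def C_def by auto
  then obtain gg dd where "arrangement m C gg dd" by (rule arrangement_exists)
  then have "arr_complement (Cn m) C \<noteq> {}" by (rule arrangement.complement_nonempty)
  then obtain b where b: "b \<in> Cn m" "b \<notin> \<Union>C" by (auto simp: arr_complement_def)
  have "b \<in> X" using b by (auto simp: arr_complement_def C_def)
  moreover have "inj_on (\<lambda>H. height H b) Ah"
  proof (rule inj_onI, rule ccontr)
    fix H K assume HK: "H \<in> Ah" "K \<in> Ah" "height H b = height K b" "H \<noteq> K"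
    have "b \<in> ?K (H, K)" using b HK by simp
    moreover then have "?K (H, K) \<in> C" unfolding C_def using HK by blast
    ultimately show False using b by blast
  qed
  ultimately show thesis by (rule that)
qed

text \<open>Over a generic base point there are as many punctures as transverse hyperplanes, and the
  homeomorphism type of the fiber keeps this number everywhere. Heights thus never coincide over
  \<open>X\<close>, which forces each coincidence locus into the union of \<open>Bv\<close> and,
  being affine, into a single member of it.\<close>

lemma transverse_closed_if_fiber_bundle:
  assumes B: "affine_arrangement fun_scale (Cn m) B" and S: "finite S"
    and fb: "fiber_bundle (top_of_set (arr_complement (Cn (Suc m)) A))
      (top_of_set (arr_complement (Cn m) B)) (proj m) (top_of_set (UNIV - S :: complex set))"
  shows "B = Bv \<and> transverse_closed A e"
proof -
  let ?E = "arr_complement (Cn (Suc m)) A" and ?Y = "arr_complement (Cn m) B"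
  have YC: "?Y \<subseteq> Cn m" and EC: "?E \<subseteq> Cn (Suc m)" by (auto simp: arr_complement_def)
  have fiber: "(UNIV - S) homeomorphic {z. b(m := z) \<in> ?E}" if "b \<in> ?Y" for b
    using fiber_bundle_fiber[OF fb EC YC that] .
  have finG: "finite Gs" using fin by simp
  \<comment> \<open>The model fiber is nonempty because \<open>S\<close> is finite, and over a point
    of \<open>X\<close> finitely many heights leave room for a point. So both base sets are the
    image of the complement of \<open>A\<close>.\<close>
  have XY: "?Y = X"
  proof (intro equalityI subsetI)
    fix b assume b: "b \<in> ?Y"
    have "infinite (UNIV - S)" using S infinite_UNIV_char_0[where 'a = complex] by simp
    then have "UNIV - S \<noteq> {}" by (metis finite.emptyI)
    then have "{z. b(m := z) \<in> ?E} \<noteq> {}" using homeomorphic_empty(1) fiber[OF b] by metis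
    then show "b \<in> X" using upd_mem_complement[of b] b YC by blast
  next
    fix b assume b: "b \<in> X"
    have bC: "b \<in> Cn m" using b X_subset by blast
    obtain z where "z \<notin> (\<lambda>g. g b) ` Gs" using ex_new_if_finite[OF infinite_UNIV_char_0] finG by blast
    then have "b(m := z) \<in> ?E" using upd_mem_complement[OF bC] b by blast
    moreover have "proj m \<in> ?E \<rightarrow> ?Y"
      using fb by (simp add: fiber_bundle_def continuous_map_def)
    ultimately have "proj m (b(m := z)) \<in> ?Y" by blast
    then show "b \<in> ?Y" by (simp add: proj_fun_upd[OF bC])
  qed
  have card: "card ((\<lambda>g. g b) ` Gs) = card S" if b: "b \<in> X" for b
  proof -
    have "{z. b(m := z) \<in> ?E} = UNIV - (\<lambda>g. g b) ` Gs"
      using upd_mem_complement[of b] b X_subset by blast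
    then show ?thesis using card_punctures_eq[OF S, of "(\<lambda>g. g b) ` Gs"] fiber[of b] b XY finG by simp
  qed
  have sub: "\<Union>B \<subseteq> Cn m" "\<Union>Bv \<subseteq> Cn m"
    using B proj_in_Cn by (auto simp: affine_arrangement_def affine_hyperplane_def Bv_def)
  have U: "\<Union>B = \<Union>Bv" using XY sub unfolding arr_complement_def by blast
  have "B = Bv"
    using arrangement_subset_if_Union_eq[OF B Bv_affine U]
      arrangement_subset_if_Union_eq[OF Bv_affine B U[symmetric]] by (rule subset_antisym)
  moreover have "transverse_closed A e"
    unfolding transverse_closed_def
  proof (intro ballI impI, elim conjE)
    fix H K assume HK: "H \<in> A" "K \<in> A" "H \<noteq> K" "\<not> par e H" "\<not> par e K" "H \<inter> K \<noteq> {}"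
    let ?L = "{b \<in> Cn m. height H b = height K b}"
    have HAh: "H \<in> Ah" "K \<in> Ah" using HK by auto
    have mem_L: "proj m x \<in> ?L" if "x \<in> H" "x \<in> K" for x
    proof -
      have xC: "x \<in> Cn (Suc m)" using that HK(1) hyp_subset by blast
      then show ?thesis
        using horizontal_mem[OF HAh(1) xC] horizontal_mem[OF HAh(2) xC] that proj_in_Cn by simp
    qed
    have ne: "?L \<noteq> {}" using HK(6) mem_L by blast
    have "b \<notin> X" if b: "b \<in> ?L" for b
    proof
      assume bX: "b \<in> X"
      obtain b' where b': "b' \<in> X" "inj_on (\<lambda>H. height H b') Ah" by (rule generic_base_point)
      have fA: "finite Ah" using fin by simp
      have "(\<lambda>g. g b) ` Gs = (\<lambda>H. height H b) ` Ah" "(\<lambda>g. g b') ` Gs = (\<lambda>H. height H b') ` Ah"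
        by (auto simp: image_image)
      then have "card ((\<lambda>H. height H b) ` Ah) = card Ah"
        using card[OF bX] card[OF b'(1)] card_image[OF b'(2)] by simp
      then have "inj_on (\<lambda>H. height H b) Ah" using fA by (rule eq_card_imp_inj_on[rotated])
      then show False using HAh HK(3) b by (auto dest: inj_onD)
    qed
    then have LU: "?L \<subseteq> \<Union>Bv" unfolding arr_complement_def by blast
    have "affine_arrangement fun_scale (Cn m) {?L}"
      using height_diff_hyperplane[OF HAh HK(3) ne] by (simp add: affine_arrangement_def)
    then obtain gg dd where "arrangement m {?L} gg dd" by (rule arrangement_exists)
    then interpret L: arrangement m "{?L}" gg dd .
    obtain g2 d2 where "arrangement m Bv g2 d2" using arrangement_exists[OF Bv_affine] .
    then interpret Bv: arrangement m Bv g2 d2 .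
    have "\<exists>M\<in>Bv. ?L \<subseteq> M"
      by (rule Bv.affine_subset_cover[OF L.hyp_affine _ ne order_refl LU]) auto
    then obtain M where M: "M \<in> Av" "?L \<subseteq> proj m ` M" unfolding Bv_def by blast
    have "x \<in> M" if "x \<in> H \<inter> K" for x
    proof -
      have xC: "x \<in> Cn (Suc m)" using that HK(1) hyp_subset by blast
      then show ?thesis using vertical_mem[OF M(1) xC] mem_L[of x] M(2) that by blast
    qed
    then show "\<exists>M\<in>A. par e M \<and> H \<inter> K \<subseteq> M" using M(1) by blast
  qed
  ultimately show ?thesis by blast
qed

text \<open>A direction common to all of \<open>Bv\<close> is common to the hyperplanes parallel to
  \<open>e\<close>, hence a multiple of \<open>e\<close>; its coordinate of index \<open>m\<close>
  is 0, so the multiple is zero.\<close>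

lemma no_common_direction_Bv:
  assumes "no_common_direction (Cn (Suc m)) A" "transverse_closed A e"
  shows "no_common_direction (Cn m) Bv"
  unfolding no_common_direction_def
proof (intro ballI impI)
  fix w assume w: "w \<in> Cn m" "\<forall>H\<in>Bv. par w H"
  have "e \<noteq> 0" by (auto simp: unit_seq_def fun_eq_iff)
  then interpret T: transverse_arrangement "Suc m" A ff cc e
    by unfold_locales (use assms unit_seq_Cn in auto)
  have wC: "w \<in> Cn (Suc m)" using w(1) by (rule Cn_Suc)
  have "par w H" if H: "H \<in> Av" for H
  proof -
    have "H \<in> A" using H by blast
    have "par w (proj m ` H)" using w(2) H by (auto simp: Bv_def)
    moreover obtain x where "x \<in> H" using hyp_nonempty[OF \<open>H \<in> A\<close>] by blast
    ultimately have "proj m x + w \<in> proj m ` H" "proj m x \<in> proj m ` H" by (auto simp: par_def)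
    then have "ff H (proj m x + w) = cc H" "ff H (proj m x) = cc H"
      using vertical_mem_proj[OF H] by auto
    then have "ff H w = 0" using ff_simps[OF \<open>H \<in> A\<close>] by simp
    then show ?thesis using par_iff[OF \<open>H \<in> A\<close> wC] by simp
  qed
  then obtain t where t: "w = fun_scale t e" using T.common_direction_Q[OF wC] by blast
  have "w m = 0" using w(1) by (simp add: Cn_def)
  then have "t = 0" using t by (simp add: fun_scale_def unit_seq_def)
  then show "w = 0" using t by (simp add: fun_scale_def fun_eq_iff)
qed

end

section \<open>Coordinate changes and the induction on the dimension\<close>

text \<open>Coordinates on a subspace, so that the same transport results serve the abstract space
  and changes of coordinates within \<open>Cn n\<close>.\<close>

locale coordinate_system = vector_space scale
  for scale :: "complex \<Rightarrow> 'v::ab_group_add \<Rightarrow> 'v" +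
  fixes V :: "'v set" and n :: nat and \<phi> :: "'v \<Rightarrow> nat \<Rightarrow> complex"
  assumes sub: "subspace V" and coords: "coordinates scale V n \<phi>"
begin

abbreviation "\<psi> \<equiv> inv_into V \<phi>"
abbreviation "img A \<equiv> (\<lambda>H. \<phi> ` H) ` A"

lemma bij: "bij_betw \<phi> V (Cn n)"
  and phi_add: "x \<in> V \<Longrightarrow> y \<in> V \<Longrightarrow> \<phi> (x + y) = \<phi> x + \<phi> y"
  and phi_scale: "x \<in> V \<Longrightarrow> \<phi> (scale c x) = fun_scale c (\<phi> x)"
  using coords by (auto simp: coordinates_def)

lemma phi_image: "\<phi> ` V = Cn n" and phi_inj: "inj_on \<phi> V"
  using bij by (auto simp: bij_betw_def)

lemma phi_in: "x \<in> V \<Longrightarrow> \<phi> x \<in> Cn n"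
  using phi_image by blast

lemma psi_in: "x \<in> Cn n \<Longrightarrow> \<psi> x \<in> V"
  and phi_psi: "x \<in> Cn n \<Longrightarrow> \<phi> (\<psi> x) = x"
  using phi_image inv_into_into f_inv_into_f by metis+

lemma psi_phi: "x \<in> V \<Longrightarrow> \<psi> (\<phi> x) = x"
  using phi_inj by (rule inv_into_f_f)

lemma phi_0: "\<phi> 0 = 0"
  using phi_add[of 0 0] subspace_0[OF sub] by simp

lemma phi_mem_image: "H \<subseteq> V \<Longrightarrow> x \<in> V \<Longrightarrow> \<phi> x \<in> \<phi> ` H \<longleftrightarrow> x \<in> H"
  using inj_on_image_mem_iff[OF phi_inj] by blast

lemma psi_add: assumes "x \<in> Cn n" "y \<in> Cn n" shows "\<psi> (x + y) = \<psi> x + \<psi> y"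
proof -
  have "x + y = \<phi> (\<psi> x + \<psi> y)" using assms by (simp add: phi_add psi_in phi_psi)
  then show ?thesis using assms by (simp add: psi_phi psi_in subspace_add[OF sub])
qed

lemma psi_scale: assumes "x \<in> Cn n" shows "\<psi> (fun_scale c x) = scale c (\<psi> x)"
proof -
  have "fun_scale c x = \<phi> (scale c (\<psi> x))" using assms by (simp add: phi_scale psi_in phi_psi)
  then show ?thesis using assms by (simp add: psi_phi psi_in subspace_scale[OF sub])
qed

lemma affine_arrangement_img:
  assumes A: "affine_arrangement scale V A"
  shows "affine_arrangement fun_scale (Cn n) (img A)"
  unfolding affine_arrangement_def
proof (intro conjI ballI)
  show "finite (img A)" using A by (simp add: affine_arrangement_def)
  fix K assume "K \<in> img A"
  then obtain H where H: "H \<in> A" "K = \<phi> ` H" by blast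
  then obtain f c w where f: "Vector_Spaces.linear scale (*) f" "w \<in> V" "f w \<noteq> 0" "H = {v \<in> V. f v = c}"
    using A by (auto simp: affine_arrangement_def affine_hyperplane_def)
  \<comment> \<open>\<open>affine_hyperplane\<close> asks for a functional linear on the whole
    sequence type, while \<open>\<psi>\<close> is controlled only on \<open>Cn n\<close>; composing
    with \<open>proj n\<close> extends it.\<close>
  define g where "g x = f (\<psi> (proj n x))" for x
  interpret f: Vector_Spaces.linear scale "(*)" f by (rule f(1))
  have "Vector_Spaces.linear fun_scale (*) g"
    by (rule functionalI)
      (simp_all add: g_def proj_add proj_scale psi_add psi_scale proj_in_Cn f.add f.scale)
  moreover have g_phi: "g (\<phi> v) = f v" if "v \<in> V" for v
    using that by (simp add: g_def proj_id phi_in psi_phi)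
  moreover have "\<phi> w \<in> Cn n" "g (\<phi> w) \<noteq> 0" using g_phi[OF f(2)] f phi_in by auto
  moreover have "K = {x \<in> Cn n. g x = c}"
  proof (intro equalityI subsetI)
    fix x assume "x \<in> K"
    then show "x \<in> {x \<in> Cn n. g x = c}" using H f(4) g_phi phi_in by auto
  next
    fix x assume x: "x \<in> {x \<in> Cn n. g x = c}"
    then have "\<psi> x \<in> H" using f(4) psi_in by (auto simp: g_def proj_id)
    then show "x \<in> K" using H x phi_psi by (metis (no_types, lifting) image_eqI mem_Collect_eq)
  qed
  ultimately show "affine_hyperplane fun_scale (Cn n) K"
    unfolding affine_hyperplane_def by blast
qed

lemma supersolvable_img_iff:
  assumes "\<And>H. H \<in> A \<Longrightarrow> H \<subseteq> V"
  shows "supersolvable (layers (Cn n) (img A)) rev_incl \<longleftrightarrow> supersolvable (layers V A) rev_incl"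
proof -
  have "pull \<phi> V (\<phi> ` H) = H" if "H \<in> A" for H
    using phi_mem_image[OF assms[OF that]] assms[OF that] unfolding pull_def by blast
  then have "pull \<phi> V ` img A = A" by (simp add: image_image)
  then show ?thesis using supersolvable_layers_pull[OF phi_image, of "img A"] by simp
qed

lemma arr_complement_img:
  assumes "\<And>H. H \<in> A \<Longrightarrow> H \<subseteq> V"
  shows "arr_complement (Cn n) (img A) = \<phi> ` arr_complement V A"
proof -
  have "\<Union>A \<subseteq> V" using assms by blast
  then have "\<phi> ` (V - \<Union>A) = \<phi> ` V - \<phi> ` \<Union>A" using inj_on_image_set_diff[OF phi_inj] by blast
  then show ?thesis by (simp add: arr_complement_def phi_image image_Union)
qed

lemma par_img_iff:
  assumes "v \<in> V" "H \<subseteq> V" shows "par (\<phi> v) (\<phi> ` H) \<longleftrightarrow> par v H"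
proof -
  have "\<phi> x + \<phi> v \<in> \<phi> ` H \<longleftrightarrow> x + v \<in> H" if "x \<in> H" for x
  proof -
    have x: "x \<in> V" "x + v \<in> V" using that assms subspace_add[OF sub] by auto
    then have "\<phi> x + \<phi> v = \<phi> (x + v)" using assms phi_add by simp
    then show ?thesis using phi_mem_image[OF assms(2) x(2)] by simp
  qed
  then show ?thesis by (simp add: par_def)
qed

lemma no_common_direction_img:
  assumes A: "\<And>H. H \<in> A \<Longrightarrow> H \<subseteq> V" and ncd: "no_common_direction V A"
  shows "no_common_direction (Cn n) (img A)"
  unfolding no_common_direction_def
proof (intro ballI impI)
  fix x assume x: "x \<in> Cn n" "\<forall>H\<in>img A. par x H"
  then have "par (\<psi> x) H" if "H \<in> A" for H
    using par_img_iff[OF psi_in[OF x(1)] A[OF that]] that by (simp add: phi_psi)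
  then have "\<psi> x = 0" using ncd psi_in[OF x(1)] by (simp add: no_common_direction_def)
  then show "x = 0" using phi_psi[OF x(1)] phi_0 by simp
qed

lemma transverse_closed_img:
  assumes A: "\<And>H. H \<in> A \<Longrightarrow> H \<subseteq> V" and v: "v \<in> V" and tc: "transverse_closed A v"
  shows "transverse_closed (img A) (\<phi> v)"
  unfolding transverse_closed_def
proof (intro ballI impI, elim conjE)
  fix H' K' assume "H' \<in> img A" "K' \<in> img A" and ne: "H' \<noteq> K'" "\<not> par (\<phi> v) H'" "\<not> par (\<phi> v) K'"
    "H' \<inter> K' \<noteq> {}"
  then obtain H K where HK: "H \<in> A" "H' = \<phi> ` H" "K \<in> A" "K' = \<phi> ` K" by blast
  have int: "\<phi> ` H \<inter> \<phi> ` K = \<phi> ` (H \<inter> K)"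
    using inj_on_image_Int[OF phi_inj A[OF HK(1)] A[OF HK(3)]] by simp
  have "H \<noteq> K" "\<not> par v H" "\<not> par v K" "H \<inter> K \<noteq> {}"
    using ne HK int par_img_iff[OF v A[OF HK(1)]] par_img_iff[OF v A[OF HK(3)]] by auto
  then obtain L where L: "L \<in> A" "par v L" "H \<inter> K \<subseteq> L"
    using tc HK(1,3) unfolding transverse_closed_def by metis
  then have "\<phi> ` L \<in> img A" "par (\<phi> v) (\<phi> ` L)" "H' \<inter> K' \<subseteq> \<phi> ` L"
    using par_img_iff[OF v A[OF L(1)]] HK int by auto
  then show "\<exists>L\<in>img A. par (\<phi> v) L \<and> H' \<inter> K' \<subseteq> L" by blast
qed

text \<open>\<open>fibers_over\<close> already quantifies over coordinates, so composing with
  \<open>\<phi>\<close> or its inverse only changes the witness.\<close>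

lemma fibers_over_img_iff:
  assumes A: "\<And>H. H \<in> A \<Longrightarrow> H \<subseteq> V"
  shows "fibers_over fun_scale (Cn n) (img A) k B \<longleftrightarrow> fibers_over scale V A k B"
proof
  assume "fibers_over fun_scale (Cn n) (img A) k B"
  then obtain \<eta> S where \<eta>: "coordinates fun_scale (Cn n) (Suc k) \<eta>" and S: "finite S"
    and fb: "fiber_bundle (top_of_set (\<eta> ` arr_complement (Cn n) (img A)))
          (top_of_set (arr_complement (Cn k) B)) (proj k) (top_of_set (UNIV - S :: complex set))"
    by (auto simp: fibers_over_def)
  have "coordinates scale V (Suc k) (\<eta> \<circ> \<phi>)"
    using \<eta> phi_in phi_add phi_scale bij_betw_trans[OF bij] by (auto simp: coordinates_def)
  moreover have "(\<eta> \<circ> \<phi>) ` arr_complement V A = \<eta> ` arr_complement (Cn n) (img A)"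
    by (simp add: arr_complement_img[OF A] image_comp)
  ultimately show "fibers_over scale V A k B"
    unfolding fibers_over_def using S fb by (intro exI[of _ "\<eta> \<circ> \<phi>"] exI[of _ S]) simp
next
  assume "fibers_over scale V A k B"
  then obtain \<eta> S where \<eta>: "coordinates scale V (Suc k) \<eta>" and S: "finite S"
    and fb: "fiber_bundle (top_of_set (\<eta> ` arr_complement V A))
          (top_of_set (arr_complement (Cn k) B)) (proj k) (top_of_set (UNIV - S :: complex set))"
    by (auto simp: fibers_over_def)
  have "coordinates fun_scale (Cn n) (Suc k) (\<eta> \<circ> \<psi>)"
    using \<eta> psi_in psi_add psi_scale bij_betw_trans[OF bij_betw_inv_into[OF bij]]
    by (auto simp: coordinates_def)
  moreover have "(\<eta> \<circ> \<psi>) ` arr_complement (Cn n) (img A) = \<eta> ` arr_complement V A"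
  proof -
    have "\<psi> ` \<phi> ` arr_complement V A = arr_complement V A"
      using psi_phi by (force simp: arr_complement_def image_image)
    then show ?thesis unfolding image_comp[symmetric] by (simp add: arr_complement_img[OF A])
  qed
  ultimately show "fibers_over fun_scale (Cn n) (img A) k B"
    unfolding fibers_over_def using S fb by (intro exI[of _ "\<eta> \<circ> \<psi>"] exI[of _ S]) simp
qed

end

lemma coordinates_straightening:
  assumes v: "v \<in> Cn (Suc m)" "v \<noteq> 0"
  obtains \<phi> where "coordinates fun_scale (Cn (Suc m)) (Suc m) \<phi>" "\<phi> v = unit_seq m"
proof -
  obtain k where k: "v k \<noteq> 0" using v(2) by (auto simp: fun_eq_iff)
  have km: "k \<le> m" using v(1) k by (auto simp: Cn_def not_less_eq_eq)
  \<comment> \<open>\<open>\<tau>\<close> swaps an index \<open>k\<close> at which \<open>v\<close>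
    is nonzero with the last index.\<close>
  define \<tau> where "\<tau> i = (if i = k then m else if i = m then k else i)" for i
  have \<tau>: "\<tau> (\<tau> i) = i" "\<tau> m = k" "\<tau> k = m" "\<tau> i = k \<longleftrightarrow> i = m" "i > m \<Longrightarrow> \<tau> i = i" for i
    using km by (auto simp: \<tau>_def)
  \<comment> \<open>\<open>x k / v k\<close> is the coefficient of \<open>v\<close>: it becomes the
    last coordinate, and that multiple of \<open>v\<close> is subtracted from the others, so
    \<open>v\<close> goes to the last unit vector. \<open>\<psi>\<close> adds the multiple
    back.\<close>
  define \<phi> where "\<phi> x i = (if i = m then x k / v k else x (\<tau> i) - x k / v k * v (\<tau> i))" for x i
  define \<psi> where "\<psi> z i = z m * v i + (if i = k then 0 else z (\<tau> i))" for z i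
  have "bij_betw \<phi> (Cn (Suc m)) (Cn (Suc m))"
  proof (rule bij_betw_byWitness[where f' = \<psi>])
    show "\<forall>x\<in>Cn (Suc m). \<psi> (\<phi> x) = x"
      using k \<tau> by (auto simp: \<psi>_def \<phi>_def fun_eq_iff) (metis \<tau>(1) \<tau>(2))+
    show "\<forall>z\<in>Cn (Suc m). \<phi> (\<psi> z) = z"
      using k \<tau> by (auto simp: \<psi>_def \<phi>_def fun_eq_iff)
    show "\<phi> ` Cn (Suc m) \<subseteq> Cn (Suc m)" "\<psi> ` Cn (Suc m) \<subseteq> Cn (Suc m)"
      using v(1) \<tau> km by (auto simp: \<psi>_def \<phi>_def Cn_def)
  qed
  moreover have "\<phi> (x + y) = \<phi> x + \<phi> y" for x y
    by (auto simp: \<phi>_def fun_eq_iff add_divide_distrib algebra_simps)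
  moreover have "\<phi> (fun_scale c x) = fun_scale c (\<phi> x)" for c x
    by (auto simp: \<phi>_def fun_scale_def fun_eq_iff algebra_simps)
  ultimately have "coordinates fun_scale (Cn (Suc m)) (Suc m) \<phi>" by (simp add: coordinates_def)
  moreover have "\<phi> v = unit_seq m" using k by (auto simp: \<phi>_def unit_seq_def fun_eq_iff)
  ultimately show thesis by (rule that)
qed

text \<open>In dimension one hyperplanes are points and none is parallel to the line, so the ideal
  of the coordinate direction is the bottom alone; \<open>supersolvable_if_direction\<close> then
  adds the single remaining step.\<close>

lemma supersolvable_line:
  assumes A: "affine_arrangement fun_scale (Cn (Suc 0)) A" and ncd: "no_common_direction (Cn (Suc 0)) A"
  shows "supersolvable (layers (Cn (Suc 0)) A) rev_incl"
proof -
  obtain ff cc where "arrangement (Suc 0) A ff cc" using arrangement_exists[OF A] .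
  then interpret arrangement "Suc 0" A ff cc .
  have e0: "unit_seq 0 \<noteq> 0" "unit_seq 0 \<in> Cn (Suc 0)"
    using unit_seq_Cn[of 0] by (auto simp: unit_seq_def fun_eq_iff)
  have multiple: "x = fun_scale (x 0) (unit_seq 0)" if "x \<in> Cn (Suc 0)" for x
    using that by (auto simp: fun_scale_def unit_seq_def Cn_def fun_eq_iff)
  have ff_e: "ff H (unit_seq 0) \<noteq> 0" if H: "H \<in> A" for H
  proof -
    obtain w where "w \<in> Cn (Suc 0)" "ff H w \<noteq> 0" using nz[OF H] by blast
    then show ?thesis
      using multiple[of w] ff_simps(3)[OF H, of "w 0" "unit_seq 0"] by (metis mult_zero_right)
  qed
  have unique: "x = y" if "H \<in> A" "x \<in> H" "y \<in> H" for H x y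
  proof -
    have xy: "x - y \<in> Cn (Suc 0)" "ff H (x - y) = 0"
      using that by (auto simp: mem_iff ff_simps Cn_closed)
    then have "(x - y) 0 = 0"
      using multiple[OF xy(1)] ff_simps(3)[OF that(1), of "(x - y) 0" "unit_seq 0"] ff_e[OF that(1)]
      by (metis mult_eq_0_iff)
    then have "x - y = 0" using multiple[OF xy(1)] by (simp add: fun_scale_def fun_eq_iff)
    then show ?thesis by simp
  qed
  have tc: "transverse_closed A (unit_seq 0)"
    unfolding transverse_closed_def
  proof (intro ballI impI, elim conjE)
    fix H K assume HK: "H \<in> A" "K \<in> A" "H \<noteq> K" "H \<inter> K \<noteq> {}"
    then obtain x where "x \<in> H" "x \<in> K" by blast
    then have "H = {x}" "K = {x}" using unique[OF HK(1)] unique[OF HK(2)] by blast+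
    then show "\<exists>L\<in>A. par (unit_seq 0) L \<and> H \<inter> K \<subseteq> L" using HK(3) by simp
  qed
  interpret T: transverse_arrangement "Suc 0" A ff cc "unit_seq 0"
    by unfold_locales (use ncd tc e0 in auto)
  have "T.Av = {}" using ff_e par_iff[OF _ e0(2)] by blast
  then have P: "layers (Cn (Suc 0)) T.Av = {Cn (Suc 0)}" using Cn_0 by (auto simp: layers_def)
  then have "poset_rank {Cn (Suc 0)} rev_incl = 0" using T.poset_rank_Q by simp
  then have "supersolvable {Cn (Suc 0)} rev_incl"
    unfolding supersolvable_def
    by (intro exI[of _ 0] exI[of _ "\<lambda>_. {Cn (Suc 0)}"]) (auto simp: bottom_of_def)
  then show ?thesis using T.supersolvable_if_direction P by simp
qed

lemma coordinate_system_Cn: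
  "coordinates fun_scale (Cn n) k \<phi> \<Longrightarrow> coordinate_system fun_scale (Cn n) k \<phi>"
  by (intro coordinate_system.intro coordinate_system_axioms.intro fun_vs.vector_space_axioms subspace_Cn)

text \<open>The induction ranges over all arrangements in \<open>Cn n\<close>, since each step
  passes to a projection in new coordinates. In dimension one both sides hold.\<close>

lemma supersolvable_iff_coord_fiber_type:
  assumes "affine_arrangement fun_scale (Cn n) A" "no_common_direction (Cn n) A" "n \<ge> 1"
  shows "supersolvable (layers (Cn n) A) rev_incl \<longleftrightarrow> coord_fiber_type n A"
  using assms
proof (induction n arbitrary: A)
  case 0
  then show ?case by simp
next
  case (Suc m)
  note A = Suc.prems(1) and ncd = Suc.prems(2)
  have AV: "H \<subseteq> Cn (Suc m)" if "H \<in> A" for H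
    using A that by (auto simp: affine_arrangement_def affine_hyperplane_def)
  show ?case
  proof (cases "m = 0")
    case True
    then show ?thesis using supersolvable_line A ncd coord_fiber_type.line[of A] by simp
  next
    case False
    then have m: "m \<ge> 1" by simp
    show ?thesis
    proof
      assume ss: "supersolvable (layers (Cn (Suc m)) A) rev_incl"
      obtain ff cc where "arrangement (Suc m) A ff cc" using arrangement_exists[OF A] .
      then interpret A: arrangement "Suc m" A ff cc .
      interpret A: essential_arrangement "Suc m" A ff cc by unfold_locales (rule ncd)
      obtain v where v: "v \<in> Cn (Suc m)" "v \<noteq> 0" "transverse_closed A v"
          and ssv: "supersolvable (layers (Cn (Suc m)) {H \<in> A. par v H}) rev_incl"
        using A.supersolvable_imp_direction[OF refl ss] by blast
      obtain \<phi> where \<phi>: "coordinates fun_scale (Cn (Suc m)) (Suc m) \<phi>" "\<phi> v = unit_seq m"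
        using coordinates_straightening[OF v(1,2)] .
      interpret C: coordinate_system fun_scale "Cn (Suc m)" "Suc m" \<phi>
        by (rule coordinate_system_Cn[OF \<phi>(1)])
      have A': "affine_arrangement fun_scale (Cn (Suc m)) (C.img A)" by (rule C.affine_arrangement_img[OF A])
      obtain gg dd where "arrangement (Suc m) (C.img A) gg dd" using arrangement_exists[OF A'] .
      then interpret B: arrangement "Suc m" "C.img A" gg dd .
      interpret B: projected_arrangement m "C.img A" gg dd by unfold_locales
      have tc: "transverse_closed (C.img A) (unit_seq m)"
        using C.transverse_closed_img[OF AV v(1,3)] \<phi>(2) by simp
      have ncd': "no_common_direction (Cn (Suc m)) (C.img A)"
        by (rule C.no_common_direction_img[OF AV ncd])
      have "C.img {H \<in> A. par v H} = B.Av"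
        using C.par_img_iff[OF v(1) AV] \<phi>(2) by auto
      then have "supersolvable (layers (Cn (Suc m)) B.Av) rev_incl"
        using C.supersolvable_img_iff[of "{H \<in> A. par v H}"] AV ssv by auto
      then have "supersolvable (layers (Cn m) B.Bv) rev_incl" using B.supersolvable_Bv_iff by simp
      then have cft: "coord_fiber_type m B.Bv"
        using Suc.IH[OF B.Bv_affine B.no_common_direction_Bv[OF ncd' tc] m] by simp
      obtain S where S: "finite S" "fiber_bundle (top_of_set (arr_complement (Cn (Suc m)) (C.img A)))
          (top_of_set (arr_complement (Cn m) B.Bv)) (proj m) (top_of_set (UNIV - S :: complex set))"
        using B.fiber_bundle_if_transverse_closed[OF tc] .
      \<comment> \<open>The map \<open>\<phi>\<close> that straightens \<open>v\<close> is itself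
        the choice of coordinates demanded by \<open>fibers_over\<close>, so the conclusion concerns
        \<open>A\<close> and not only its image.\<close>
      have "fibers_over fun_scale (Cn (Suc m)) A m B.Bv"
        unfolding fibers_over_def using \<phi>(1) S C.arr_complement_img[OF AV] by auto
      then show "coord_fiber_type (Suc m) A" using coord_fiber_type.step[OF A cft] by simp
    next
      assume "coord_fiber_type (Suc m) A"
      then obtain B where B: "coord_fiber_type m B" "fibers_over fun_scale (Cn (Suc m)) A m B"
        by cases (use False in auto)
      then obtain \<phi> S where \<phi>: "coordinates fun_scale (Cn (Suc m)) (Suc m) \<phi>" and S: "finite S"
        and fb: "fiber_bundle (top_of_set (\<phi> ` arr_complement (Cn (Suc m)) A))
          (top_of_set (arr_complement (Cn m) B)) (proj m) (top_of_set (UNIV - S :: complex set))"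
        by (auto simp: fibers_over_def)
      have BA: "affine_arrangement fun_scale (Cn m) B" using B(1) by cases auto
      interpret C: coordinate_system fun_scale "Cn (Suc m)" "Suc m" \<phi>
        by (rule coordinate_system_Cn[OF \<phi>])
      have A': "affine_arrangement fun_scale (Cn (Suc m)) (C.img A)" by (rule C.affine_arrangement_img[OF A])
      obtain gg dd where "arrangement (Suc m) (C.img A) gg dd" using arrangement_exists[OF A'] .
      then interpret B: arrangement "Suc m" "C.img A" gg dd .
      interpret B: projected_arrangement m "C.img A" gg dd by unfold_locales
      have ncd': "no_common_direction (Cn (Suc m)) (C.img A)"
        by (rule C.no_common_direction_img[OF AV ncd])
      \<comment> \<open>The given base arrangement is arbitrary; the bundle forces it to be the
        projected one, to which the induction hypothesis applies.\<close>
      have tc: "B = B.Bv" "transverse_closed (C.img A) (unit_seq m)"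
        using B.transverse_closed_if_fiber_bundle[OF BA S] fb C.arr_complement_img[OF AV] by auto
      have "supersolvable (layers (Cn m) B.Bv) rev_incl"
        using Suc.IH[OF B.Bv_affine B.no_common_direction_Bv[OF ncd' tc(2)] m] B(1) tc(1) by simp
      then have ssv: "supersolvable (layers (Cn (Suc m)) B.Av) rev_incl"
        using B.supersolvable_Bv_iff by simp
      interpret T: transverse_arrangement "Suc m" "C.img A" gg dd "unit_seq m"
        by unfold_locales
          (use ncd' tc(2) unit_seq_Cn in \<open>auto simp: unit_seq_def fun_eq_iff\<close>)
      have "supersolvable (layers (Cn (Suc m)) (C.img A)) rev_incl"
        by (rule T.supersolvable_if_direction[OF ssv])
      then show "supersolvable (layers (Cn (Suc m)) A) rev_incl"
        using C.supersolvable_img_iff[OF AV] by simp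
    qed
  qed
qed

lemma coordinates_exist:
  fixes scale :: "complex \<Rightarrow> 'v::ab_group_add \<Rightarrow> 'v" and Basis :: "'v set"
  assumes "finite_dimensional_vector_space scale Basis"
  obtains \<phi> where "coordinates scale UNIV (vector_space.dim scale (UNIV :: 'v set)) \<phi>"
proof -
  interpret finite_dimensional_vector_space scale Basis by fact
  define d where "d = card Basis"
  obtain b where b: "bij_betw b {..<d} Basis"
    using ex_bij_betw_nat_finite[OF finite_Basis] by (auto simp: d_def atLeast0LessThan)
  have bB: "b i \<in> Basis" if "i < d" for i using b that by (auto simp: bij_betw_def)
  have b_eq: "b i = b j \<longleftrightarrow> i = j" if "i < d" "j < d" for i j
    using b that by (auto simp: bij_betw_def inj_on_def)
  define \<phi> where "\<phi> v i = (if i < d then representation Basis v (b i) else 0)" for v i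
  define \<psi> where "\<psi> z = (\<Sum>i<d. scale (z i) (b i))" for z
  have "bij_betw \<phi> UNIV (Cn d)"
  proof (rule bij_betw_byWitness[where f' = \<psi>])
    show "\<forall>v\<in>UNIV. \<psi> (\<phi> v) = v"
    proof
      fix v
      have "\<psi> (\<phi> v) = (\<Sum>i<d. scale (representation Basis v (b i)) (b i))"
        by (auto simp: \<psi>_def \<phi>_def intro: sum.cong)
      also have "\<dots> = (\<Sum>x\<in>Basis. scale (representation Basis v x) x)"
        by (rule sum.reindex_bij_betw[OF b])
      also have "\<dots> = v"
        by (rule sum_representation_eq) (auto simp: independent_Basis span_Basis finite_Basis)
      finally show "\<psi> (\<phi> v) = v" .
    qed
    show "\<forall>z\<in>Cn d. \<phi> (\<psi> z) = z"
    proof (intro ballI ext)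
      fix z j assume z: "z \<in> Cn d"
      show "\<phi> (\<psi> z) j = z j"
      proof (cases "j < d")
        case True
        have "representation Basis (\<psi> z) (b j)
            = (\<Sum>i<d. representation Basis (scale (z i) (b i)) (b j))"
          unfolding \<psi>_def by (subst representation_sum) (auto simp: independent_Basis span_Basis)
        also have "\<dots> = (\<Sum>i<d. if i = j then z j else 0)"
          using True bB by (intro sum.cong)
            (auto simp: representation_scale representation_basis independent_Basis span_Basis b_eq)
        also have "\<dots> = z j" using True by simp
        finally show ?thesis using True by (simp add: \<phi>_def)
      next
        case False
        then show ?thesis using z by (simp add: \<phi>_def Cn_def)
      qed
    qed
  qed (auto simp: \<phi>_def Cn_def)
  moreover have "\<phi> (x + y) = \<phi> x + \<phi> y" for x y
    by (auto simp: \<phi>_def fun_eq_iff representation_add independent_Basis span_Basis)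
  moreover have "\<phi> (scale c x) = fun_scale c (\<phi> x)" for c x
    by (auto simp: \<phi>_def fun_eq_iff fun_scale_def representation_scale independent_Basis span_Basis)
  ultimately have "coordinates scale UNIV d \<phi>" by (simp add: coordinates_def)
  then show thesis using that by (simp add: d_def dim_UNIV)
qed

text \<open>A vector killed by every linear part is killed by their span, which is the whole dual;
  the coordinate functionals belong to the dual and separate points.\<close>

lemma (in coordinate_system) no_common_direction_if_essential:
  assumes V: "V = UNIV" and ess: "essential scale A"
  shows "no_common_direction UNIV A"
  unfolding no_common_direction_def
proof (intro ballI impI, rule ccontr)
  fix v assume par: "\<forall>H\<in>A. par v H" and "v \<noteq> 0"
  have "f v = 0" if f: "f \<in> linear_parts scale A" for f
  proof -
    obtain c where c: "{x. f x = c} \<in> A" and lin: "Vector_Spaces.linear scale (*) f" and "f \<noteq> 0"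
      using f by (auto simp: linear_parts_def dual_space_def)
    interpret f: Vector_Spaces.linear scale "(*)" f by (rule lin)
    obtain w where "f w \<noteq> 0" using \<open>f \<noteq> 0\<close> by (auto simp: fun_eq_iff)
    \<comment> \<open>\<open>par\<close> speaks of translating points, so a point of the hyperplane
      is required; a multiple of \<open>w\<close> provides one.\<close>
    then have w: "f (scale (c / f w) w) = c" by (simp add: f.scale)
    have "par v {x. f x = c}" using par c by blast
    then have "scale (c / f w) w + v \<in> {x. f x = c}" using w unfolding par_def by simp
    then show ?thesis using w by (simp add: f.add)
  qed
  then have "linear_parts scale A \<subseteq> {f. f v = 0}" by blast
  moreover have "fun_vs.subspace {f. f v = 0}" by (auto simp: fun_vs.subspace_def fun_scale_def)
  ultimately have "fun_vs.span (linear_parts scale A) \<subseteq> {f. f v = 0}" by (rule fun_vs.span_minimal)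
  then have dual: "f v = 0" if "Vector_Spaces.linear scale (*) f" for f
    using ess that by (auto simp: essential_def dual_space_def)
  have "\<phi> v i = 0" for i
  proof (rule dual)
    show "Vector_Spaces.linear scale (*) (\<lambda>x. \<phi> x i)"
      by unfold_locales (use V phi_add phi_scale in \<open>auto simp: fun_scale_def algebra_simps\<close>)
  qed
  then have "\<phi> v = \<phi> 0" by (simp add: phi_0 fun_eq_iff)
  then show False using inj_onD[OF phi_inj, of v 0] V \<open>v \<noteq> 0\<close> by simp
qed

theorem theorem4p10:
  fixes scale :: "complex \<Rightarrow> 'v::ab_group_add \<Rightarrow> 'v"
    and Basis :: "'v set"
    and A :: "'v set set"
  assumes "finite_dimensional_vector_space scale Basis"
    and "vector_space.dim scale (UNIV :: 'v set) \<ge> 1"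
    and "affine_arrangement scale UNIV A"
    and "essential scale A"
  shows "supersolvable (layers UNIV A) (\<lambda>X Y. Y \<subseteq> X) \<longleftrightarrow> fiber_type scale UNIV A"
proof -
  interpret F: finite_dimensional_vector_space scale Basis by fact
  obtain \<phi> where \<phi>: "coordinates scale UNIV (F.dim UNIV) \<phi>" using coordinates_exist[OF assms(1)] .
  interpret C: coordinate_system scale UNIV "F.dim UNIV" \<phi>
    by unfold_locales (use \<phi> in auto)
  have A': "affine_arrangement fun_scale (Cn (F.dim UNIV)) (C.img A)"
    by (rule C.affine_arrangement_img[OF assms(3)])
  have "no_common_direction (Cn (F.dim UNIV)) (C.img A)"
    using C.no_common_direction_img C.no_common_direction_if_essential[OF refl assms(4)] by simp
  then have "supersolvable (layers UNIV A) (\<lambda>X Y. Y \<subseteq> X) \<longleftrightarrow> coord_fiber_type (F.dim UNIV) (C.img A)"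
    using supersolvable_iff_coord_fiber_type[OF A' _ assms(2)] C.supersolvable_img_iff[of A] by simp
  also have "\<dots> \<longleftrightarrow> fiber_type fun_scale (Cn (F.dim UNIV)) (C.img A)"
    by (rule coord_fiber_type_iff)
  \<comment> \<open>Both definitions split into dimension one and \<open>fibers_over\<close>;
    coordinates preserve the dimension, and \<open>fibers_over\<close> is invariant under
    them.\<close>
  also have "\<dots> \<longleftrightarrow> fiber_type scale UNIV A"
    unfolding fiber_type_def dim_Cn using A' assms(3) C.fibers_over_img_iff[of A] by simp
  finally show ?thesis .
qed

end
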